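(* Let $b\ge 2$ be an integer and let $\mathcal{P}_b\subseteq[0,1)$ be the set of real numbers in $[0,1)$ that are Poisson generic in base $b$. Then $\mathcal{P}_b$ is $\Pi^0_3$-complete in the effective (lightface) Borel hierarchy.
   Context: Each $x\in[0,1)$ is identified with its base-$b$ expansion $x=\sum_{j\ge1}x_jb^{-j}$, $x_j\in\{0,\dots,b-1\}$, with $x_j\neq0$ for infinitely many $j$. For real $r>1$, $x\restriction r$ denotes $x_1\cdots x_{\lfloor r\rfloor}$. Occurrences of words are counted over all starting positions (overlaps allowed). For real $\lambda>0$, integers $j\ge0,k\ge1$, $Z^\lambda_{j,k}(x)=b^{-k}|\{w\in\{0,\dots,b-1\}^k: w\text{ occurs exactly } j\text{ times in } x\restriction(\lambda b^k+k)\}|$; $x$ is Poisson generic in base $b$ if for every real $\lambda>0$ and integer $j\ge0$, $Z^\lambda_{j,k}(x)\to e^{-\lambda}\lambda^j/j!$ as $k\to\infty$. A set of reals is $\Sigma^0_n$ (resp. $\Pi^0_n$) in the effective Borel hierarchy if membership is definable by a $\Sigma^0_n$ (resp. $\Pi^0_n$) formula of second-order arithmetic, i.e. one whose atomic formulas are algebraic identities between integers or membership of the real in intervals with rational endpoints, and whose quantifiers range over integers with the indicated alternation. A set is complete for an effective class if it belongs to the class and every set in the class (e.g. every $\Pi^0_3$ subset of $\omega^\omega$) is reducible to it via a computable map. *)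

theory Defs
  imports Complex_Main "HOL-Library.Nat_Bijection"
begin

section \<open>Poisson generic real numbers\<close>

text \<open>Digit sequences are indexed from 0: \<open>d j\<close> is the digit with weight \<open>b\<close> to the power \<open>-(j+1)\<close>.
  The requirement of infinitely many nonzero digits makes the expansion unique; the number 0 has
  no such expansion (its only expansion 000... is not Poisson generic anyway).\<close>

definition base_expansion :: "nat \<Rightarrow> (nat \<Rightarrow> nat) \<Rightarrow> real \<Rightarrow> bool" where
  "base_expansion b d x \<longleftrightarrow>
     (\<forall>j. d j < b) \<and> infinite {j. d j \<noteq> 0} \<and> (\<lambda>j. real (d j) / real b ^ (j + 1)) sums x"

definition restrict_seq :: "(nat \<Rightarrow> nat) \<Rightarrow> real \<Rightarrow> nat list" where
  "restrict_seq d r = map d [0..<nat \<lfloor>r\<rfloor>]"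

definition occurrences :: "'a list \<Rightarrow> 'a list \<Rightarrow> nat" where
  "occurrences w u =
     card {i. i + length w \<le> length u \<and> take (length w) (drop i u) = w}"

definition Z :: "nat \<Rightarrow> real \<Rightarrow> nat \<Rightarrow> nat \<Rightarrow> (nat \<Rightarrow> nat) \<Rightarrow> real" where
  "Z b lam j k d =
     real (card {w. length w = k \<and> set w \<subseteq> {0..<b} \<and>
                    occurrences w (restrict_seq d (lam * real b ^ k + real k)) = j})
     / real b ^ k"

definition poisson_generic_seq :: "nat \<Rightarrow> (nat \<Rightarrow> nat) \<Rightarrow> bool" where
  "poisson_generic_seq b d \<longleftrightarrow>
     (\<forall>lam>0. \<forall>j. (\<lambda>k. Z b lam j k d) \<longlonglongrightarrow> exp (- lam) * lam ^ j / fact j)"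

definition poisson_generic_reals :: "nat \<Rightarrow> real set" where
  "poisson_generic_reals b =
     {x \<in> {0..<1}. \<exists>d. base_expansion b d x \<and> poisson_generic_seq b d}"

section \<open>Arithmetical formulas with a point parameter\<close>

text \<open>Variables are named by natural numbers and range over the integers. The bounded quantifier
  \<open>BEx v s t \<phi>\<close> says that \<open>\<phi>\<close> holds for some \<open>v\<close> with \<open>s \<le> v \<le> t\<close>; the variable \<open>v\<close> is
  not bound in \<open>s\<close> and \<open>t\<close>. The atom \<open>Mem ts\<close> says that the parameter lies in the basic set
  coded by the values of \<open>ts\<close>.\<close>

datatype tm = Var nat | Const int | Add tm tm | Mul tm tm

datatype fm =
    Eq tm tm
  | Mem "tm list"
  | Neg fm
  | Conj fm fm
  | BEx nat tm tm fm
  | Ex nat fm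
  | All nat fm

primrec tm_val :: "(nat \<Rightarrow> int) \<Rightarrow> tm \<Rightarrow> int" where
  "tm_val e (Var v) = e v"
| "tm_val e (Const c) = c"
| "tm_val e (Add s t) = tm_val e s + tm_val e t"
| "tm_val e (Mul s t) = tm_val e s * tm_val e t"

primrec sat :: "(int list \<Rightarrow> bool) \<Rightarrow> (nat \<Rightarrow> int) \<Rightarrow> fm \<Rightarrow> bool" where
  "sat M e (Eq s t) \<longleftrightarrow> tm_val e s = tm_val e t"
| "sat M e (Mem ts) \<longleftrightarrow> M (map (tm_val e) ts)"
| "sat M e (Neg \<phi>) \<longleftrightarrow> \<not> sat M e \<phi>"
| "sat M e (Conj \<phi> \<psi>) \<longleftrightarrow> sat M e \<phi> \<and> sat M e \<psi>"
| "sat M e (BEx v s t \<phi>) \<longleftrightarrow> (\<exists>i\<in>{tm_val e s..tm_val e t}. sat M (e(v := i)) \<phi>)"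
| "sat M e (Ex v \<phi>) \<longleftrightarrow> (\<exists>i. sat M (e(v := i)) \<phi>)"
| "sat M e (All v \<phi>) \<longleftrightarrow> (\<forall>i. sat M (e(v := i)) \<phi>)"

primrec bounded_fm :: "fm \<Rightarrow> bool" where
  "bounded_fm (Eq s t) \<longleftrightarrow> True"
| "bounded_fm (Mem ts) \<longleftrightarrow> True"
| "bounded_fm (Neg \<phi>) \<longleftrightarrow> bounded_fm \<phi>"
| "bounded_fm (Conj \<phi> \<psi>) \<longleftrightarrow> bounded_fm \<phi> \<and> bounded_fm \<psi>"
| "bounded_fm (BEx v s t \<phi>) \<longleftrightarrow> bounded_fm \<phi>"
| "bounded_fm (Ex v \<phi>) \<longleftrightarrow> False"
| "bounded_fm (All v \<phi>) \<longleftrightarrow> False"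

text \<open>Prenex formulas with \<open>n\<close> alternating, possibly empty, blocks of unbounded quantifiers in front
  of a matrix with bounded quantifiers only.\<close>

inductive Sigma_fm :: "nat \<Rightarrow> fm \<Rightarrow> bool" and Pi_fm :: "nat \<Rightarrow> fm \<Rightarrow> bool" where
  Sigma_0: "bounded_fm \<phi> \<Longrightarrow> Sigma_fm 0 \<phi>"
| Pi_0: "bounded_fm \<phi> \<Longrightarrow> Pi_fm 0 \<phi>"
| Sigma_Suc: "Pi_fm n \<phi> \<Longrightarrow> Sigma_fm (Suc n) \<phi>"
| Sigma_Ex: "Sigma_fm (Suc n) \<phi> \<Longrightarrow> Sigma_fm (Suc n) (Ex v \<phi>)"
| Pi_Suc: "Sigma_fm n \<phi> \<Longrightarrow> Pi_fm (Suc n) \<phi>"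
| Pi_All: "Pi_fm (Suc n) \<phi> \<Longrightarrow> Pi_fm (Suc n) (All v \<phi>)"

section \<open>Effective Borel classes of sets of reals and of subsets of Baire space\<close>

fun real_atom :: "real \<Rightarrow> int list \<Rightarrow> bool" where
  "real_atom x [p, q, r, s] \<longleftrightarrow> x \<in> {of_int p / of_int q <..< of_int r / of_int s}"
| "real_atom x _ \<longleftrightarrow> False"

fun baire_atom :: "(nat \<Rightarrow> nat) \<Rightarrow> int list \<Rightarrow> bool" where
  "baire_atom x [i, j] \<longleftrightarrow> 0 \<le> i \<and> int (x (nat i)) = j"
| "baire_atom x _ \<longleftrightarrow> False"

text \<open>Negated interval atoms are allowed in the matrix, so for sets of reals the lowest levels
  contain sets that are not open resp. closed at rational points. From level 3 on the classes
  coincide with the lightface classes generated from the effectively open sets.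

  Quantifying over all assignments \<open>e\<close> makes \<open>\<phi>\<close> behave as a sentence about \<open>x\<close>.\<close>

definition Pi_real :: "nat \<Rightarrow> real set \<Rightarrow> bool" where
  "Pi_real n A \<longleftrightarrow> (\<exists>\<phi>. Pi_fm n \<phi> \<and> (\<forall>x e. x \<in> A \<longleftrightarrow> sat (real_atom x) e \<phi>))"

definition Pi_baire :: "nat \<Rightarrow> (nat \<Rightarrow> nat) set \<Rightarrow> bool" where
  "Pi_baire n B \<longleftrightarrow> (\<exists>\<phi>. Pi_fm n \<phi> \<and> (\<forall>x e. x \<in> B \<longleftrightarrow> sat (baire_atom x) e \<phi>))"

section \<open>Computable maps from Baire space to the reals\<close>

text \<open>Kleene's partial recursive functions with an oracle: \<open>eval x p ns m\<close> means that \<open>p\<close> with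
  oracle \<open>x\<close> halts on input \<open>ns\<close> with output \<open>m\<close>.\<close>

datatype prog =
    Zero
  | Succ
  | Proj nat
  | Oracle
  | Comp prog "prog list"
  | PrimRec prog prog
  | Mu prog

inductive eval :: "(nat \<Rightarrow> nat) \<Rightarrow> prog \<Rightarrow> nat list \<Rightarrow> nat \<Rightarrow> bool" for x where
  eval_Zero: "eval x Zero ns 0"
| eval_Succ: "eval x Succ [n] (Suc n)"
| eval_Proj: "i < length ns \<Longrightarrow> eval x (Proj i) ns (ns ! i)"
| eval_Oracle: "eval x Oracle [n] (x n)"
| eval_Comp: "list_all2 (\<lambda>q m. eval x q ns m) qs ms \<Longrightarrow> eval x p ms y
    \<Longrightarrow> eval x (Comp p qs) ns y"
| eval_PrimRec_0: "eval x p ns y \<Longrightarrow> eval x (PrimRec p q) (0 # ns) y"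
| eval_PrimRec_Suc: "eval x (PrimRec p q) (n # ns) z \<Longrightarrow> eval x q (n # z # ns) y
    \<Longrightarrow> eval x (PrimRec p q) (Suc n # ns) y"
| eval_Mu: "eval x p (n # ns) 0 \<Longrightarrow> (\<And>i. i < n \<Longrightarrow> \<exists>k. eval x p (i # ns) (Suc k))
    \<Longrightarrow> eval x (Mu p) ns n"

definition computable_map :: "((nat \<Rightarrow> nat) \<Rightarrow> real) \<Rightarrow> bool" where
  "computable_map f \<longleftrightarrow>
     (\<exists>p. \<forall>x n. \<exists>m. eval x p [n] m \<and> \<bar>f x - of_int (int_decode m) / 2 ^ n\<bar> \<le> 1 / 2 ^ n)"

text \<open>The reduced sets live in Baire space; for subsets of the connected space of reals, continuous
  reductions are too scarce.\<close>

definition effectively_Pi_complete :: "nat \<Rightarrow> real set \<Rightarrow> bool" where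
  "effectively_Pi_complete n A \<longleftrightarrow>
     Pi_real n A \<and>
     (\<forall>B. Pi_baire n B \<longrightarrow> (\<exists>f. computable_map f \<and> (\<forall>x. x \<in> B \<longleftrightarrow> f x \<in> A)))"

end

(* Upper bound: the Poisson distribution is the only probability distribution with
   (j+1) p_{j+1} = lambda p_j, so Poisson genericity says that the integers
   q (j+1) A_{j+1} - p A_j are o(b^k) for all rational lambda = p/q, where A_j is the number of words
   of length k with j occurrences. This is a statement of the form "for all, exists, for all" whose
   matrix is computable from comparisons of x with rationals, and computations are arithmetized with
   Goedel's beta function.

   Hardness: for random digits, size biasing makes the expectation of these integers bounded by a
   power of k, and the variance is small because one digit touches only k windows. So the failure
   probabilities are summable, and derandomizing by conditional expectations gives a computable
   Poisson generic sequence z. A Pi_3 set has the form {x. g x s tends to infinity with s} for a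
   computable g. Overwriting the last 1/(g x s + 2) of the first b^s digits of z with ones, for
   all s, leaves o(b^k) windows changed if g x tends to infinity, but spoils the count of missing
   words at scale s infinitely often if g x takes some value infinitely often. *)

theory Submission
  imports Defs "HOL-Number_Theory.Cong" "HOL-Library.Infinite_Set"
begin

text \<open>Real parameters and the transcendental limit cannot be mentioned in a formula about
  integers. The recurrence removes both: rational parameters suffice because the counts vary little
  with lambda, uniformly in the word length, and what remains are exact inequalities between
  integers. The same inequalities define the events avoided by the derandomization, so no numerical
  approximation enters the choice of digits. Deciding length k takes about k b^k digits, so only
  finitely many lengths can be watched at a time. Admitting them late costs an exponential factor,
  but the second moment bound k^12/b^k leaves enough room. Digits are not continuous in x, and only
  comparisons with rationals are available. The strict left cut of x yields exactly the expansion
  with infinitely many nonzero digits. The reduction has to produce such an expansion for every x.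
  For this reason g x s is kept at most s, so that the blocks of ones never become empty at large
  scales; the summand 2 in the denominator keeps each block within half of its prefix.\<close>

section \<open>Closure properties of oracle-computable functions\<close>

text \<open>Environments are infinite, although a program sees only a finite part of them, so that
  arities never have to be tracked. Bound variables are treated in de Bruijn style.\<close>

definition recursive :: "((nat \<Rightarrow> nat) \<Rightarrow> (nat \<Rightarrow> nat) \<Rightarrow> nat) \<Rightarrow> bool" where
  "recursive F \<longleftrightarrow> (\<exists>p m. \<forall>x e. eval x p (map e [0..<m]) (F x e))"

lemma eval_Proj_map:
  assumes "i < m" shows "eval x (Proj i) (map e [0..<m]) (e i)"
  using eval_Proj[of i "map e [0..<m]" x] assms by simp

lemma eval_Comp_map:
  assumes "\<And>i. i < m \<Longrightarrow> eval x (q i) ns (h i)" "eval x p (map h [0..<m]) y"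
  shows "eval x (Comp p (map q [0..<m])) ns y"
  by (rule eval_Comp[OF _ assms(2)]) (auto simp: list_all2_conv_all_nth assms(1))

lemma eval_pad:
  assumes "eval x p (map e [0..<m]) y" "m \<le> M"
  shows "eval x (Comp p (map Proj [0..<m])) (map e [0..<M]) y"
  by (rule eval_Comp_map[where q = Proj, OF eval_Proj_map assms(1)]) (use assms(2) in simp)

lemma recursiveI:
  "(\<And>x e. eval x p (map e [0..<m]) (F x e)) \<Longrightarrow> recursive F"
  unfolding recursive_def by blast

text \<open>The program for \<open>F\<close> reads only its first \<open>m\<close> inputs, so only
  \<open>m\<close> of the infinitely many programs for the \<open>G i\<close> enter the composition,
  and their input lengths have a common bound.\<close>

lemma recursive_subst:
  assumes "recursive F" "\<And>i. recursive (G i)"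
  shows "recursive (\<lambda>x e. F x (\<lambda>i. G i x e))"
proof -
  obtain p m where p: "\<And>x e. eval x p (map e [0..<m]) (F x e)"
    using assms(1) unfolding recursive_def by blast
  have "\<forall>i. \<exists>q k. \<forall>x e. eval x q (map e [0..<k]) (G i x e)"
    using assms(2) unfolding recursive_def by blast
  then obtain q k where q: "\<And>i x e. eval x (q i) (map e [0..<k i]) (G i x e)"
    by metis
  define M where "M = Max (k ` {..<m} \<union> {0})"
  have M: "k i \<le> M" if "i < m" for i
    unfolding M_def using that by (intro Max_ge) auto
  show ?thesis
    by (rule recursiveI[where m = M
          and p = "Comp p (map (\<lambda>i. Comp (q i) (map Proj [0..<k i])) [0..<m])"])
       (rule eval_Comp_map[OF _ p], rule eval_pad[OF q], erule M)
qed

lemma recursive_var [simp]: "recursive (\<lambda>x e. e i)"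
  by (rule recursiveI[where m = "Suc i" and p = "Proj i"]) (rule eval_Proj_map, simp)

lemma recursive_subst1:
  assumes "recursive (\<lambda>x e. f x (e 0))" "recursive A"
  shows "recursive (\<lambda>x e. f x (A x e))"
  using recursive_subst[OF assms(1), of "\<lambda>i. A"] assms(2) by simp

lemma recursive_oracle: "recursive A \<Longrightarrow> recursive (\<lambda>x e. x (A x e))"
  by (rule recursive_subst1[where f = "\<lambda>x. x"])
     (rule recursiveI[where m = 1 and p = Oracle], simp add: eval_Oracle)

lemma recursive_Suc: "recursive A \<Longrightarrow> recursive (\<lambda>x e. Suc (A x e))"
  by (rule recursive_subst1[where f = "\<lambda>_. Suc"])
     (rule recursiveI[where m = 1 and p = Succ], simp add: eval_Succ)

lemma recursive_const: "recursive (\<lambda>x e. c)"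
proof (induction c)
  case 0
  show ?case by (rule recursiveI[where m = 0 and p = Zero]) (simp add: eval_Zero)
qed (rule recursive_Suc)

lemma recursive_shift: "recursive F \<Longrightarrow> recursive (\<lambda>x e. F x (\<lambda>i. e (Suc i)))"
  using recursive_subst[of F "\<lambda>i x e. e (Suc i)"] by simp

lemma recursive_instantiate:
  assumes "recursive (\<lambda>x e. F x (e 0) (\<lambda>i. e (Suc i)))" "recursive A"
  shows "recursive (\<lambda>x e. F x (A x e) e)"
proof -
  have *: "recursive (case i of 0 \<Rightarrow> A | Suc j \<Rightarrow> \<lambda>x e. e j)" for i
    using assms(2) by (cases i) auto
  show ?thesis
    using recursive_subst[OF assms(1), of "\<lambda>i. case i of 0 \<Rightarrow> A | Suc j \<Rightarrow> \<lambda>x e. e j"] * by simp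
qed

text \<open>\<open>PrimRec\<close> passes the counter and the previous value in front of the
  parameters; hence the step function finds them as variables 0 and 1, with the old environment
  shifted by two.\<close>

lemma recursive_rec_nat:
  assumes F: "recursive F" and N: "recursive N"
    and G: "recursive (\<lambda>x e. G x (e 0) (e 1) (\<lambda>i. e (Suc (Suc i))))"
  shows "recursive (\<lambda>x e. rec_nat (F x e) (\<lambda>n z. G x n z e) (N x e))"
proof -
  obtain p m where p: "\<And>x e. eval x p (map e [0..<m]) (F x e)"
    using F unfolding recursive_def by blast
  obtain q k where q: "\<And>x e. eval x q (map e [0..<k]) (G x (e 0) (e 1) (\<lambda>i. e (Suc (Suc i))))"
    using G unfolding recursive_def by blast
  define M where "M = max m k"
  define p' where "p' = Comp p (map Proj [0..<m])"
  define q' where "q' = Comp q (map Proj [0..<k])"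
  have upt: "[0..<Suc n] = 0 # map Suc [0..<n]" for n
    by (simp add: map_Suc_upt upt_conv_Cons)
  have p': "eval x p' (map e [0..<M]) (F x e)" for x e
    unfolding p'_def by (rule eval_pad[OF p]) (simp add: M_def)
  have q': "eval x q' (n # z # map e [0..<M]) (G x n z e)" for x e n z
  proof -
    have "eval x q' (map (case_nat n (case_nat z e)) [0..<Suc (Suc M)]) (G x n z e)"
      unfolding q'_def using eval_pad[OF q[of x "case_nat n (case_nat z e)"], of "Suc (Suc M)"]
      by (simp add: M_def)
    then show ?thesis
      unfolding upt by (simp add: comp_def)
  qed
  have "eval x (PrimRec p' q') (n # map e [0..<M]) (rec_nat (F x e) (\<lambda>n z. G x n z e) n)" for x n e
    by (induction n) (auto intro: eval_PrimRec_0 eval_PrimRec_Suc p' q')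
  then have "eval x (PrimRec p' q') (map e [0..<Suc M])
      (rec_nat (F x (\<lambda>i. e (Suc i))) (\<lambda>n z. G x n z (\<lambda>i. e (Suc i))) (e 0))" for x e
    unfolding upt by (simp add: comp_def)
  then have "recursive (\<lambda>x e. rec_nat (F x (\<lambda>i. e (Suc i))) (\<lambda>n z. G x n z (\<lambda>i. e (Suc i))) (e 0))"
    by (rule recursiveI)
  from recursive_instantiate[OF this N] show ?thesis .
qed

lemma recursive_add:
  assumes "recursive A" "recursive B" shows "recursive (\<lambda>x e. A x e + B x e)"
proof -
  have "a + b = rec_nat a (\<lambda>_ z. Suc z) b" for a b :: nat by (induction b) auto
  then show ?thesis
    by (simp, intro recursive_rec_nat assms recursive_Suc recursive_var)
qed

lemma recursive_mult:
  assumes "recursive A" "recursive B" shows "recursive (\<lambda>x e. A x e * B x e)"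
proof -
  have "a * b = rec_nat 0 (\<lambda>_ z. z + a) b" for a b :: nat by (induction b) auto
  then show ?thesis
    by (simp, intro recursive_rec_nat assms recursive_const recursive_add recursive_var
         recursive_shift[OF recursive_shift[OF assms(1)]])
qed

lemma recursive_power:
  assumes "recursive A" "recursive B" shows "recursive (\<lambda>x e. A x e ^ B x e)"
proof -
  have "a ^ b = rec_nat 1 (\<lambda>_ z. z * a) b" for a b :: nat by (induction b) auto
  then show ?thesis
    by (simp, intro recursive_rec_nat assms recursive_const recursive_mult recursive_var
         recursive_shift[OF recursive_shift[OF assms(1)]])
qed

lemma recursive_pred:
  assumes "recursive A" shows "recursive (\<lambda>x e. A x e - 1)"
proof -
  have "a - 1 = rec_nat 0 (\<lambda>n z. n) a" for a :: nat by (induction a) auto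
  then show ?thesis
    by (simp, intro recursive_rec_nat assms recursive_const recursive_var)
qed

lemma recursive_diff:
  assumes "recursive A" "recursive B" shows "recursive (\<lambda>x e. A x e - B x e)"
proof -
  have *: "a - b = rec_nat a (\<lambda>_ z. z - 1) b" for a b :: nat by (induction b) auto
  have "recursive (\<lambda>x e. rec_nat (A x e) (\<lambda>_ z. z - 1) (B x e))"
    by (intro recursive_rec_nat assms recursive_pred recursive_var)
  then show ?thesis
    unfolding *[symmetric] .
qed

lemma recursive_sum:
  assumes "recursive (\<lambda>x e. F x (e 0) (\<lambda>i. e (Suc i)))" "recursive N"
  shows "recursive (\<lambda>x e. \<Sum>i<N x e. F x i e)"
proof -
  have eq: "(\<Sum>i<n. f i) = rec_nat 0 (\<lambda>i z. z + f i) n" for f :: "nat \<Rightarrow> nat" and n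
    by (induction n) auto
  have "recursive (\<lambda>x e. F x (e 0) (\<lambda>i. e (Suc (Suc i))))"
    using recursive_subst[OF assms(1), of "\<lambda>i x e. e (if i = 0 then 0 else Suc i)"] by simp
  then show ?thesis
    unfolding eq
    by (intro recursive_rec_nat[where G = "\<lambda>x i z e. z + F x i e"] assms(2) recursive_const
        recursive_add recursive_var)
qed

section \<open>Decidable relations and bounded quantifiers\<close>

definition decidable :: "((nat \<Rightarrow> nat) \<Rightarrow> (nat \<Rightarrow> nat) \<Rightarrow> bool) \<Rightarrow> bool" where
  "decidable P \<longleftrightarrow> recursive (\<lambda>x e. of_bool (P x e))"

lemma recursive_of_bool: "decidable P \<Longrightarrow> recursive (\<lambda>x e. of_bool (P x e))"
  unfolding decidable_def .

lemma decidable_le: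
  assumes "recursive A" "recursive B" shows "decidable (\<lambda>x e. A x e \<le> B x e)"
proof -
  have "of_bool (a \<le> b) = 1 - (a - b)" for a b :: nat by auto
  then show ?thesis
    unfolding decidable_def by (simp only:) (intro recursive_diff recursive_const assms)
qed

lemma decidable_less:
  assumes "recursive A" "recursive B" shows "decidable (\<lambda>x e. A x e < B x e)"
  using decidable_le[OF recursive_Suc[OF assms(1)] assms(2)] by (simp add: Suc_le_eq)

lemma decidable_not:
  assumes "decidable P" shows "decidable (\<lambda>x e. \<not> P x e)"
proof -
  have "of_bool (\<not> p) = 1 - (of_bool p :: nat)" for p by auto
  with assms show ?thesis
    unfolding decidable_def by (simp only:) (intro recursive_diff recursive_const)
qed

lemma decidable_conj:
  assumes "decidable P" "decidable Q" shows "decidable (\<lambda>x e. P x e \<and> Q x e)"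
  using assms unfolding decidable_def of_bool_conj by (rule recursive_mult)

lemma decidable_disj:
  assumes "decidable P" "decidable Q" shows "decidable (\<lambda>x e. P x e \<or> Q x e)"
  using decidable_not[OF decidable_conj[OF assms[THEN decidable_not]]] by simp

lemma decidable_imp:
  assumes "decidable P" "decidable Q" shows "decidable (\<lambda>x e. P x e \<longrightarrow> Q x e)"
  unfolding imp_conv_disj by (intro decidable_disj decidable_not assms)

lemma decidable_eq:
  assumes "recursive A" "recursive B" shows "decidable (\<lambda>x e. A x e = B x e)"
  unfolding eq_iff by (intro decidable_conj decidable_le assms)

lemma decidable_const: "decidable (\<lambda>x e. c)"
  unfolding decidable_def by (rule recursive_const)

lemma decidable_ex_less:
  assumes "decidable (\<lambda>x e. P x (e 0) (\<lambda>i. e (Suc i)))" "recursive N"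
  shows "decidable (\<lambda>x e. \<exists>i<N x e. P x i e)"
proof -
  \<comment> \<open>Truncated subtraction from 1, applied twice, maps 0 to 0 and every positive
    number of witnesses to 1.\<close>
  have "of_bool (\<exists>i<n. p i) = (1::nat) - (1 - (\<Sum>i<n. of_bool (p i)))" for p and n :: nat
  proof (cases "\<exists>i<n. p i")
    case True
    then obtain i where "i < n" "p i" by blast
    then have "(of_bool (p i) :: nat) \<le> (\<Sum>i<n. of_bool (p i))"
      by (intro member_le_sum) auto
    then have "1 \<le> (\<Sum>i<n. of_bool (p i) :: nat)" using \<open>p i\<close> by simp
    then show ?thesis using True by simp
  next
    case False
    then have "(\<Sum>i<n. of_bool (p i) :: nat) = 0" by auto
    moreover have "of_bool (\<exists>i<n. p i) = (0::nat)" using False by simp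
    ultimately show ?thesis by linarith
  qed
  moreover have "recursive (\<lambda>x e. 1 - (1 - (\<Sum>i<N x e. of_bool (P x i e))))"
    using assms unfolding decidable_def
    by (intro recursive_diff recursive_const
      recursive_sum[where F = "\<lambda>x i e. of_bool (P x i e)"])
  ultimately show ?thesis
    unfolding decidable_def by presburger
qed

lemma decidable_all_less:
  assumes "decidable (\<lambda>x e. P x (e 0) (\<lambda>i. e (Suc i)))" "recursive N"
  shows "decidable (\<lambda>x e. \<forall>i<N x e. P x i e)"
  using decidable_not[OF decidable_ex_less[where P = "\<lambda>x i e. \<not> P x i e", OF decidable_not[OF assms(1)] assms(2)]]
  by simp

lemma decidable_ex_le:
  assumes "decidable (\<lambda>x e. P x (e 0) (\<lambda>i. e (Suc i)))" "recursive N"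
  shows "decidable (\<lambda>x e. \<exists>i\<le>N x e. P x i e)"
  using decidable_ex_less[OF assms(1) recursive_Suc[OF assms(2)]] by (simp add: less_Suc_eq_le)

lemma decidable_all_le:
  assumes "decidable (\<lambda>x e. P x (e 0) (\<lambda>i. e (Suc i)))" "recursive N"
  shows "decidable (\<lambda>x e. \<forall>i\<le>N x e. P x i e)"
  using decidable_all_less[OF assms(1) recursive_Suc[OF assms(2)]] by (simp add: less_Suc_eq_le)

lemma recursive_if:
  assumes "decidable P" "recursive A" "recursive B"
  shows "recursive (\<lambda>x e. if P x e then A x e else B x e)"
proof -
  have "(if p then a else b) = of_bool p * a + of_bool (\<not> p) * b" for p and a b :: nat by auto
  then show ?thesis
    by (simp only:) (intro recursive_add recursive_mult recursive_of_bool decidable_not assms)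
qed

lemma recursive_div:
  assumes "recursive A" "recursive B" shows "recursive (\<lambda>x e. A x e div B x e)"
proof -
  \<comment> \<open>The quotient is the number of positive multiples of \<open>b\<close> up to
    \<open>a\<close>; for \<open>b = 0\<close> the default value 0 has to be split off.\<close>
  have "a div b = (if b = 0 then 0 else (\<Sum>i<a. of_bool (Suc i * b \<le> a)))" for a b :: nat
  proof (cases "b = 0")
    case False
    then have "Suc i * b \<le> a \<longleftrightarrow> i < a div b" for i
      using less_eq_div_iff_mult_less_eq[of b "Suc i" a] by (simp add: Suc_le_eq)
    then have "{i. i < a \<and> Suc i * b \<le> a} = {..<a div b}"
      using div_le_dividend[of a b] by (auto intro: less_le_trans)
    moreover have "(\<Sum>i<a. of_bool (Suc i * b \<le> a)) = card {i. i < a \<and> Suc i * b \<le> a}"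
      by (simp add: of_bool_def sum.If_cases Int_def)
    ultimately show ?thesis using False by simp
  qed simp
  then show ?thesis
    by (simp only:) (intro recursive_if decidable_eq assms recursive_const recursive_sum
         recursive_of_bool decidable_le recursive_mult recursive_Suc recursive_var
         recursive_shift[OF assms(1)] recursive_shift[OF assms(2)])
qed

lemma recursive_mod:
  assumes "recursive A" "recursive B" shows "recursive (\<lambda>x e. A x e mod B x e)"
  unfolding minus_div_mult_eq_mod[symmetric]
  by (intro recursive_diff recursive_mult recursive_div assms)

lemma recursive_prod_encode:
  assumes "recursive A" "recursive B" shows "recursive (\<lambda>x e. prod_encode (A x e, B x e))"
  unfolding prod_encode_def triangle_def
  by (simp, intro recursive_add recursive_mult recursive_div recursive_const recursive_Suc assms)

lemma le_prod_decode: "fst (prod_decode n) \<le> n" "snd (prod_decode n) \<le> n"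
  using le_prod_encode_1[of "fst (prod_decode n)" "snd (prod_decode n)"]
    le_prod_encode_2[of "snd (prod_decode n)" "fst (prod_decode n)"] by simp_all

text \<open>Unpairing by exhaustive search: both components are at most the code, and exactly one
  pair has a nonzero coefficient, so decoding becomes a bounded sum over encodings.\<close>

lemma prod_decode_sum:
  "fst (prod_decode n) = (\<Sum>i<Suc n. \<Sum>j<Suc n. of_bool (prod_encode (i, j) = n) * i)" (is ?A)
  "snd (prod_decode n) = (\<Sum>i<Suc n. \<Sum>j<Suc n. of_bool (prod_encode (i, j) = n) * j)" (is ?B)
proof -
  obtain i j where ij: "prod_decode n = (i, j)" by fastforce
  then have le: "i \<le> n" "j \<le> n" using le_prod_decode[of n] by simp_all
  have *: "prod_encode (u, v) = n \<longleftrightarrow> u = i \<and> v = j" for u v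
    using ij by (metis prod_decode_inverse prod_encode_inverse prod.inject)
  have inner: "(\<Sum>v<Suc n. of_bool (u = i \<and> v = j) * f u v) = (if u = i then f i j else 0)"
    for u and f :: "nat \<Rightarrow> nat \<Rightarrow> nat"
    using le(2) sum.delta[of "{..<Suc n}" j "\<lambda>v. f i v"]
    by (auto simp: of_bool_def if_distrib[of "\<lambda>c. c * _"] cong: if_cong)
  have "(\<Sum>u<Suc n. \<Sum>v<Suc n. of_bool (prod_encode (u, v) = n) * f u v) = f i j"
    for f :: "nat \<Rightarrow> nat \<Rightarrow> nat"
    unfolding * inner using le(1) sum.delta[of "{..<Suc n}" i "\<lambda>v. f i j"] by simp
  from this[of "\<lambda>u v. u"] this[of "\<lambda>u v. v"] show ?A ?B using ij by simp_all
qed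

lemmas recursive_basic = recursive_var recursive_const recursive_oracle recursive_Suc
  recursive_add recursive_mult recursive_power recursive_diff recursive_div recursive_mod
  recursive_sum recursive_of_bool recursive_if recursive_prod_encode
  decidable_le decidable_less decidable_eq decidable_not decidable_conj decidable_disj
  decidable_imp decidable_const decidable_ex_less decidable_all_less decidable_ex_le
  decidable_all_le

lemma recursive_fst_prod_decode:
  "recursive A \<Longrightarrow> recursive (\<lambda>x e. fst (prod_decode (A x e)))"
  by (rule recursive_subst1[where f = "\<lambda>_ n. fst (prod_decode n)"])
     (unfold prod_decode_sum, intro recursive_basic)

lemma recursive_snd_prod_decode:
  "recursive A \<Longrightarrow> recursive (\<lambda>x e. snd (prod_decode (A x e)))"
  by (rule recursive_subst1[where f = "\<lambda>_ n. snd (prod_decode n)"])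
     (unfold prod_decode_sum, intro recursive_basic)

lemmas recursive_intros = recursive_basic recursive_fst_prod_decode recursive_snd_prod_decode

text \<open>The value depends on \<open>e 0\<close> only, so all further inputs can be fed with
  zeros; this yields the one-argument program that \<open>computable_map\<close> asks for.\<close>

lemma recursive_program:
  assumes "recursive (\<lambda>x e. f x (e 0))"
  shows "\<exists>p. \<forall>x n. eval x p [n] (f x n)"
proof -
  obtain p m where p: "\<And>x e. eval x p (map e [0..<m]) (f x (e 0))"
    using assms unfolding recursive_def by blast
  have "eval x (Comp p (map (\<lambda>i. if i = 0 then Proj 0 else Zero) [0..<m])) [n] (f x n)" for x n
    by (rule eval_Comp_map[OF _ p[of x "\<lambda>i. if i = 0 then n else 0", simplified]])
       (use eval_Proj[of 0 "[n]" x] in \<open>auto intro: eval_Zero\<close>)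
  then show ?thesis by blast
qed

section \<open>Arithmetical definability of computations\<close>

primrec rename_tm :: "(nat \<Rightarrow> nat) \<Rightarrow> tm \<Rightarrow> tm" where
  "rename_tm f (Var v) = Var (f v)"
| "rename_tm f (Const c) = Const c"
| "rename_tm f (Add s t) = Add (rename_tm f s) (rename_tm f t)"
| "rename_tm f (Mul s t) = Mul (rename_tm f s) (rename_tm f t)"

primrec rename_fm :: "(nat \<Rightarrow> nat) \<Rightarrow> fm \<Rightarrow> fm" where
  "rename_fm f (Eq s t) = Eq (rename_tm f s) (rename_tm f t)"
| "rename_fm f (Mem ts) = Mem (map (rename_tm f) ts)"
| "rename_fm f (Neg \<phi>) = Neg (rename_fm f \<phi>)"
| "rename_fm f (Conj \<phi> \<psi>) = Conj (rename_fm f \<phi>) (rename_fm f \<psi>)"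
| "rename_fm f (BEx v s t \<phi>) = BEx (f v) (rename_tm f s) (rename_tm f t) (rename_fm f \<phi>)"
| "rename_fm f (Ex v \<phi>) = Ex (f v) (rename_fm f \<phi>)"
| "rename_fm f (All v \<phi>) = All (f v) (rename_fm f \<phi>)"

lemma tm_val_rename: "tm_val e (rename_tm f t) = tm_val (\<lambda>i. e (f i)) t"
  by (induction t) auto

lemma bounded_fm_rename [simp]: "bounded_fm (rename_fm f \<phi>) = bounded_fm \<phi>"
  by (induction \<phi>) auto

text \<open>Injectivity excludes capture: rebinding \<open>f v\<close> must leave the values of all
  other renamed variables alone.\<close>

lemma sat_rename:
  assumes "inj f"
  shows "sat M e (rename_fm f \<phi>) = sat M (\<lambda>i. e (f i)) \<phi>"
proof -
  have upd: "(\<lambda>i. (e(f v := z)) (f i)) = (\<lambda>i. e (f i))(v := z)" for e :: "nat \<Rightarrow> int" and v z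
    using assms by (auto simp: fun_eq_iff inj_eq)
  show ?thesis
    by (induction \<phi> arbitrary: e) (simp_all only: sat.simps rename_fm.simps tm_val_rename upd map_map o_def)
qed

section \<open>Bounded relations on environments of natural numbers\<close>

definition nat_term :: "((nat \<Rightarrow> nat) \<Rightarrow> nat) \<Rightarrow> bool" where
  "nat_term T \<longleftrightarrow> (\<exists>t m. \<forall>e e'. (\<forall>i<m. e' i = int (e i)) \<longrightarrow> tm_val e' t = int (T e))"

lemma nat_term_var: "nat_term (\<lambda>e. e i)"
  unfolding nat_term_def by (intro exI[of _ "Var i"] exI[of _ "Suc i"]) auto

lemma nat_term_const: "nat_term (\<lambda>e. c)"
  unfolding nat_term_def by (intro exI[of _ "Const (int c)"] exI[of _ "0"]) auto

lemma nat_term_add: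
  assumes "nat_term S" "nat_term T" shows "nat_term (\<lambda>e. S e + T e)"
proof -
  obtain s m t n where
    s: "\<And>e e'. (\<forall>i<m. e' i = int (e i)) \<Longrightarrow> tm_val e' s = int (S e)" and
    t: "\<And>e e'. (\<forall>i<n. e' i = int (e i)) \<Longrightarrow> tm_val e' t = int (T e)"
    using assms unfolding nat_term_def by blast
  show ?thesis
    unfolding nat_term_def
  proof (intro exI allI impI)
    fix e and e' :: "nat \<Rightarrow> int" assume *: "\<forall>i<m + n. e' i = int (e i)"
    have "tm_val e' s = int (S e)" "tm_val e' t = int (T e)"
      using * by (auto intro!: s t)
    then show "tm_val e' (Add s t) = int (S e + T e)" by simp
  qed
qed

lemma nat_term_mult:
  assumes "nat_term S" "nat_term T" shows "nat_term (\<lambda>e. S e * T e)"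
proof -
  obtain s m t n where
    s: "\<And>e e'. (\<forall>i<m. e' i = int (e i)) \<Longrightarrow> tm_val e' s = int (S e)" and
    t: "\<And>e e'. (\<forall>i<n. e' i = int (e i)) \<Longrightarrow> tm_val e' t = int (T e)"
    using assms unfolding nat_term_def by blast
  show ?thesis
    unfolding nat_term_def
  proof (intro exI allI impI)
    fix e and e' :: "nat \<Rightarrow> int" assume *: "\<forall>i<m + n. e' i = int (e i)"
    have "tm_val e' s = int (S e)" "tm_val e' t = int (T e)"
      using * by (auto intro!: s t)
    then show "tm_val e' (Mul s t) = int (S e * T e)" by simp
  qed
qed

lemma nat_term_Suc:
  assumes "nat_term T" shows "nat_term (\<lambda>e. Suc (T e))"
  using nat_term_add[OF assms nat_term_const[of 1]] by simp

text \<open>The relation may depend on finitely many entries of the environment only; this makes all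
  larger indices available as fresh variables.\<close>

definition Delta0 :: "(real \<Rightarrow> (nat \<Rightarrow> nat) \<Rightarrow> bool) \<Rightarrow> bool" where
  "Delta0 P \<longleftrightarrow> (\<exists>\<phi> m. bounded_fm \<phi> \<and>
     (\<forall>y e e'. (\<forall>i<m. e' i = int (e i)) \<longrightarrow> (sat (real_atom y) e' \<phi> \<longleftrightarrow> P y e)))"

lemma Delta0I:
  assumes "bounded_fm \<phi>"
    "\<And>y e e'. (\<And>i. i < m \<Longrightarrow> e' i = int (e i)) \<Longrightarrow> sat (real_atom y) e' \<phi> \<longleftrightarrow> P y e"
  shows "Delta0 P"
  unfolding Delta0_def by (intro exI[of _ \<phi>] exI[of _ m]) (simp add: assms)

lemma Delta0_finite_support:
  assumes "Delta0 P"
  obtains m where "\<And>y e e'. (\<forall>i<m. e i = e' i) \<Longrightarrow> P y e \<longleftrightarrow> P y e'"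
proof -
  obtain \<phi> m where "bounded_fm \<phi>" and
    \<phi>: "\<And>y e e'. (\<forall>i<m. e' i = int (e i)) \<Longrightarrow> sat (real_atom y) e' \<phi> \<longleftrightarrow> P y e"
    using assms unfolding Delta0_def by blast
  have "P y e \<longleftrightarrow> P y e'" if "\<forall>i<m. e i = e' i" for y e e'
    using \<phi>[of "\<lambda>i. int (e i)" e y] \<phi>[of "\<lambda>i. int (e i)" e' y] that by simp
  then show ?thesis by (rule that)
qed

lemma Delta0_eq:
  assumes "nat_term S" "nat_term T" shows "Delta0 (\<lambda>y e. S e = T e)"
proof -
  obtain s m t n where
    s: "\<And>e e'. (\<forall>i<m. e' i = int (e i)) \<Longrightarrow> tm_val e' s = int (S e)" and
    t: "\<And>e e'. (\<forall>i<n. e' i = int (e i)) \<Longrightarrow> tm_val e' t = int (T e)"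
    using assms unfolding nat_term_def by blast
  show ?thesis
  proof (rule Delta0I[of "Eq s t" "m + n"])
    fix y e and e' :: "nat \<Rightarrow> int" assume *: "\<And>i. i < m + n \<Longrightarrow> e' i = int (e i)"
    have "tm_val e' s = int (S e)" "tm_val e' t = int (T e)"
      using * by (auto intro!: s t)
    then show "sat (real_atom y) e' (Eq s t) \<longleftrightarrow> S e = T e" by simp
  qed simp
qed

lemma Delta0_not: assumes "Delta0 P" shows "Delta0 (\<lambda>y e. \<not> P y e)"
proof -
  obtain \<phi> m where "bounded_fm \<phi>"
    "\<And>y e e'. (\<forall>i<m. e' i = int (e i)) \<Longrightarrow> sat (real_atom y) e' \<phi> \<longleftrightarrow> P y e"
    using assms unfolding Delta0_def by blast
  then show ?thesis by (intro Delta0I[of "Neg \<phi>" m]) auto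
qed

lemma Delta0_conj:
  assumes "Delta0 P" "Delta0 Q" shows "Delta0 (\<lambda>y e. P y e \<and> Q y e)"
proof -
  obtain \<phi> m where \<phi>: "bounded_fm \<phi>"
    "\<And>y e e'. (\<forall>i<m. e' i = int (e i)) \<Longrightarrow> sat (real_atom y) e' \<phi> \<longleftrightarrow> P y e"
    using assms(1) unfolding Delta0_def by blast
  obtain \<psi> n where \<psi>: "bounded_fm \<psi>"
    "\<And>y e e'. (\<forall>i<n. e' i = int (e i)) \<Longrightarrow> sat (real_atom y) e' \<psi> \<longleftrightarrow> Q y e"
    using assms(2) unfolding Delta0_def by blast
  show ?thesis
  proof (rule Delta0I[of "Conj \<phi> \<psi>" "m + n"])
    fix y e and e' :: "nat \<Rightarrow> int" assume *: "\<And>i. i < m + n \<Longrightarrow> e' i = int (e i)"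
    have "sat (real_atom y) e' \<phi> \<longleftrightarrow> P y e" "sat (real_atom y) e' \<psi> \<longleftrightarrow> Q y e"
      using * by (auto intro!: \<phi>(2) \<psi>(2))
    then show "sat (real_atom y) e' (Conj \<phi> \<psi>) \<longleftrightarrow> P y e \<and> Q y e" by simp
  qed (simp add: \<phi> \<psi>)
qed

lemma Delta0_disj:
  assumes "Delta0 P" "Delta0 Q" shows "Delta0 (\<lambda>y e. P y e \<or> Q y e)"
  using Delta0_not[OF Delta0_conj[OF assms[THEN Delta0_not]]] by simp

lemma Delta0_const: "Delta0 (\<lambda>y e. c)"
  by (rule Delta0I[of "Eq (Const 0) (Const (if c then 0 else 1))" 0]) auto

text \<open>A renaming that identifies variables could cause capture at the binders. Instead, each
  argument is copied into a fresh variable \<open>M + j\<close> by a bounded quantifier with a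
  one-element range, which keeps the formula bounded.\<close>

primrec copies :: "(nat \<Rightarrow> nat) \<Rightarrow> nat \<Rightarrow> fm \<Rightarrow> nat \<Rightarrow> fm" where
  "copies f M \<phi> 0 = \<phi>"
| "copies f M \<phi> (Suc j) = BEx (M + j) (Var (f j)) (Var (f j)) (copies f M \<phi> j)"

lemma bounded_fm_copies [simp]: "bounded_fm (copies f M \<phi> j) = bounded_fm \<phi>"
  by (induction j) auto

lemma sat_copies:
  assumes "\<And>i. i < j \<Longrightarrow> f i < M"
  shows "sat A e (copies f M \<phi> j) =
    sat A (\<lambda>v. if M \<le> v \<and> v < M + j then e (f (v - M)) else e v) \<phi>"
  using assms
proof (induction j arbitrary: e)
  case (Suc j)
  have "sat A e (copies f M \<phi> (Suc j)) = sat A (e(M + j := e (f j))) (copies f M \<phi> j)"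
    by simp
  also have "\<dots> = sat A (\<lambda>v. if M \<le> v \<and> v < M + j then (e(M + j := e (f j))) (f (v - M))
      else (e(M + j := e (f j))) v) \<phi>"
    using Suc by simp
  also have "(\<lambda>v. if M \<le> v \<and> v < M + j then (e(M + j := e (f j))) (f (v - M))
      else (e(M + j := e (f j))) v) = (\<lambda>v. if M \<le> v \<and> v < M + Suc j then e (f (v - M)) else e v)"
  proof
    fix v
    have "f (v - M) \<noteq> M + j" if "M \<le> v" "v < M + j"
      using Suc.prems[of "v - M"] that by (simp add: less_imp_neq less_diff_conv2 trans_less_add1)
    then show "(if M \<le> v \<and> v < M + j then (e(M + j := e (f j))) (f (v - M))
      else (e(M + j := e (f j))) v) = (if M \<le> v \<and> v < M + Suc j then e (f (v - M)) else e v)"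
      by (auto simp: less_Suc_eq)
  qed
  finally show ?case .
next
  case 0
  have "(\<lambda>v. if M \<le> v \<and> v < M then e (f (v - M)) else e v) = e" by auto
  then show ?case by simp
qed

text \<open>All variables of the formula are first shifted by \<open>M\<close>, beyond every
  \<open>f i\<close> that is read; the copies then load \<open>e (f i)\<close> into
  \<open>M + i\<close>. This works for arbitrary \<open>f\<close>, as manipulations of de Bruijn
  indices require.\<close>

lemma Delta0_rename:
  assumes "Delta0 P" shows "Delta0 (\<lambda>y e. P y (\<lambda>i. e (f i)))"
proof -
  obtain \<phi> m where \<phi>: "bounded_fm \<phi>"
    "\<And>y e e'. (\<forall>i<m. e' i = int (e i)) \<Longrightarrow> sat (real_atom y) e' \<phi> \<longleftrightarrow> P y e"
    using assms unfolding Delta0_def by blast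
  define M where "M = Suc (Max (f ` {..<m} \<union> {0}))"
  have M: "f i < M" if "i < m" for i
    unfolding M_def less_Suc_eq_le using that by (intro Max_ge) auto
  have inj: "inj (\<lambda>i. i + M)" by (auto simp: inj_def)
  show ?thesis
    by (rule Delta0I[of "copies f M (rename_fm (\<lambda>i. i + M) \<phi>) m" M])
       (use \<phi> in \<open>auto simp: M sat_copies[of m f M, OF M] sat_rename[OF inj]\<close>)
qed

lemma Delta0_bex_le:
  assumes "Delta0 (\<lambda>y e. P y (e 0) (\<lambda>i. e (Suc i)))" "nat_term T"
  shows "Delta0 (\<lambda>y e. \<exists>i\<le>T e. P y i e)"
proof -
  define Q where "Q = (\<lambda>y e. P y (e 0) (\<lambda>i. e (Suc i)))"
  have Q: "Delta0 Q" using assms(1) unfolding Q_def .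
  obtain m where m: "\<And>y e e'. (\<forall>i<m. e i = e' i) \<Longrightarrow> Q y e \<longleftrightarrow> Q y e'"
    using Delta0_finite_support[OF Q] by blast
  obtain t n where t: "\<And>e e'. (\<forall>i<n. e' i = int (e i)) \<Longrightarrow> tm_val e' t = int (T e)"
    using assms(2) unfolding nat_term_def by blast
  \<comment> \<open>The de Bruijn variable 0 becomes the named variable \<open>m\<close>. It lies
    beyond the support of \<open>Q\<close>, so binding it changes no other entry that
    \<open>Q\<close> reads.\<close>
  have "Delta0 (\<lambda>y e. Q y (\<lambda>i. e (case_nat m id i)))"
    by (rule Delta0_rename[OF Q])
  then obtain \<psi> k where \<psi>: "bounded_fm \<psi>"
    "\<And>y e e'. (\<forall>i<k. e' i = int (e i)) \<Longrightarrow>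
       sat (real_atom y) e' \<psi> \<longleftrightarrow> Q y (\<lambda>i. e (case_nat m id i))"
    unfolding Delta0_def by blast
  have fresh: "Q y (\<lambda>l. (e(m := i)) (case_nat m id l)) \<longleftrightarrow> P y i e" for y e i
  proof -
    have "Q y (\<lambda>l. (e(m := i)) (case_nat m id l)) \<longleftrightarrow> Q y (case_nat i e)"
      by (rule m) (auto split: nat.split)
    then show ?thesis by (simp add: Q_def)
  qed
  show ?thesis
  proof (rule Delta0I[of "BEx m (Const 0) t \<psi>" "k + n"])
    fix y e and e' :: "nat \<Rightarrow> int"
    assume e': "\<And>i. i < k + n \<Longrightarrow> e' i = int (e i)"
    have inst: "sat (real_atom y) (e'(m := int i)) \<psi> \<longleftrightarrow> P y i e" for i
      unfolding fresh[symmetric] by (rule \<psi>(2)) (use e' in auto)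
    have "tm_val e' t = int (T e)" using t e' by simp
    then have "sat (real_atom y) e' (BEx m (Const 0) t \<psi>) \<longleftrightarrow>
        (\<exists>z\<in>{0..int (T e)}. sat (real_atom y) (e'(m := z)) \<psi>)"
      by simp
    also have "\<dots> \<longleftrightarrow> (\<exists>i\<le>T e. sat (real_atom y) (e'(m := int i)) \<psi>)"
      by (metis atLeastAtMost_iff of_nat_0_le_iff of_nat_le_iff zero_le_imp_eq_int)
    finally show "sat (real_atom y) e' (BEx m (Const 0) t \<psi>) \<longleftrightarrow> (\<exists>i\<le>T e. P y i e)"
      unfolding inst .
  qed (simp add: \<psi>)
qed

lemma Delta0_ball_less:
  assumes "Delta0 (\<lambda>y e. P y (e 0) (\<lambda>i. e (Suc i)))"
  shows "Delta0 (\<lambda>y e. \<forall>i<e j. P y i e)"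
proof -
  have "Delta0 (\<lambda>y e. \<not> (\<exists>i\<le>e j. \<not> i = e j \<and> \<not> P y i e))"
    by (intro Delta0_not Delta0_bex_le Delta0_conj Delta0_eq nat_term_var assms)
  then show ?thesis
    by (rule back_subst[of Delta0]) (auto simp: fun_eq_iff le_less)
qed

section \<open>Sigma_1 relations\<close>

definition Sigma1 :: "(real \<Rightarrow> (nat \<Rightarrow> nat) \<Rightarrow> bool) \<Rightarrow> bool" where
  "Sigma1 P \<longleftrightarrow> (\<exists>Q. Delta0 Q \<and> (\<forall>y e. P y e \<longleftrightarrow> (\<exists>c. Q y (case_nat c e))))"

lemma Sigma1I:
  assumes "Delta0 (\<lambda>y e. Q y (e 0) (\<lambda>i. e (Suc i)))" "\<And>y e. P y e \<longleftrightarrow> (\<exists>c. Q y c e)"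
  shows "Sigma1 P"
  unfolding Sigma1_def using assms by (intro exI[of _ "\<lambda>y e. Q y (e 0) (\<lambda>i. e (Suc i))"]) simp

lemma Sigma1_Delta0: "Delta0 P \<Longrightarrow> Sigma1 P"
  by (rule Sigma1I[of "\<lambda>y c e. P y e"]) (rule Delta0_rename[of P], simp_all)

lemma Delta0_cons:
  assumes "Delta0 Q" shows "Delta0 (\<lambda>y e. Q y (case_nat (e i) (\<lambda>j. e (f j))))"
proof -
  have "(\<lambda>k. e (case_nat i f k)) = case_nat (e i) (\<lambda>j. e (f j))" for e :: "nat \<Rightarrow> nat"
    by (auto split: nat.split)
  with Delta0_rename[OF assms, of "case_nat i f"] show ?thesis by simp
qed

lemma Delta0_cons2:
  assumes "Delta0 Q"
  shows "Delta0 (\<lambda>y e. Q y (case_nat (e i) (case_nat (e i') (\<lambda>j. e (f j)))))"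
proof -
  have "(\<lambda>k. e (case_nat i (case_nat i' f) k)) = case_nat (e i) (case_nat (e i') (\<lambda>j. e (f j)))"
    for e :: "nat \<Rightarrow> nat"
    by (auto split: nat.split)
  with Delta0_rename[OF assms, of "case_nat i (case_nat i' f)"] show ?thesis by simp
qed

lemma Sigma1_rename:
  assumes "Sigma1 P" shows "Sigma1 (\<lambda>y e. P y (\<lambda>i. e (f i)))"
proof -
  obtain Q where Q: "Delta0 Q" "\<And>y e. P y e \<longleftrightarrow> (\<exists>c. Q y (case_nat c e))"
    using assms unfolding Sigma1_def by blast
  show ?thesis
    by (rule Sigma1I[of "\<lambda>y c e. Q y (case_nat c (\<lambda>i. e (f i)))"])
       (simp_all add: Q(2) Delta0_cons[OF Q(1)])
qed

text \<open>Two witnesses are merged by a common upper bound under bounded quantifiers rather than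
  by pairing.\<close>

lemma Sigma1_conj:
  assumes "Sigma1 P" "Sigma1 P'" shows "Sigma1 (\<lambda>y e. P y e \<and> P' y e)"
proof -
  obtain Q where Q: "Delta0 Q" "\<And>y e. P y e \<longleftrightarrow> (\<exists>c. Q y (case_nat c e))"
    using assms unfolding Sigma1_def by blast
  obtain Q' where Q': "Delta0 Q'" "\<And>y e. P' y e \<longleftrightarrow> (\<exists>c. Q' y (case_nat c e))"
    using assms unfolding Sigma1_def by blast
  show ?thesis
  proof (rule Sigma1I[of "\<lambda>y c e. (\<exists>i\<le>c. Q y (case_nat i e)) \<and> (\<exists>i\<le>c. Q' y (case_nat i e))"])
    show "(P y e \<and> P' y e) \<longleftrightarrow> (\<exists>c. (\<exists>i\<le>c. Q y (case_nat i e)) \<and> (\<exists>i\<le>c. Q' y (case_nat i e)))" for y e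
      unfolding Q(2) Q'(2) by (meson max.cobounded1 max.cobounded2)
  qed (intro Delta0_conj Delta0_bex_le nat_term_var Delta0_cons Q Q')
qed

lemma Sigma1_ex:
  assumes "Sigma1 (\<lambda>y e. P y (e 0) (\<lambda>i. e (Suc i)))"
  shows "Sigma1 (\<lambda>y e. \<exists>i. P y i e)"
proof -
  obtain Q where Q: "Delta0 Q" "\<And>y e. P y (e 0) (\<lambda>i. e (Suc i)) \<longleftrightarrow> (\<exists>c. Q y (case_nat c e))"
    using assms unfolding Sigma1_def by blast
  have P: "P y i e \<longleftrightarrow> (\<exists>c. Q y (case_nat c (case_nat i e)))" for y i e
    using Q(2)[of y "case_nat i e"] by simp
  show ?thesis
  proof (rule Sigma1I[of "\<lambda>y c e. \<exists>i\<le>c. \<exists>c'\<le>c. Q y (case_nat c' (case_nat i e))"])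
    show "(\<exists>i. P y i e) \<longleftrightarrow> (\<exists>c. \<exists>i\<le>c. \<exists>c'\<le>c. Q y (case_nat c' (case_nat i e)))" for y e
      unfolding P by (meson max.cobounded1 max.cobounded2)
  qed (intro Delta0_bex_le nat_term_var Delta0_cons2 Q)
qed

text \<open>Collection: finitely many witnesses have a maximum, so the unbounded quantifier can be
  pulled in front of the bounded universal one.\<close>

lemma Sigma1_ball_less:
  assumes "Sigma1 (\<lambda>y e. P y (e 0) (\<lambda>i. e (Suc i)))"
  shows "Sigma1 (\<lambda>y e. \<forall>i<e j. P y i e)"
proof -
  obtain Q where Q: "Delta0 Q" "\<And>y e. P y (e 0) (\<lambda>i. e (Suc i)) \<longleftrightarrow> (\<exists>c. Q y (case_nat c e))"
    using assms unfolding Sigma1_def by blast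
  have P: "P y i e \<longleftrightarrow> (\<exists>c. Q y (case_nat c (case_nat i e)))" for y i e
    using Q(2)[of y "case_nat i e"] by simp
  have collect: "(\<forall>i<n. \<exists>c. R i c) \<longleftrightarrow> (\<exists>d. \<forall>i<n. \<exists>c\<le>d. R i c)" for n :: nat and R :: "nat \<Rightarrow> nat \<Rightarrow> bool"
  proof
    assume "\<forall>i<n. \<exists>c. R i c"
    then obtain h where h: "\<And>i. i < n \<Longrightarrow> R i (h i)" by metis
    have "h i \<le> Max (h ` {..<n})" if "i < n" for i
      using that by (intro Max_ge) auto
    with h show "\<exists>d. \<forall>i<n. \<exists>c\<le>d. R i c" by blast
  qed blast
  show ?thesis
  proof (rule Sigma1I[of "\<lambda>y c e. \<forall>i<e j. \<exists>c'\<le>c. Q y (case_nat c' (case_nat i e))"])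
    show "(\<forall>i<e j. P y i e) \<longleftrightarrow> (\<exists>c. \<forall>i<e j. \<exists>c'\<le>c. Q y (case_nat c' (case_nat i e)))" for y e
      unfolding P by (rule collect)
  qed (intro Delta0_ball_less[of _ "Suc j"] Delta0_bex_le nat_term_var Delta0_cons2 Q)
qed

lemma Sigma1_finite_conj:
  assumes "\<And>j. j < l \<Longrightarrow> Sigma1 (P j)" shows "Sigma1 (\<lambda>y e. \<forall>j<(l::nat). P j y e)"
  using assms
proof (induction l)
  case 0
  show ?case by (rule Sigma1_Delta0) (simp add: Delta0_const)
next
  case (Suc l)
  have "Sigma1 (\<lambda>y e. P l y e \<and> (\<forall>j<l. P j y e))"
    by (intro Sigma1_conj Suc) simp_all
  then show ?case by (simp add: All_less_Suc)
qed

text \<open>Serves to quantify all intermediate results of a composition at once. They precede the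
  other variables, whose indices move up by \<open>l\<close>.\<close>

lemma Sigma1_ex_tuple:
  assumes "Sigma1 P" shows "Sigma1 (\<lambda>y e. \<exists>h. P y (\<lambda>i. if i < l then h i else e (i - l)))"
  using assms
proof (induction l arbitrary: P)
  case (Suc l)
  have "Sigma1 (\<lambda>y e. \<exists>c. P y (\<lambda>i. if i < l then e i else if i = l then c else e (i - 1)))"
  proof (rule Sigma1_ex)
    have "(\<lambda>i. if i < l then e (Suc i) else if i = l then e 0 else e (Suc (i - 1))) =
        (\<lambda>i. e (if i < l then Suc i else if i = l then 0 else i))" for e :: "nat \<Rightarrow> nat"
      by auto
    then show "Sigma1 (\<lambda>y e. P y (\<lambda>i. if i < l then e (Suc i) else if i = l then e 0 else e (Suc (i - 1))))"
      using Sigma1_rename[OF Suc.prems] by simp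
  qed
  from Suc.IH[OF this]
  have "Sigma1 (\<lambda>y e. \<exists>h c. P y (\<lambda>i. if i < l then h i else if i = l then c else e (i - 1 - l)))"
    by (rule back_subst[of Sigma1]) (intro ext iff_exI arg_cong[of _ _ "P _"], auto)
  moreover have "(\<exists>h c. P y (\<lambda>i. if i < l then h i else if i = l then c else e (i - 1 - l))) \<longleftrightarrow>
      (\<exists>h. P y (\<lambda>i. if i < Suc l then h i else e (i - Suc l)))" for y e
  proof
    assume "\<exists>h c. P y (\<lambda>i. if i < l then h i else if i = l then c else e (i - 1 - l))"
    then obtain h c where *: "P y (\<lambda>i. if i < l then h i else if i = l then c else e (i - 1 - l))"
      by blast
    have "(\<lambda>i. if i < l then h i else if i = l then c else e (i - 1 - l)) =
        (\<lambda>i. if i < Suc l then (h(l := c)) i else e (i - Suc l))"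
      by (auto simp: fun_eq_iff)
    with * have "P y (\<lambda>i. if i < Suc l then (h(l := c)) i else e (i - Suc l))"
      by (simp only:)
    then show "\<exists>h. P y (\<lambda>i. if i < Suc l then h i else e (i - Suc l))"
      by blast
  next
    assume "\<exists>h. P y (\<lambda>i. if i < Suc l then h i else e (i - Suc l))"
    then obtain h where *: "P y (\<lambda>i. if i < Suc l then h i else e (i - Suc l))" by blast
    have "(\<lambda>i. if i < Suc l then h i else e (i - Suc l)) =
        (\<lambda>i. if i < l then h i else if i = l then h l else e (i - 1 - l))"
      by (auto simp: fun_eq_iff)
    with * have "P y (\<lambda>i. if i < l then h i else if i = l then h l else e (i - 1 - l))"
      by (simp only:)
    then show "\<exists>h c. P y (\<lambda>i. if i < l then h i else if i = l then c else e (i - 1 - l))"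
      by blast
  qed
  ultimately show ?case by simp
qed simp

lemma nat_term_rename:
  assumes "nat_term T" shows "nat_term (\<lambda>e. T (\<lambda>i. e (f i)))"
proof -
  obtain t m where t: "\<And>e e'. (\<forall>i<m. e' i = int (e i)) \<Longrightarrow> tm_val e' t = int (T e)"
    using assms unfolding nat_term_def by blast
  have "f i < Suc (Max (f ` {..<m} \<union> {0}))" if "i < m" for i
    unfolding less_Suc_eq_le using that by (intro Max_ge) auto
  then show ?thesis
    unfolding nat_term_def
    by (intro exI[of _ "rename_tm f t"] exI[of _ "Suc (Max (f ` {..<m} \<union> {0}))"])
       (auto simp: tm_val_rename intro!: t)
qed

lemmas nat_term_intros = nat_term_var nat_term_const nat_term_Suc nat_term_add nat_term_mult

section \<open>Goedel's beta function\<close>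

definition beta :: "nat \<Rightarrow> nat \<Rightarrow> nat \<Rightarrow> nat" where
  "beta s t i = s mod Suc (Suc i * t)"

text \<open>Arithmetical atoms are equations, so the remainder is described by a quotient
  \<open>q\<close> and its upper bound by a slack \<open>u\<close>, both of them bounded by
  terms.\<close>

lemma beta_eq_iff:
  "beta s t i = r \<longleftrightarrow> (\<exists>q\<le>s. s = q * Suc (Suc i * t) + r) \<and> (\<exists>u\<le>Suc i * t. r + u = Suc i * t)"
    (is "?L \<longleftrightarrow> ?R")
proof
  assume L: ?L
  then have r: "r \<le> Suc i * t" unfolding beta_def
    using mod_less_divisor[of "Suc (Suc i * t)" s] by linarith
  have "s = s div Suc (Suc i * t) * Suc (Suc i * t) + r"
    using L unfolding beta_def by (metis div_mult_mod_eq)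
  moreover have "s div Suc (Suc i * t) \<le> s" by (rule div_le_dividend)
  moreover have "r + (Suc i * t - r) = Suc i * t" using r by linarith
  moreover have "Suc i * t - r \<le> Suc i * t" by linarith
  ultimately show ?R by blast
next
  assume ?R
  then obtain q u where "s = q * Suc (Suc i * t) + r" "r + u = Suc i * t" by blast
  then have "s = q * Suc (Suc i * t) + r" "r < Suc (Suc i * t)" by linarith+
  then show ?L unfolding beta_def by (metis mod_less mod_mult_self3)
qed

lemma Delta0_beta:
  assumes "nat_term S" "nat_term T" "nat_term I" "nat_term R"
  shows "Delta0 (\<lambda>y e. beta (S e) (T e) (I e) = R e)"
  unfolding beta_eq_iff
  by (intro Delta0_conj Delta0_bex_le Delta0_eq nat_term_intros assms assms[THEN nat_term_rename])

text \<open>A common prime divides the difference \<open>(j - i) * fact M\<close>. Since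
  \<open>j - i\<close> is at most \<open>M\<close>, it divides \<open>fact M\<close> in either case,
  and hence 1.\<close>

lemma beta_moduli_coprime:
  assumes "i < j" "j \<le> M"
  shows "coprime (Suc (Suc i * fact M)) (Suc (Suc j * fact M))"
proof (rule ccontr)
  assume "\<not> ?thesis"
  then have "gcd (Suc (Suc i * fact M)) (Suc (Suc j * fact M)) \<noteq> 1"
    unfolding coprime_iff_gcd_eq_1 .
  then obtain p where "prime p" "p dvd gcd (Suc (Suc i * fact M)) (Suc (Suc j * fact M))"
    using prime_factor_nat by blast
  then have p: "prime p" "p dvd Suc (Suc i * fact M)" "p dvd Suc (Suc j * fact M)"
    unfolding gcd_greatest_iff by blast+
  have "Suc (Suc j * fact M) - Suc (Suc i * fact M) = (j - i) * fact M"
    by (simp add: diff_mult_distrib)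
  moreover have "p dvd Suc (Suc j * fact M) - Suc (Suc i * fact M)"
    using p(3,2) by (rule dvd_diff_nat)
  ultimately have "p dvd (j - i) * fact M" by simp
  moreover have "p dvd fact M" if "p dvd j - i"
  proof -
    have "p \<le> M" using dvd_imp_le[OF that] assms by simp
    then show ?thesis using prime_dvd_fact_iff[OF p(1), of M] by blast
  qed
  ultimately have "p dvd fact M" using prime_dvd_mult_iff[OF p(1)] by blast
  then have "p dvd Suc i * fact M" by simp
  then have "p dvd Suc (Suc i * fact M) - Suc i * fact M" using p(2) by (rule dvd_diff_nat[rotated])
  then show False using p(1) by simp
qed

lemma beta_exists: "\<exists>s t. \<forall>i\<le>n. beta s t i = a i"
proof -
  \<comment> \<open>\<open>M\<close> bounds the indices, for the coprimality of the moduli, and also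
    the values, so that every value is its own remainder.\<close>
  define M where "M = n + Max (a ` {..n})"
  have aM: "a i \<le> M" if "i \<le> n" for i
    unfolding M_def using that by (intro trans_le_add2 Max_ge) auto
  have "\<exists>s. \<forall>i\<in>{..n}. [s = a i] (mod Suc (Suc i * fact M))"
  proof (rule chinese_remainder_nat)
    show "\<forall>i\<in>{..n}. \<forall>j\<in>{..n}. i \<noteq> j \<longrightarrow> coprime (Suc (Suc i * fact M)) (Suc (Suc j * fact M))"
      using beta_moduli_coprime[of _ _ M]
      by (metis M_def atMost_iff coprime_commute le_add1 le_trans linorder_neqE_nat)
  qed simp
  then obtain s where s: "\<And>i. i \<le> n \<Longrightarrow> [s = a i] (mod Suc (Suc i * fact M))" by auto
  have "beta s (fact M) i = a i" if "i \<le> n" for i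
  proof -
    have "a i < Suc (Suc i * fact M)"
      using aM[OF that] fact_ge_self[of M] by (simp add: less_Suc_eq_le trans_le_add1)
    then show ?thesis
      using s[OF that] unfolding beta_def cong_def by simp
  qed
  then show ?thesis by blast
qed

section \<open>The left Dedekind cut as an oracle\<close>

text \<open>The upper bound 2 is an artefact of the atoms being bounded intervals; only numbers below 1
  matter.\<close>

definition cut_oracle :: "real \<Rightarrow> nat \<Rightarrow> nat" where
  "cut_oracle y n = of_bool (y \<in> {real (fst (prod_decode n)) / real (snd (prod_decode n)) <..< 2})"

lemma Delta0_cut: "Delta0 (\<lambda>y e. y \<in> {real (e i) / real (e j) <..< 2})"
  by (rule Delta0I[of "Mem [Var i, Var j, Const 2, Const 1]" "Suc (max i j)"]) auto

lemma Delta0_prod_encode: "Delta0 (\<lambda>y e. prod_encode (e i, e j) = e k)"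
proof -
  \<comment> \<open>Doubling clears the division by 2 in the triangular number and leaves a
    polynomial equation.\<close>
  have *: "prod_encode (i, j) = k \<longleftrightarrow> (i + j) * Suc (i + j) + 2 * i = 2 * k" for i j k
    unfolding prod_encode_def triangle_def by (auto elim!: evenE)
  show ?thesis
    unfolding * by (intro Delta0_eq nat_term_intros)
qed

lemma Delta0_cut_oracle: "Delta0 (\<lambda>y e. cut_oracle y (e i) = e j)"
proof -
  have eq: "cut_oracle y n = m \<longleftrightarrow> (\<exists>p\<le>n. \<exists>q\<le>n. prod_encode (p, q) = n \<and>
      (y \<in> {real p / real q <..< 2} \<and> m = 1 \<or> \<not> y \<in> {real p / real q <..< 2} \<and> m = 0))"
    (is "_ \<longleftrightarrow> ?R") for y n m
  proof -
    obtain p q where pq: "prod_decode n = (p, q)" by fastforce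
    then have n: "n = prod_encode (p, q)" by (metis prod_decode_inverse)
    have le: "p \<le> n" "q \<le> n" using le_prod_decode[of n] pq by simp_all
    have "prod_encode (p', q') = n \<longleftrightarrow> p' = p \<and> q' = q" for p' q'
      unfolding n by (metis prod_encode_inverse prod.inject)
    then have "?R \<longleftrightarrow> (y \<in> {real p / real q <..< 2} \<and> m = 1 \<or> \<not> y \<in> {real p / real q <..< 2} \<and> m = 0)"
      using le by auto
    then show ?thesis
      unfolding cut_oracle_def pq by auto
  qed
  show ?thesis
    unfolding eq
    by (intro Delta0_bex_le Delta0_conj Delta0_disj Delta0_not Delta0_eq nat_term_intros
        Delta0_prod_encode Delta0_cut)
qed

section \<open>Inversion of program evaluation\<close>

lemma eval_Zero_iff: "eval x Zero ns m \<longleftrightarrow> m = 0"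
  by (auto elim: eval.cases intro: eval_Zero)

lemma eval_Succ_iff: "eval x Succ ns m \<longleftrightarrow> (\<exists>n. ns = [n] \<and> m = Suc n)"
  by (auto elim: eval.cases intro: eval_Succ)

lemma eval_Proj_iff: "eval x (Proj i) ns m \<longleftrightarrow> i < length ns \<and> m = ns ! i"
  by (auto elim: eval.cases intro: eval_Proj)

lemma eval_Oracle_iff: "eval x Oracle ns m \<longleftrightarrow> (\<exists>n. ns = [n] \<and> m = x n)"
  by (auto elim: eval.cases intro: eval_Oracle)

lemma eval_Comp_iff:
  "eval x (Comp p qs) ns m \<longleftrightarrow>
    (\<exists>h. (\<forall>j<length qs. eval x (qs ! j) ns (h j)) \<and> eval x p (map h [0..<length qs]) m)"
proof
  assume "eval x (Comp p qs) ns m"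
  then obtain ms where ms: "list_all2 (\<lambda>q m. eval x q ns m) qs ms" "eval x p ms m"
    by (auto elim: eval.cases)
  from ms(1) have "length ms = length qs" by (simp add: list_all2_lengthD)
  then have "ms = map (\<lambda>j. ms ! j) [0..<length qs]" by (metis map_nth)
  with ms show "\<exists>h. (\<forall>j<length qs. eval x (qs ! j) ns (h j)) \<and> eval x p (map h [0..<length qs]) m"
    by (intro exI[of _ "\<lambda>j. ms ! j"]) (simp add: list_all2_conv_all_nth)
next
  assume "\<exists>h. (\<forall>j<length qs. eval x (qs ! j) ns (h j)) \<and> eval x p (map h [0..<length qs]) m"
  then show "eval x (Comp p qs) ns m"
    by (auto intro!: eval_Comp simp: list_all2_conv_all_nth)
qed

lemma eval_PrimRec_Nil: "\<not> eval x (PrimRec p q) [] m"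
  by (auto elim: eval.cases)

text \<open>\<open>h\<close> is the history of all intermediate values. Replacing the recursive
  evaluation by the existence of a history is what makes coding by \<open>beta\<close>
  possible.\<close>

lemma eval_PrimRec_iff:
  "eval x (PrimRec p q) (k # ns) m \<longleftrightarrow>
    (\<exists>h. eval x p ns (h 0) \<and> (\<forall>i<k. eval x q (i # h i # ns) (h (Suc i))) \<and> h k = m)"
proof (induction k arbitrary: m)
  case 0
  have "eval x (PrimRec p q) (0 # ns) m \<longleftrightarrow> eval x p ns m"
    by (auto elim: eval.cases intro: eval_PrimRec_0)
  then show ?case by auto
next
  case (Suc k)
  have step: "eval x (PrimRec p q) (Suc k # ns) m \<longleftrightarrow>
      (\<exists>z. eval x (PrimRec p q) (k # ns) z \<and> eval x q (k # z # ns) m)"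
    by (auto elim: eval.cases intro: eval_PrimRec_Suc)
  show ?case
  proof
    assume "eval x (PrimRec p q) (Suc k # ns) m"
    then obtain h where h: "eval x p ns (h 0)" "\<forall>i<k. eval x q (i # h i # ns) (h (Suc i))"
      "eval x q (k # h k # ns) m"
      unfolding step Suc.IH by blast
    then show "\<exists>h. eval x p ns (h 0) \<and> (\<forall>i<Suc k. eval x q (i # h i # ns) (h (Suc i))) \<and> h (Suc k) = m"
      by (intro exI[of _ "h(Suc k := m)"]) (auto simp: less_Suc_eq)
  next
    assume "\<exists>h. eval x p ns (h 0) \<and> (\<forall>i<Suc k. eval x q (i # h i # ns) (h (Suc i))) \<and> h (Suc k) = m"
    then show "eval x (PrimRec p q) (Suc k # ns) m"
      unfolding step Suc.IH by (metis less_Suc_eq)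
  qed
qed

lemma eval_Mu_iff:
  "eval x (Mu p) ns m \<longleftrightarrow> eval x p (m # ns) 0 \<and> (\<forall>i<m. \<exists>k. eval x p (i # ns) (Suc k))"
  by (auto elim: eval.cases intro: eval_Mu)

definition Sigma1_graph :: "prog \<Rightarrow> bool" where
  "Sigma1_graph p \<longleftrightarrow>
    (\<forall>n. Sigma1 (\<lambda>y e. eval (cut_oracle y) p (map (\<lambda>i. e (Suc i)) [0..<n]) (e 0)))"

lemma Sigma1_eval:
  assumes "Sigma1_graph p"
  shows "Sigma1 (\<lambda>y e. eval (cut_oracle y) p (map (\<lambda>i. e (g i)) [0..<n]) (e k))"
proof -
  have "Sigma1 (\<lambda>y e. eval (cut_oracle y) p (map (\<lambda>i. e (Suc i)) [0..<n]) (e 0))"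
    using assms unfolding Sigma1_graph_def by blast
  from Sigma1_rename[OF this, of "case_nat k g"] show ?thesis by simp
qed

text \<open>Induction on programs. Composition quantifies the intermediate results, primitive
  recursion a coded history; minimization relies on collection, because all values before the least
  zero must be defined.\<close>

lemma Sigma1_graph_all: "Sigma1_graph p"
proof (induction p)
  case Zero
  show ?case
    unfolding Sigma1_graph_def eval_Zero_iff
    by (intro allI Sigma1_Delta0 Delta0_eq nat_term_intros)
next
  case Succ
  have "map (\<lambda>i. e (Suc i)) [0..<n] = [k] \<longleftrightarrow> n = 1 \<and> k = e 1" for n k and e :: "nat \<Rightarrow> nat"
    by (cases n; cases "n - 1") (auto simp: upt_conv_Cons)
  then have "(\<exists>k. map (\<lambda>i. e (Suc i)) [0..<n] = [k] \<and> e 0 = Suc k) \<longleftrightarrow> n = 1 \<and> e 0 = Suc (e 1)"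
    for n and e :: "nat \<Rightarrow> nat" by auto
  then show ?case
    unfolding Sigma1_graph_def eval_Succ_iff
    by (simp only:) (intro allI Sigma1_Delta0 Delta0_conj Delta0_const Delta0_eq nat_term_intros)
next
  case (Proj j)
  have "j < length (map (\<lambda>i. e (Suc i)) [0..<n]) \<and> e 0 = map (\<lambda>i. e (Suc i)) [0..<n] ! j
    \<longleftrightarrow> j < n \<and> e 0 = e (Suc j)" for n and e :: "nat \<Rightarrow> nat" by auto
  then show ?case
    unfolding Sigma1_graph_def eval_Proj_iff
    by (simp only:) (intro allI Sigma1_Delta0 Delta0_conj Delta0_const Delta0_eq nat_term_intros)
next
  case Oracle
  have "map (\<lambda>i. e (Suc i)) [0..<n] = [k] \<longleftrightarrow> n = 1 \<and> k = e 1" for n k and e :: "nat \<Rightarrow> nat"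
    by (cases n; cases "n - 1") (auto simp: upt_conv_Cons)
  then have "(\<exists>k. map (\<lambda>i. e (Suc i)) [0..<n] = [k] \<and> e 0 = x k) \<longleftrightarrow> n = 1 \<and> x (e 1) = e 0"
    for n and x e :: "nat \<Rightarrow> nat" by auto
  then show ?case
    unfolding Sigma1_graph_def eval_Oracle_iff
    by (simp only:) (intro allI Sigma1_Delta0 Delta0_conj Delta0_const Delta0_cut_oracle)
next
  case (Comp p qs)
  show ?case
    unfolding Sigma1_graph_def
  proof
    fix n
    define l where "l = length qs"
    have args: "Sigma1 (\<lambda>y e. (\<forall>j<l. eval (cut_oracle y) (qs ! j) (map (\<lambda>i. e (l + Suc i)) [0..<n]) (e j)) \<and>
        eval (cut_oracle y) p (map (\<lambda>i. e i) [0..<l]) (e l))"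
      using Comp by (intro Sigma1_conj Sigma1_finite_conj Sigma1_eval) (auto simp: l_def)
    have tuple: "map (\<lambda>i. if i < l then h i else e (i - l)) [0..<l] = map h [0..<l]" for h e :: "nat \<Rightarrow> nat"
      by simp
    show "Sigma1 (\<lambda>y e. eval (cut_oracle y) (Comp p qs) (map (\<lambda>i. e (Suc i)) [0..<n]) (e 0))"
      unfolding eval_Comp_iff l_def[symmetric]
      using Sigma1_ex_tuple[OF args, of l] by (simp add: tuple)
  qed
next
  case (PrimRec p q)
  show ?case
    unfolding Sigma1_graph_def
  proof
    fix n
    show "Sigma1 (\<lambda>y e. eval (cut_oracle y) (PrimRec p q) (map (\<lambda>i. e (Suc i)) [0..<n]) (e 0))"
    proof (cases n)
      case 0
      then show ?thesis by (simp add: eval_PrimRec_Nil Sigma1_Delta0 Delta0_const)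
    next
      case (Suc n')
      have lists: "map (\<lambda>i. e (Suc i)) [0..<Suc n'] = e 1 # map (\<lambda>i. e (Suc (Suc i))) [0..<n']"
        "i # z # map (\<lambda>i. e (Suc (Suc i))) [0..<n'] =
           map (\<lambda>j. case_nat i (case_nat z (\<lambda>i. e (Suc (Suc i)))) j) [0..<Suc (Suc n')]"
        for e :: "nat \<Rightarrow> nat" and i z
        by (simp_all add: upt_conv_Cons map_Suc_upt[symmetric] comp_def del: upt_Suc)
      \<comment> \<open>Every value is named by an extra existential variable, because
        \<open>Sigma1_eval\<close> accepts only variables as inputs and output.\<close>
      have seq: "eval x (PrimRec p q) (k # ns) m \<longleftrightarrow>
        (\<exists>s t. (\<exists>z. beta s t 0 = z \<and> eval x p ns z) \<and>
          (\<forall>i<k. \<exists>z z'. beta s t i = z \<and> beta s t (Suc i) = z' \<and> eval x q (i # z # ns) z') \<and>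
          beta s t k = m)" (is "_ \<longleftrightarrow> ?R") for x k ns m
      proof
        assume "eval x (PrimRec p q) (k # ns) m"
        then obtain h where h: "eval x p ns (h 0)" "\<forall>i<k. eval x q (i # h i # ns) (h (Suc i))" "h k = m"
          unfolding eval_PrimRec_iff by blast
        obtain s t where "\<forall>i\<le>k. beta s t i = h i" using beta_exists by blast
        with h show ?R by (intro exI[of _ s] exI[of _ t]) auto
      next
        assume ?R
        then obtain s t where "eval x p ns (beta s t 0)"
          "\<forall>i<k. eval x q (i # beta s t i # ns) (beta s t (Suc i))" "beta s t k = m"
          by auto
        then show "eval x (PrimRec p q) (k # ns) m"
          unfolding eval_PrimRec_iff by blast
      qed
      have q: "Sigma1 (\<lambda>y e. eval (cut_oracle y) q (map (case_nat (e i) (case_nat (e z) (\<lambda>i. e (f i))))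
          [0..<Suc (Suc n')]) (e z'))" for i z z' f
      proof -
        have "(\<lambda>j. e (case_nat i (case_nat z f) j)) = case_nat (e i) (case_nat (e z) (\<lambda>i. e (f i)))"
          for e :: "nat \<Rightarrow> nat"
          by (auto split: nat.split)
        then show ?thesis
          using Sigma1_eval[OF PrimRec.IH(2), of "case_nat i (case_nat z f)" "Suc (Suc n')" z'] by simp
      qed
      show ?thesis
        unfolding Suc lists(1) seq unfolding lists(2)
        by (intro Sigma1_ex Sigma1_conj Sigma1_ball_less Sigma1_Delta0[OF Delta0_beta] nat_term_intros
            Sigma1_eval[OF PrimRec.IH(1)] q)
    qed
  qed
next
  case (Mu p)
  show ?case
    unfolding Sigma1_graph_def
  proof
    fix n
    have list: "i # map (\<lambda>i. e (Suc i)) [0..<n] = map (\<lambda>j. case_nat i (\<lambda>i. e (Suc i)) j) [0..<Suc n]"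
      for e :: "nat \<Rightarrow> nat" and i
      by (simp add: upt_conv_Cons map_Suc_upt[symmetric] comp_def del: upt_Suc)
    have p: "Sigma1 (\<lambda>y e. eval (cut_oracle y) p (map (case_nat (e i) (\<lambda>i. e (f i)))
        [0..<Suc n]) (e z))" for i z f
    proof -
      have "(\<lambda>j. e (case_nat i f j)) = case_nat (e i) (\<lambda>i. e (f i))" for e :: "nat \<Rightarrow> nat"
        by (auto split: nat.split)
      then show ?thesis
        using Sigma1_eval[OF Mu.IH, of "case_nat i f" "Suc n" z] by simp
    qed
    have eq: "eval x (Mu p) ns m \<longleftrightarrow> (\<exists>z. z = 0 \<and> eval x p (m # ns) z) \<and>
        (\<forall>i<m. \<exists>k k'. k' = Suc k \<and> eval x p (i # ns) k')" for x ns m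
      unfolding eval_Mu_iff by simp
    show "Sigma1 (\<lambda>y e. eval (cut_oracle y) (Mu p) (map (\<lambda>i. e (Suc i)) [0..<n]) (e 0))"
      unfolding eq list
      by (intro Sigma1_ex Sigma1_conj Sigma1_ball_less Sigma1_Delta0[OF Delta0_eq] nat_term_intros p)
  qed
qed

text \<open>Determinism makes output 0 of a characteristic function exclude output 1, so that the
  failure of a decidable relation is Sigma_1.\<close>

lemma eval_functional: "eval x p ns m \<Longrightarrow> eval x p ns m' \<Longrightarrow> m = m'"
proof (induction p arbitrary: ns m m')
  case (Comp p qs)
  obtain h where h: "\<forall>j<length qs. eval x (qs ! j) ns (h j)" "eval x p (map h [0..<length qs]) m"
    using Comp.prems(1) unfolding eval_Comp_iff by blast
  obtain h' where h': "\<forall>j<length qs. eval x (qs ! j) ns (h' j)" "eval x p (map h' [0..<length qs]) m'"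
    using Comp.prems(2) unfolding eval_Comp_iff by blast
  have "map h [0..<length qs] = map h' [0..<length qs]"
    using h(1) h'(1) Comp.IH(2)[OF nth_mem] by auto
  with h(2) h'(2) Comp.IH(1) show ?case by simp
next
  case (PrimRec p q)
  show ?case
  proof (cases ns)
    case Nil
    then show ?thesis using PrimRec.prems by (simp add: eval_PrimRec_Nil)
  next
    case (Cons k ns')
    obtain h where h: "eval x p ns' (h 0)" "\<forall>i<k. eval x q (i # h i # ns') (h (Suc i))" "h k = m"
      using PrimRec.prems(1) unfolding Cons eval_PrimRec_iff by blast
    obtain h' where h': "eval x p ns' (h' 0)" "\<forall>i<k. eval x q (i # h' i # ns') (h' (Suc i))" "h' k = m'"
      using PrimRec.prems(2) unfolding Cons eval_PrimRec_iff by blast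
    have "h i = h' i" if "i \<le> k" for i
      using that
    proof (induction i)
      case 0
      then show ?case using PrimRec.IH(1) h(1) h'(1) by blast
    next
      case (Suc i)
      then have i: "i < k" and eq: "h i = h' i" by simp_all
      have "eval x q (i # h i # ns') (h (Suc i))" "eval x q (i # h' i # ns') (h' (Suc i))"
        using h(2) h'(2) i by blast+
      with eq show ?case using PrimRec.IH(2) by metis
    qed
    then show ?thesis using h(3) h'(3) by blast
  qed
next
  case (Mu p)
  have "\<not> m < m'" "\<not> m' < m"
    using Mu unfolding eval_Mu_iff by (metis nat.distinct(1))+
  then show ?case by simp
qed (auto simp: eval_Zero_iff eval_Succ_iff eval_Proj_iff eval_Oracle_iff)

section \<open>Pi_3 sets of reals from decidable relations\<close>

definition nonneg_fm :: "nat \<Rightarrow> fm" where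
  "nonneg_fm v = BEx v (Const 0) (Var v) (Eq (Const 0) (Const 0))"

text \<open>The bounds of \<open>BEx\<close> are evaluated before \<open>v\<close> is rebound, so
  the range runs from 0 to the old value of \<open>v\<close>.\<close>

lemma sat_nonneg_fm: "sat M e (nonneg_fm v) \<longleftrightarrow> 0 \<le> e v" "bounded_fm (nonneg_fm v)"
  unfolding nonneg_fm_def by auto

lemma all_int_nonneg: "(\<forall>i. 0 \<le> i \<longrightarrow> P i) \<longleftrightarrow> (\<forall>n. P (int n))"
  by (metis of_nat_0_le_iff zero_le_imp_eq_int)

lemma ex_int_nonneg: "(\<exists>i. 0 \<le> i \<and> P i) \<longleftrightarrow> (\<exists>n. P (int n))"
  by (metis of_nat_0_le_iff zero_le_imp_eq_int)

text \<open>The failure of \<open>R\<close> is Sigma_1. Negating it leaves one further universal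
  quantifier, over the witness \<open>w\<close>, which joins the innermost block, so three blocks
  are enough.\<close>

lemma Pi_real_3I:
  assumes R: "decidable (\<lambda>x e. R x (e 0) (e 1) (e 2))"
    and A: "\<And>x. x \<in> A \<longleftrightarrow> x \<in> {0<..<1} \<and> (\<forall>a. \<exists>b. \<forall>c. R (cut_oracle x) a b c)"
  shows "Pi_real 3 A"
proof -
  obtain p m where p: "\<And>x e. eval x p (map e [0..<m]) (of_bool (R x (e 0) (e 1) (e 2)))"
    using R unfolding decidable_def recursive_def by blast
  have p0: "eval x p (map e [0..<m]) 0 \<longleftrightarrow> \<not> R x (e 0) (e 1) (e 2)" for x e
    using p[of x e] eval_functional[of x p "map e [0..<m]" 0] by (auto simp: of_bool_def split: if_splits)
  \<comment> \<open>The program may read more than three inputs, on which \<open>R\<close> does not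
    depend; \<open>min i 2\<close> fills them with entry 2.\<close>
  have "Sigma1 (\<lambda>y e. \<exists>z. z = 0 \<and> eval (cut_oracle y) p (map (\<lambda>i. e (min i 2)) [0..<m]) z)"
    by (intro Sigma1_ex Sigma1_conj Sigma1_Delta0[OF Delta0_eq] nat_term_intros Sigma1_eval
        Sigma1_graph_all)
  then obtain Q where Q: "Delta0 Q" "\<And>y e. (\<exists>z. z = 0 \<and> eval (cut_oracle y) p (map (\<lambda>i. e (min i 2)) [0..<m]) z)
      \<longleftrightarrow> (\<exists>w. Q y (case_nat w e))"
    unfolding Sigma1_def by blast
  obtain \<phi> k where \<phi>: "bounded_fm \<phi>"
    "\<And>y e e'. (\<forall>i<k. e' i = int (e i)) \<Longrightarrow> sat (real_atom y) e' \<phi> \<longleftrightarrow> Q y e"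
    using Q(1) unfolding Delta0_def by blast
  \<comment> \<open>The matrix may look at entries beyond 3. They are loaded from variable 1, so
    that the final formula does not depend on the assignment.\<close>
  define \<psi> where "\<psi> = copies (\<lambda>_. 1) 4 \<phi> k"
  define g where "g a b c = (\<lambda>i::nat. if i = 1 then b else if i = 2 then c else a :: nat)" for a b c
  have \<psi>: "sat (real_atom y) (e(1 := int a, 2 := int b, 3 := int c, 0 := int w)) \<psi> \<longleftrightarrow>
      Q y (case_nat w (g a b c))"
    for y e a b c w
    unfolding \<psi>_def
    by (subst sat_copies, simp, rule \<phi>(2))
       (auto split: nat.split simp: g_def numeral_eq_Suc less_Suc_eq)
  have \<psi>_R: "(\<exists>w. sat (real_atom y) (e(1 := int a, 2 := int b, 3 := int c, 0 := int w)) \<psi>) \<longleftrightarrow>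
      \<not> R (cut_oracle y) a b c" for y e a b c
    unfolding \<psi> Q(2)[symmetric]
    using p0[of "cut_oracle y" "\<lambda>i. g a b c (min i 2)"] by (simp add: g_def)
  define X where "X = Mem [Const 0, Const 1, Const 1, Const 1]"
  define \<chi> where "\<chi> = Conj X (Neg (Conj (nonneg_fm 1)
    (Neg (Conj (nonneg_fm 2) (Neg (Conj (nonneg_fm 3) (Conj (nonneg_fm 0) \<psi>)))))))"
  have "bounded_fm \<chi>"
    by (simp add: \<chi>_def X_def sat_nonneg_fm \<psi>_def \<phi>(1))
  then have "Pi_fm (Suc (Suc (Suc 0))) (All 1 (Ex 2 (All 3 (All 0 \<chi>))))"
    by (intro Pi_All Pi_Suc Sigma_Ex Sigma_Suc Sigma_0)
  then have "Pi_fm 3 (All 1 (Ex 2 (All 3 (All 0 \<chi>))))" by (simp add: numeral_3_eq_3)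
  moreover have "x \<in> A \<longleftrightarrow> sat (real_atom x) e (All 1 (Ex 2 (All 3 (All 0 \<chi>))))" for x e
  proof -
    have "sat (real_atom x) e (All 1 (Ex 2 (All 3 (All 0 \<chi>)))) \<longleftrightarrow>
      x \<in> {0<..<1} \<and> (\<forall>a. 0 \<le> a \<longrightarrow> (\<exists>b. 0 \<le> b \<and> (\<forall>c. 0 \<le> c \<longrightarrow> (\<forall>w. 0 \<le> w \<longrightarrow>
        \<not> sat (real_atom x) (e(1 := a, 2 := b, 3 := c, 0 := w)) \<psi>))))"
      by (simp add: \<chi>_def X_def sat_nonneg_fm)
    also have "\<dots> \<longleftrightarrow> x \<in> {0<..<1} \<and> (\<forall>a. \<exists>b. \<forall>c. R (cut_oracle x) a b c)"
      unfolding all_int_nonneg ex_int_nonneg using \<psi>_R by blast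
    finally show ?thesis using A by simp
  qed
  ultimately show ?thesis
    unfolding Pi_real_def by blast
qed

section \<open>Evaluation of arithmetical formulas by programs\<close>

definition recursive_int :: "((nat \<Rightarrow> nat) \<Rightarrow> (nat \<Rightarrow> nat) \<Rightarrow> int) \<Rightarrow> bool" where
  "recursive_int H \<longleftrightarrow> (\<exists>P N. recursive P \<and> recursive N \<and> (\<forall>x e. H x e = int (P x e) - int (N x e)))"

lemma recursive_intI:
  assumes "recursive P" "recursive N" "\<And>x e. H x e = int (P x e) - int (N x e)"
  shows "recursive_int H"
  using assms unfolding recursive_int_def by blast

lemma recursive_int_const: "recursive_int (\<lambda>x e. c)"
  by (rule recursive_intI[OF recursive_const[of "nat c"] recursive_const[of "nat (- c)"]]) simp

lemma recursive_int_of_nat: "recursive A \<Longrightarrow> recursive_int (\<lambda>x e. int (A x e))"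
  by (erule recursive_intI[OF _ recursive_const[of 0]]) simp

lemma recursive_int_add:
  assumes "recursive_int A" "recursive_int B" shows "recursive_int (\<lambda>x e. A x e + B x e)"
proof -
  obtain P N P' N' where "recursive P" "recursive N" "recursive P'" "recursive N'"
    "\<forall>x e. A x e = int (P x e) - int (N x e)" "\<forall>x e. B x e = int (P' x e) - int (N' x e)"
    using assms unfolding recursive_int_def by blast
  then show ?thesis
    by (intro recursive_intI[of "\<lambda>x e. P x e + P' x e" "\<lambda>x e. N x e + N' x e"] recursive_add) auto
qed

lemma recursive_int_mult:
  assumes "recursive_int A" "recursive_int B" shows "recursive_int (\<lambda>x e. A x e * B x e)"
proof -
  obtain P N P' N' where "recursive P" "recursive N" "recursive P'" "recursive N'"
    "\<forall>x e. A x e = int (P x e) - int (N x e)" "\<forall>x e. B x e = int (P' x e) - int (N' x e)"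
    using assms unfolding recursive_int_def by blast
  note * = this
  show ?thesis
  proof (rule recursive_intI)
    show "recursive (\<lambda>x e. P x e * P' x e + N x e * N' x e)"
      "recursive (\<lambda>x e. P x e * N' x e + N x e * P' x e)"
      by (intro recursive_add recursive_mult *(1-4))+
    show "A x e * B x e = int (P x e * P' x e + N x e * N' x e) - int (P x e * N' x e + N x e * P' x e)"
      for x e
      unfolding *(5,6)[rule_format] of_nat_add of_nat_mult by (simp only: ring_distribs)
  qed
qed

lemma recursive_int_shift:
  assumes "recursive_int A" shows "recursive_int (\<lambda>x e. A x (\<lambda>i. e (Suc i)))"
proof -
  obtain P N where *: "recursive P" "recursive N" "\<forall>x e. A x e = int (P x e) - int (N x e)"
    using assms unfolding recursive_int_def by blast
  show ?thesis
    by (rule recursive_intI[OF *(1,2)[THEN recursive_shift]]) (simp add: *(3))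
qed

lemma int_decode_eq: "int_decode n = (if even n then int (n div 2) else - int (Suc n div 2))"
  by (auto simp: int_decode_def sum_decode_def elim!: oddE)

lemma recursive_int_decode:
  assumes "recursive A" shows "recursive_int (\<lambda>x e. int_decode (A x e))"
  by (rule recursive_intI[of "\<lambda>x e. if A x e mod 2 = 0 then A x e div 2 else 0"
        "\<lambda>x e. if A x e mod 2 = 0 then 0 else Suc (A x e) div 2"], (intro recursive_intros assms)+)
     (auto simp: int_decode_eq even_iff_mod_2_eq_zero)

lemma recursive_int_tm_val:
  assumes "\<And>v. recursive_int (E v)" shows "recursive_int (\<lambda>x e. tm_val (\<lambda>v. E v x e) t)"
  by (induction t) (auto intro: assms recursive_int_const recursive_int_add recursive_int_mult)

lemma decidable_int_eq:
  assumes "recursive_int A" "recursive_int B" shows "decidable (\<lambda>x e. A x e = B x e)"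
proof -
  obtain P N P' N' where *: "recursive P" "recursive N" "recursive P'" "recursive N'"
    "\<forall>x e. A x e = int (P x e) - int (N x e)" "\<forall>x e. B x e = int (P' x e) - int (N' x e)"
    using assms unfolding recursive_int_def by blast
  have "A x e = B x e \<longleftrightarrow> P x e + N' x e = P' x e + N x e" for x e
    using *(5,6) by auto
  then show ?thesis
    using * by (simp only:) (intro decidable_eq recursive_add)
qed

lemma decidable_baire_atom:
  assumes "recursive_int A" "recursive_int B"
  shows "decidable (\<lambda>x e. baire_atom x [A x e, B x e])"
proof -
  obtain P N P' N' where *: "recursive P" "recursive N" "recursive P'" "recursive N'"
    "\<forall>x e. A x e = int (P x e) - int (N x e)" "\<forall>x e. B x e = int (P' x e) - int (N' x e)"
    using assms unfolding recursive_int_def by blast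
  have "baire_atom x [A x e, B x e] \<longleftrightarrow> N x e \<le> P x e \<and> x (P x e - N x e) + N' x e = P' x e" for x e
  proof -
    have "nat (int (P x e) - int (N x e)) = P x e - N x e" by simp
    then show ?thesis using *(5,6) by auto
  qed
  then show ?thesis
    using * by (simp only:) (intro recursive_intros)
qed

text \<open>The assignment is generalized to a family of computable integers. A bounded quantifier
  then becomes a search for an offset, and the bound variable is interpreted as the lower bound plus
  this offset.\<close>

lemma decidable_bounded_fm:
  assumes "bounded_fm \<phi>" "\<And>v. recursive_int (E v)"
  shows "decidable (\<lambda>x e. sat (baire_atom x) (\<lambda>v. E v x e) \<phi>)"
  using assms
proof (induction \<phi> arbitrary: E)
  case (Eq s t)
  then show ?case by (simp add: decidable_int_eq recursive_int_tm_val)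
next
  case (Mem ts)
  show ?case
  proof (cases "\<exists>s t. ts = [s, t]")
    case True
    with Mem show ?thesis
      by (auto simp del: baire_atom.simps intro!: decidable_baire_atom recursive_int_tm_val)
  next
    case False
    then have "\<not> baire_atom x (map f ts)" for x f
      by (cases "(x, map f ts)" rule: baire_atom.cases) (auto simp: map_eq_Cons_conv)
    then show ?thesis by (simp add: decidable_const)
  qed
next
  case (BEx v s t \<phi>)
  obtain P N where s: "recursive P" "recursive N"
    "\<And>x e. tm_val (\<lambda>v. E v x e) s = int (P x e) - int (N x e)"
    using recursive_int_tm_val[of E s, OF BEx.prems(2)] unfolding recursive_int_def by blast
  obtain P' N' where t: "recursive P'" "recursive N'"
    "\<And>x e. tm_val (\<lambda>v. E v x e) t = int (P' x e) - int (N' x e)"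
    using recursive_int_tm_val[of E t, OF BEx.prems(2)] unfolding recursive_int_def by blast
  define E' where "E' u = (if u = v then (\<lambda>x e. tm_val (\<lambda>v. E v x (\<lambda>i. e (Suc i))) s + int (e 0))
    else (\<lambda>x e. E u x (\<lambda>i. e (Suc i))))" for u
  have "recursive_int (E' u)" for u
    unfolding E'_def using BEx.prems(2)
    by (auto intro!: recursive_int_add recursive_int_of_nat recursive_var
        recursive_int_shift[of "\<lambda>x e. tm_val (\<lambda>v. E v x e) s"] recursive_int_tm_val recursive_int_shift)
  with BEx have "decidable (\<lambda>x e. sat (baire_atom x) (\<lambda>u. E' u x e) \<phi>)" by simp
  moreover have "(\<lambda>u. E' u x e) =
      (\<lambda>u. E u x (\<lambda>i. e (Suc i)))(v := tm_val (\<lambda>v. E v x (\<lambda>i. e (Suc i))) s + int (e 0))" for x e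
    by (auto simp: E'_def)
  ultimately have "decidable (\<lambda>x e. sat (baire_atom x)
      ((\<lambda>u. E u x (\<lambda>i. e (Suc i)))(v := tm_val (\<lambda>v. E v x (\<lambda>i. e (Suc i))) s + int (e 0))) \<phi>)"
    by simp
  \<comment> \<open>The number of offsets is the length of the range; truncated subtraction makes it
    0 for an empty range.\<close>
  then have dec: "decidable (\<lambda>x e. \<exists>j<(Suc (P' x e + N x e) - (P x e + N' x e)). sat (baire_atom x)
      ((\<lambda>u. E u x e)(v := tm_val (\<lambda>v. E v x e) s + int j)) \<phi>)"
    by (intro decidable_ex_less recursive_intros s t)
  have "sat (baire_atom x) (\<lambda>u. E u x e) (BEx v s t \<phi>) \<longleftrightarrow>
     (\<exists>j<(Suc (P' x e + N x e) - (P x e + N' x e)). sat (baire_atom x)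
      ((\<lambda>u. E u x e)(v := tm_val (\<lambda>v. E v x e) s + int j)) \<phi>)" (is "?L \<longleftrightarrow> ?R") for x e
  proof
    assume ?L
    then obtain i where i: "tm_val (\<lambda>u. E u x e) s \<le> i" "i \<le> tm_val (\<lambda>u. E u x e) t"
      "sat (baire_atom x) ((\<lambda>u. E u x e)(v := i)) \<phi>" by auto
    define j where "j = nat (i - tm_val (\<lambda>u. E u x e) s)"
    have "i = tm_val (\<lambda>u. E u x e) s + int j" using i(1) by (simp add: j_def)
    moreover have "j < Suc (P' x e + N x e) - (P x e + N' x e)"
      using i unfolding j_def s(3) t(3) by linarith
    ultimately show ?R using i(3) by blast
  next
    assume ?R
    then obtain j where "j < Suc (P' x e + N x e) - (P x e + N' x e)"
      "sat (baire_atom x) ((\<lambda>u. E u x e)(v := tm_val (\<lambda>v. E v x e) s + int j)) \<phi>" by blast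
    moreover from this have "tm_val (\<lambda>v. E v x e) s + int j \<le> tm_val (\<lambda>u. E u x e) t"
      unfolding s(3) t(3) by linarith
    ultimately show ?L by auto
  qed
  with dec show ?case by simp
qed (simp_all add: decidable_not decidable_conj)

primrec update_coded :: "nat list \<Rightarrow> nat \<Rightarrow> (nat \<Rightarrow> int) \<Rightarrow> nat \<Rightarrow> int" where
  "update_coded [] p e = e"
| "update_coded (v # vs) p e =
     update_coded vs (snd (prod_decode p)) (e(v := int_decode (fst (prod_decode p))))"

text \<open>Pairing and the coding of integers are onto, so one natural number can run through the
  values of a quantified variable together with a code for the rest of its block.\<close>

lemma all_coded: "(\<forall>i p. f i p) \<longleftrightarrow> (\<forall>p. f (int_decode (fst (prod_decode p))) (snd (prod_decode p)))"
  by (metis fst_conv int_encode_inverse prod_encode_inverse snd_conv)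

lemma ex_coded: "(\<exists>i p. f i p) \<longleftrightarrow> (\<exists>p. f (int_decode (fst (prod_decode p))) (snd (prod_decode p)))"
  using all_coded[of "\<lambda>i p. \<not> f i p"] by blast

lemma Pi_block:
  "Pi_fm (Suc n) \<phi> \<Longrightarrow> \<exists>vs \<psi>. Sigma_fm n \<psi> \<and> (\<forall>M e. sat M e \<phi> \<longleftrightarrow> (\<forall>p. sat M (update_coded vs p e) \<psi>))"
proof (induction \<phi> rule: measure_induct_rule[where f = size])
  case (less \<phi>)
  from less.prems consider "Sigma_fm n \<phi>" | v \<phi>' where "\<phi> = All v \<phi>'" "Pi_fm (Suc n) \<phi>'"
    by (rule Pi_fm.cases) auto
  then show ?case
  proof cases
    case 1
    then show ?thesis by (intro exI[of _ "[]"] exI[of _ \<phi>]) simp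
  next
    case 2
    with less.IH[of \<phi>'] obtain vs \<psi> where \<psi>: "Sigma_fm n \<psi>"
      "\<And>M e. sat M e \<phi>' \<longleftrightarrow> (\<forall>p. sat M (update_coded vs p e) \<psi>)" by auto
    have "sat M e \<phi> \<longleftrightarrow> (\<forall>p. sat M (update_coded (v # vs) p e) \<psi>)" for M e
      unfolding 2 sat.simps \<psi>(2) update_coded.simps by (rule all_coded)
    with \<psi>(1) show ?thesis by blast
  qed
qed

lemma Sigma_block:
  "Sigma_fm (Suc n) \<phi> \<Longrightarrow> \<exists>vs \<psi>. Pi_fm n \<psi> \<and> (\<forall>M e. sat M e \<phi> \<longleftrightarrow> (\<exists>p. sat M (update_coded vs p e) \<psi>))"
proof (induction \<phi> rule: measure_induct_rule[where f = size])
  case (less \<phi>)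
  from less.prems consider "Pi_fm n \<phi>" | v \<phi>' where "\<phi> = Ex v \<phi>'" "Sigma_fm (Suc n) \<phi>'"
    by (rule Sigma_fm.cases) auto
  then show ?case
  proof cases
    case 1
    then show ?thesis by (intro exI[of _ "[]"] exI[of _ \<phi>]) simp
  next
    case 2
    with less.IH[of \<phi>'] obtain vs \<psi> where \<psi>: "Pi_fm n \<psi>"
      "\<And>M e. sat M e \<phi>' \<longleftrightarrow> (\<exists>p. sat M (update_coded vs p e) \<psi>)" by auto
    have "sat M e \<phi> \<longleftrightarrow> (\<exists>p. sat M (update_coded (v # vs) p e) \<psi>)" for M e
      unfolding 2 sat.simps \<psi>(2) update_coded.simps by (rule ex_coded)
    with \<psi>(1) show ?thesis by blast
  qed
qed

lemma recursive_int_update_coded: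
  assumes "\<And>v. recursive_int (E v)" "recursive P"
  shows "recursive_int (\<lambda>x e. update_coded vs (P x e) (\<lambda>v. E v x e) u)"
  using assms
proof (induction vs arbitrary: E P)
  case (Cons v vs)
  define E' where "E' = E(v := \<lambda>x e. int_decode (fst (prod_decode (P x e))))"
  have "(\<lambda>w. E' w x e) = (\<lambda>w. E w x e)(v := int_decode (fst (prod_decode (P x e))))" for x e
    by (auto simp: E'_def)
  moreover have "recursive_int (\<lambda>x e. update_coded vs (snd (prod_decode (P x e))) (\<lambda>w. E' w x e) u)"
    using Cons.prems
    by (intro Cons.IH) (auto simp: E'_def intro!: recursive_int_decode recursive_intros)
  ultimately show ?case by simp
qed simp

lemma Sigma_fm_0: "Sigma_fm 0 \<phi> \<Longrightarrow> bounded_fm \<phi>"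
  by (auto elim: Sigma_fm.cases)

lemma Pi_baire_3E:
  assumes "Pi_baire 3 B"
  obtains R where "decidable (\<lambda>x e. R x (e 0) (e 1) (e 2))" "\<And>x. x \<in> B \<longleftrightarrow> (\<forall>a. \<exists>b. \<forall>c. R x a b c)"
proof -
  obtain \<phi> where "Pi_fm 3 \<phi>" and B: "\<And>x e. x \<in> B \<longleftrightarrow> sat (baire_atom x) e \<phi>"
    using assms unfolding Pi_baire_def by blast
  then have "Pi_fm (Suc 2) \<phi>" by (simp add: numeral_3_eq_3 numeral_2_eq_2)
  then obtain us \<psi> where "Sigma_fm 2 \<psi>"
    and \<phi>: "\<And>M e. sat M e \<phi> \<longleftrightarrow> (\<forall>p. sat M (update_coded us p e) \<psi>)"
    using Pi_block by blast
  then have "Sigma_fm (Suc 1) \<psi>" by (simp add: numeral_2_eq_2)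
  then obtain vs \<chi> where "Pi_fm 1 \<chi>"
    and \<psi>: "\<And>M e. sat M e \<psi> \<longleftrightarrow> (\<exists>p. sat M (update_coded vs p e) \<chi>)"
    using Sigma_block by blast
  then have "Pi_fm (Suc 0) \<chi>" by simp
  then obtain ws \<theta> where "Sigma_fm 0 \<theta>"
    and \<chi>: "\<And>M e. sat M e \<chi> \<longleftrightarrow> (\<forall>p. sat M (update_coded ws p e) \<theta>)"
    using Pi_block by blast
  \<comment> \<open>Any start assignment would do, as the formula behaves like a sentence; the zero
    assignment is computable.\<close>
  define R where "R x a b c \<longleftrightarrow> sat (baire_atom x)
    (update_coded ws c (update_coded vs b (update_coded us a (\<lambda>_. 0)))) \<theta>" for x a b c
  have "decidable (\<lambda>x e. sat (baire_atom x) (\<lambda>v. update_coded ws (e 2)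
      (\<lambda>v. update_coded vs (e 1) (\<lambda>v. update_coded us (e 0) (\<lambda>v. 0) v) v) v) \<theta>)"
    by (intro decidable_bounded_fm Sigma_fm_0 \<open>Sigma_fm 0 \<theta>\<close> recursive_int_update_coded
        recursive_int_const recursive_var)
  then have "decidable (\<lambda>x e. R x (e 0) (e 1) (e 2))" unfolding R_def by simp
  moreover have "x \<in> B \<longleftrightarrow> (\<forall>a. \<exists>b. \<forall>c. R x a b c)" for x
    unfolding B[of x "\<lambda>_. 0"] \<phi> \<psi> \<chi> R_def ..
  ultimately show ?thesis by (rule that)
qed

section \<open>Pi_3 sets as limits to infinity\<close>

definition first_failure :: "nat \<Rightarrow> (nat \<Rightarrow> bool) \<Rightarrow> nat" where
  "first_failure n P = (\<Sum>i<n. of_bool (\<forall>i'\<le>i. P i'))"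

text \<open>The sum counts the initial run of successes. It is thus a bounded search with default
  value \<open>n\<close>, in a form whose computability follows from closure under sums.\<close>

lemma le_first_failure_iff: "m \<le> first_failure n P \<longleftrightarrow> m \<le> n \<and> (\<forall>i<m. P i)"
proof -
  have eq: "first_failure n P = card {i. i < n \<and> (\<forall>i'\<le>i. P i')}"
    by (simp add: first_failure_def of_bool_def sum.If_cases Int_def)
  show ?thesis
  proof
    assume m: "m \<le> first_failure n P"
    have "P i" if "i < m" for i
    proof (rule ccontr)
      assume "\<not> P i"
      then have "{i. i < n \<and> (\<forall>i'\<le>i. P i')} \<subseteq> {..<i}" by (auto simp: not_le[symmetric])
      from card_mono[OF _ this] m that show False unfolding eq by simp
    qed
    moreover have "{i. i < n \<and> (\<forall>i'\<le>i. P i')} \<subseteq> {..<n}" by auto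
    from card_mono[OF _ this] m have "m \<le> n" unfolding eq by simp
    ultimately show "m \<le> n \<and> (\<forall>i<m. P i)" by blast
  next
    assume m: "m \<le> n \<and> (\<forall>i<m. P i)"
    then have "{..<m} \<subseteq> {i. i < n \<and> (\<forall>i'\<le>i. P i')}" by auto
    from card_mono[OF _ this] show "m \<le> first_failure n P" unfolding eq by simp
  qed
qed


text \<open>A \<open>\<Sigma>\<^sub>2\<close> fact \<open>\<exists>b. \<forall>c. Q b c\<close> holds iff the least candidate \<open>b\<close> not refuted
  by stage \<open>s\<close> changes only finitely often; \<open>\<Pi>\<^sub>3\<close> facts are then tested by the least \<open>a\<close> whose
  candidate changes at stage \<open>s\<close>.\<close>

definition candidate :: "(nat \<Rightarrow> nat \<Rightarrow> bool) \<Rightarrow> nat \<Rightarrow> nat" where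
  "candidate Q s = first_failure (Suc s) (\<lambda>b. \<exists>c\<le>s. \<not> Q b c)"

definition least_change :: "(nat \<Rightarrow> nat \<Rightarrow> nat \<Rightarrow> bool) \<Rightarrow> nat \<Rightarrow> nat" where
  "least_change Q s = first_failure s (\<lambda>a. candidate (Q a) (Suc s) = candidate (Q a) s)"

text \<open>A candidate once refuted stays refuted.\<close>

lemma candidate_mono: "candidate Q s \<le> candidate Q (Suc s)"
proof -
  have "candidate Q s \<le> Suc s \<and> (\<forall>b<candidate Q s. \<exists>c\<le>s. \<not> Q b c)"
    using le_first_failure_iff[of "candidate Q s" "Suc s" "\<lambda>b. \<exists>c\<le>s. \<not> Q b c"]
    by (simp add: candidate_def)
  then have "candidate Q s \<le> Suc (Suc s) \<and> (\<forall>b<candidate Q s. \<exists>c\<le>Suc s. \<not> Q b c)"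
    by (meson le_SucI)
  then show ?thesis
    by (subst (2) candidate_def) (simp add: le_first_failure_iff)
qed

text \<open>If no \<open>b\<close> survives, the first \<open>k\<close> candidates are all refuted
  by some stage, so the least one left is unbounded. A surviving \<open>b\<close> is an upper bound,
  and a bounded monotone sequence of naturals reaches its maximum.\<close>

lemma candidate_stabilizes_iff:
  "(\<exists>S. \<forall>s\<ge>S. candidate Q (Suc s) = candidate Q s) \<longleftrightarrow> (\<exists>b. \<forall>c. Q b c)"
proof
  assume "\<exists>S. \<forall>s\<ge>S. candidate Q (Suc s) = candidate Q s"
  then obtain S where S: "\<And>s. s \<ge> S \<Longrightarrow> candidate Q (Suc s) = candidate Q s" by blast
  have const: "candidate Q s = candidate Q S" if "s \<ge> S" for s
    using that by (induction s rule: dec_induct) (auto simp: S)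
  show "\<exists>b. \<forall>c. Q b c"
  proof (rule ccontr)
    assume "\<nexists>b. \<forall>c. Q b c"
    then obtain r where r: "\<And>b. \<not> Q b (r b)" by metis
    define k where "k = Suc (candidate Q S)"
    define s where "s = S + k + Max (r ` {..<k})"
    have "r b \<le> s" if "b < k" for b
      unfolding s_def using that by (intro trans_le_add2 Max_ge) auto
    then have "k \<le> candidate Q s"
      unfolding candidate_def le_first_failure_iff using r by (auto simp: s_def)
    moreover have "candidate Q s = candidate Q S" by (rule const) (simp add: s_def)
    ultimately show False by (simp add: k_def)
  qed
next
  assume "\<exists>b. \<forall>c. Q b c"
  then obtain b where b: "\<And>c. Q b c" by blast
  have bound: "candidate Q s \<le> b" for s
  proof (rule ccontr)
    assume "\<not> candidate Q s \<le> b"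
    then have "Suc b \<le> candidate Q s" by simp
    then have "\<forall>i<Suc b. \<exists>c\<le>s. \<not> Q i c" unfolding candidate_def le_first_failure_iff by simp
    then have "\<exists>c. \<not> Q b c" by (meson lessI)
    then show False using b by simp
  qed
  have fin: "finite (range (candidate Q))"
    by (rule finite_subset[of _ "{..b}"]) (use bound in auto)
  define m where "m = Max (range (candidate Q))"
  have "m \<in> range (candidate Q)" unfolding m_def using fin by (intro Max_in) auto
  then obtain S where S: "candidate Q S = m" by blast
  have "candidate Q s = m" if "s \<ge> S" for s
  proof -
    have "m \<le> candidate Q s"
      using that S by (induction s rule: dec_induct) (auto intro: order_trans candidate_mono)
    moreover have "candidate Q s \<le> m" unfolding m_def using fin by (intro Max_ge) auto
    ultimately show ?thesis by simp
  qed
  then show "\<exists>S. \<forall>s\<ge>S. candidate Q (Suc s) = candidate Q s" by (intro exI[of _ S]) simp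
qed

lemma least_change_unbounded_iff:
  "(\<forall>m. \<exists>S. \<forall>s\<ge>S. m \<le> least_change Q s) \<longleftrightarrow> (\<forall>a. \<exists>b. \<forall>c. Q a b c)"
proof -
  have "(\<forall>m. \<exists>S. \<forall>s\<ge>S. m \<le> least_change Q s) \<longleftrightarrow>
      (\<forall>a. \<exists>S. \<forall>s\<ge>S. candidate (Q a) (Suc s) = candidate (Q a) s)" (is "?L \<longleftrightarrow> ?R")
  proof
    assume L: ?L
    show ?R
    proof
      fix a
      from L obtain S where "\<forall>s\<ge>S. Suc a \<le> least_change Q s" by blast
      then show "\<exists>S. \<forall>s\<ge>S. candidate (Q a) (Suc s) = candidate (Q a) s"
        unfolding least_change_def le_first_failure_iff by blast
    qed
  next
    assume ?R
    then obtain S where S: "\<And>a s. s \<ge> S a \<Longrightarrow> candidate (Q a) (Suc s) = candidate (Q a) s" by metis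
    show ?L
    proof
      fix m
      \<comment> \<open>The summand \<open>m\<close> makes the stage at least \<open>m\<close>,
        because \<open>least_change\<close> never exceeds the stage.\<close>
      have "S a \<le> m + Max (S ` {..<m})" if "a < m" for a
        using that by (intro trans_le_add2 Max_ge) auto
      then show "\<exists>S. \<forall>s\<ge>S. m \<le> least_change Q s"
        unfolding least_change_def le_first_failure_iff
        by (intro exI[of _ "m + Max (S ` {..<m})"]) (auto intro!: S intro: order_trans)
    qed
  qed
  then show ?thesis unfolding candidate_stabilizes_iff .
qed

text \<open>This cap later keeps the marked block of every large scale nonempty.\<close>

lemma least_change_le: "least_change Q s \<le> s"
  unfolding least_change_def
  using le_first_failure_iff[of _ s "\<lambda>a. candidate (Q a) (Suc s) = candidate (Q a) s"] by blast

lemma recursive_least_change: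
  assumes R: "decidable (\<lambda>x e. R x (e 0) (e 1) (e 2))" and S: "recursive S"
  shows "recursive (\<lambda>x e. least_change (R x) (S x e))"
proof -
  have sub: "decidable (\<lambda>x e. R x (A x e) (B x e) (C x e))"
    if "recursive A" "recursive B" "recursive C" for A B C
  proof -
    have "recursive (case i of 0 \<Rightarrow> A | Suc 0 \<Rightarrow> B | _ \<Rightarrow> C)" for i
      using that by (auto split: nat.split)
    from recursive_subst[OF R[unfolded decidable_def], of "\<lambda>i. case i of 0 \<Rightarrow> A | Suc 0 \<Rightarrow> B | _ \<Rightarrow> C", OF this]
    show ?thesis by (simp add: decidable_def numeral_2_eq_2)
  qed
  show ?thesis
    by (rule recursive_subst1[where f = "\<lambda>x s. least_change (R x) s"])
       (unfold least_change_def candidate_def first_failure_def, (intro recursive_intros sub S)+)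
qed

theorem Pi_baire_3_reduction:
  assumes "Pi_baire 3 B"
  obtains g where "recursive (\<lambda>x e. g x (e 0))" "\<And>x s. g x s \<le> s" "\<And>x. x \<in> B \<longleftrightarrow> (\<forall>m. \<exists>S. \<forall>s\<ge>S. m \<le> g x s)"
proof -
  obtain R where R: "decidable (\<lambda>x e. R x (e 0) (e 1) (e 2))" "\<And>x. x \<in> B \<longleftrightarrow> (\<forall>a. \<exists>b. \<forall>c. R x a b c)"
    using assms by (rule Pi_baire_3E) blast
  show ?thesis
    by (rule that[of "\<lambda>x. least_change (R x)"])
       (simp_all add: least_change_unbounded_iff R(2) recursive_least_change[OF R(1)] least_change_le)
qed

section \<open>Word frequencies\<close>

text \<open>Words of length \<open>k\<close> are coded by numbers below \<open>b ^ k\<close>, the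
  first letter being least significant, so that appending a letter adds one term.\<close>

definition window :: "nat \<Rightarrow> (nat \<Rightarrow> nat) \<Rightarrow> nat \<Rightarrow> nat \<Rightarrow> nat" where
  "window b d k i = (\<Sum>t<k. d (i + t) * b ^ t)"

text \<open>\<open>N\<close> counts starting positions, so the windows extend beyond the first
  \<open>N\<close> digits.\<close>

definition occ :: "nat \<Rightarrow> (nat \<Rightarrow> nat) \<Rightarrow> nat \<Rightarrow> nat \<Rightarrow> nat \<Rightarrow> nat" where
  "occ b d k N w = (\<Sum>i<N. of_bool (window b d k i = w))"

definition freq :: "nat \<Rightarrow> (nat \<Rightarrow> nat) \<Rightarrow> nat \<Rightarrow> nat \<Rightarrow> nat \<Rightarrow> nat" where
  "freq b d k N j = (\<Sum>w<b ^ k. of_bool (occ b d k N w = j))"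

lemma sum_of_bool_card: "(\<Sum>i<(n::nat). of_bool (P i) :: nat) = card {i. i < n \<and> P i}"
  by (simp add: of_bool_def sum.If_cases Int_def)

lemma occ_card: "occ b d k N w = card {i. i < N \<and> window b d k i = w}"
  unfolding occ_def by (rule sum_of_bool_card)

lemma freq_card: "freq b d k N j = card {w. w < b ^ k \<and> occ b d k N w = j}"
  unfolding freq_def by (rule sum_of_bool_card)

lemma window_Suc: "window b d (Suc k) i = window b d k i + d (i + k) * b ^ k"
  by (simp add: window_def)

lemma window_less:
  assumes "\<And>t. t < k \<Longrightarrow> d (i + t) < b" shows "window b d k i < b ^ k"
  using assms
proof (induction k)
  case (Suc k)
  then have "window b d k i < b ^ k" "Suc (d (i + k)) \<le> b" by (simp_all add: Suc_le_eq)
  then have "window b d k i + d (i + k) * b ^ k < Suc (d (i + k)) * b ^ k" by simp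
  also have "\<dots> \<le> b * b ^ k" using \<open>Suc (d (i + k)) \<le> b\<close> by (rule mult_le_mono1)
  finally show ?case by (simp add: window_Suc)
qed (simp add: window_def)

lemma window_cong: "(\<And>t. t < k \<Longrightarrow> d (i + t) = d' (i' + t)) \<Longrightarrow> window b d k i = window b d' k i'"
  unfolding window_def by (intro sum.cong) auto

lemma window_digit:
  assumes "\<And>t. t < k \<Longrightarrow> d (i + t) < b" "t < k"
  shows "window b d k i div b ^ t mod b = d (i + t)"
  using assms
proof (induction k)
  case (Suc k)
  have b: "b > 0" using Suc.prems(1)[of 0] by simp
  show ?case
  proof (cases "t = k")
    case True
    have "window b d k i < b ^ k" by (rule window_less) (use Suc.prems in auto)
    then show ?thesis using True Suc.prems b by (simp add: window_Suc)
  next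
    case False
    then have t: "t < k" using Suc.prems by simp
    then obtain m where k: "k = Suc t + m" using less_imp_Suc_add by auto
    have "(window b d k i + d (i + k) * b ^ k) div b ^ t = (window b d k i + b ^ t * (b * (d (i + k) * b ^ m))) div b ^ t"
      by (simp add: k power_add algebra_simps)
    also have "\<dots> mod b = window b d k i div b ^ t mod b"
      using b by simp
    finally show ?thesis using Suc t by (simp add: window_Suc)
  qed
qed simp

lemma window_eq_iff:
  assumes "\<And>t. t < k \<Longrightarrow> d (i + t) < b" "\<And>t. t < k \<Longrightarrow> d' (i' + t) < b"
  shows "window b d k i = window b d' k i' \<longleftrightarrow> (\<forall>t<k. d (i + t) = d' (i' + t))"
  using window_digit[where d = d and i = i and k = k and b = b, OF assms(1)]
    window_digit[where d = d' and i = i' and k = k and b = b, OF assms(2)] window_cong[of k d i d' i' b]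
  by metis

lemma card_diff_le:
  assumes "finite D" "\<And>w. w < n \<Longrightarrow> w \<notin> D \<Longrightarrow> P w \<longleftrightarrow> Q w"
  shows "\<bar>real (card {w. w < (n::nat) \<and> P w}) - real (card {w. w < n \<and> Q w})\<bar> \<le> real (card D)"
proof -
  have le: "card {w. w < n \<and> P w} \<le> card {w. w < n \<and> Q w} + card D"
    if "\<And>w. w < n \<Longrightarrow> w \<notin> D \<Longrightarrow> P w \<longleftrightarrow> Q w" for P Q
  proof -
    have "card {w. w < n \<and> P w} \<le> card ({w. w < n \<and> Q w} \<union> D)"
      using that assms(1) by (intro card_mono) auto
    also have "\<dots> \<le> card {w. w < n \<and> Q w} + card D" by (rule card_Un_le)
    finally show ?thesis .
  qed
  from le[of P Q] le[of Q P] assms(2) show ?thesis by force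
qed

text \<open>Changing the window at one position affects only the counts of its old and of its new
  word, hence the factor 2.\<close>

lemma freq_diff_le:
  assumes "finite S" "\<And>i. i < N \<Longrightarrow> i \<notin> S \<Longrightarrow> window b d k i = window b d' k i"
  shows "\<bar>real (freq b d k N j) - real (freq b d' k N j)\<bar> \<le> 2 * real (card S)"
proof -
  define D where "D = window b d k ` S \<union> window b d' k ` S"
  have "{i. i < N \<and> window b d k i = w} = {i. i < N \<and> window b d' k i = w}" if "w \<notin> D" for w
    using that assms(2) unfolding D_def by force
  then have "\<bar>real (freq b d k N j) - real (freq b d' k N j)\<bar> \<le> real (card D)"
    unfolding freq_card occ_card by (intro card_diff_le) (auto simp: D_def assms(1))
  also have "card D \<le> card S + card S"
    unfolding D_def by (intro order_trans[OF card_Un_le] add_mono card_image_le assms(1))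
  finally show ?thesis by simp
qed

text \<open>Only words seen at the additional positions change their counts. Counting distinct words
  rather than positions pays off where the additional windows are mostly equal.\<close>

lemma freq_diff_image_le:
  assumes "N \<le> N'"
  shows "\<bar>real (freq b d k N j) - real (freq b d k N' j)\<bar> \<le> real (card (window b d k ` {N..<N'}))"
proof -
  define D where "D = window b d k ` {N..<N'}"
  have "{i. i < N \<and> window b d k i = w} = {i. i < N' \<and> window b d k i = w}" if "w \<notin> D" for w
    using that assms unfolding D_def by (auto simp: image_iff)
  then show ?thesis
    unfolding freq_card occ_card D_def[symmetric] by (intro card_diff_le) (auto simp: D_def)
qed

lemma freq_diff_N_le:
  assumes "N \<le> N'"
  shows "\<bar>real (freq b d k N j) - real (freq b d k N' j)\<bar> \<le> real N' - real N"
proof -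
  have "card (window b d k ` {N..<N'}) \<le> card {N..<N'}"
    by (rule card_image_le) simp
  with freq_diff_image_le[OF assms, of b d k j] show ?thesis using assms by simp
qed

lemma sum_lessThan_mult:
  fixes h :: "nat \<Rightarrow> 'a::comm_monoid_add"
  shows "(\<Sum>v<n * m. h v) = (\<Sum>a<n. \<Sum>v<m. h (v + a * m))"
proof -
  have "sum h {a * m..<a * m + m} = (\<Sum>v<m. h (v + a * m))" for a
    using sum.shift_bounds_nat_ivl[of h 0 "a * m" m] by (simp add: atLeast0LessThan add.commute)
  then show ?thesis using sum.nat_group[of h m n] by simp
qed

text \<open>Double counting: a word with \<open>j + 1\<close> occurrences is met at
  \<open>j + 1\<close> starting positions. This turns the recurrence into a statement about the word
  seen at a given position.\<close>

lemma mult_freq_Suc: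
  assumes "\<And>i. d i < b"
  shows "Suc j * freq b d k N (Suc j) = (\<Sum>i<N. of_bool (occ b d k N (window b d k i) = Suc j))"
proof -
  have "(\<Sum>i<N. of_bool (occ b d k N (window b d k i) = Suc j) :: nat) =
      (\<Sum>i<N. \<Sum>w<b ^ k. of_bool (window b d k i = w) * of_bool (occ b d k N w = Suc j))"
  proof (rule sum.cong[OF refl])
    fix i
    have "window b d k i < b ^ k" using assms by (rule window_less)
    then have "(\<Sum>w<b ^ k. of_bool (window b d k i = w) * of_bool (occ b d k N w = Suc j)) =
        (\<Sum>w\<in>{window b d k i}. of_bool (window b d k i = w) * of_bool (occ b d k N w = Suc j) :: nat)"
      by (intro sum.mono_neutral_right) auto
    then show "of_bool (occ b d k N (window b d k i) = Suc j) =
        (\<Sum>w<b ^ k. of_bool (window b d k i = w) * of_bool (occ b d k N w = Suc j) :: nat)"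
      by simp
  qed
  also have "\<dots> = (\<Sum>w<b ^ k. \<Sum>i<N. of_bool (window b d k i = w) * of_bool (occ b d k N w = Suc j))"
    by (rule sum.swap)
  also have "\<dots> = (\<Sum>w<b ^ k. occ b d k N w * of_bool (occ b d k N w = Suc j))"
    unfolding occ_def sum_distrib_right ..
  also have "\<dots> = (\<Sum>w<b ^ k. Suc j * of_bool (occ b d k N w = Suc j))"
    by (intro sum.cong) (auto simp: of_bool_def)
  finally show ?thesis unfolding freq_def sum_distrib_left by simp
qed

lemma freq_le: "freq b d k N j \<le> b ^ k"
proof -
  have "freq b d k N j \<le> card {..<b ^ k}"
    unfolding freq_card by (intro card_mono) auto
  then show ?thesis by simp
qed

section \<open>Uniformly distributed digits\<close>

definition digs :: "nat \<Rightarrow> nat \<Rightarrow> nat \<Rightarrow> nat" where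
  "digs b v i = v div b ^ i mod b"

text \<open>The numbers below \<open>b ^ L\<close> list all words of \<open>L\<close> digits, each
  continued by zeros, with equal weight.\<close>

definition expect :: "nat \<Rightarrow> nat \<Rightarrow> ((nat \<Rightarrow> nat) \<Rightarrow> real) \<Rightarrow> real" where
  "expect b L F = (\<Sum>v<b ^ L. F (digs b v)) / real b ^ L"

lemma digs_less: "b > 0 \<Longrightarrow> digs b v i < b"
  by (simp add: digs_def)

lemma digs_add:
  assumes "v < b ^ L" "a < b" shows "digs b (v + a * b ^ L) = (digs b v)(L := a)"
proof
  fix i
  have b: "b > 0" using assms(2) by simp
  consider "i < L" | "i = L" | "i > L" by linarith
  then show "digs b (v + a * b ^ L) i = ((digs b v)(L := a)) i"
  proof cases
    case 1
    then obtain m where L: "L = Suc i + m" using less_imp_Suc_add by auto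
    have "(v + a * b ^ L) div b ^ i = (v + b ^ i * (b * (a * b ^ m))) div b ^ i"
      by (simp add: L power_add algebra_simps)
    also have "\<dots> mod b = v div b ^ i mod b" using b by simp
    finally show ?thesis using 1 by (simp add: digs_def)
  next
    case 2
    then show ?thesis using assms b by (simp add: digs_def)
  next
    case 3
    have "v + a * b ^ L < Suc a * b ^ L" using assms(1) by simp
    also have "\<dots> \<le> b * b ^ L" using assms(2) by (intro mult_le_mono1) simp
    also have "\<dots> \<le> b ^ i" using 3 b power_increasing[of "Suc L" i b] by simp
    finally have 1: "v + a * b ^ L < b ^ i" .
    then have "v < b ^ i" by simp
    with 1 3 show ?thesis by (simp add: digs_def)
  qed
qed

lemma expect_0: "expect b 0 F = F (\<lambda>i. digs b 0 i)"
  by (simp add: expect_def)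

lemma expect_Suc:
  "expect b (Suc L) F = (\<Sum>a<b. expect b L (\<lambda>y. F (y(L := a)))) / real b"
proof -
  have "(\<Sum>v<b * b ^ L. F (digs b v)) = (\<Sum>a<b. \<Sum>v<b ^ L. F ((digs b v)(L := a)))"
    unfolding sum_lessThan_mult by (intro sum.cong refl) (simp add: digs_add)
  then show ?thesis
    by (simp add: expect_def sum_divide_distrib[symmetric])
qed

lemma expect_add: "expect b L (\<lambda>y. F y + G y) = expect b L F + expect b L G"
  by (simp add: expect_def sum.distrib add_divide_distrib)

lemma expect_diff: "expect b L (\<lambda>y. F y - G y) = expect b L F - expect b L G"
  by (simp add: expect_def sum_subtractf diff_divide_distrib)

lemma expect_cmult: "expect b L (\<lambda>y. c * F y) = c * expect b L F"
  by (simp add: expect_def sum_distrib_left[symmetric])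

lemma expect_sum: "expect b L (\<lambda>y. \<Sum>i\<in>I. F i y) = (\<Sum>i\<in>I. expect b L (F i))"
  by (simp add: expect_def sum.swap[of _ I] sum_divide_distrib[symmetric])

lemma expect_const: "b > 0 \<Longrightarrow> expect b L (\<lambda>y. c) = c"
  by (simp add: expect_def)

lemma expect_mono:
  assumes "b > 0" "\<And>y. (\<And>i. y i < b) \<Longrightarrow> F y \<le> G y"
  shows "expect b L F \<le> expect b L G"
  unfolding expect_def by (intro divide_right_mono sum_mono assms(2) digs_less assms(1)) simp

lemma expect_cong:
  assumes "b > 0" "\<And>y. (\<And>i. y i < b) \<Longrightarrow> F y = G y"
  shows "expect b L F = expect b L G"
  by (intro antisym expect_mono assms(1)) (simp_all add: assms(2))

lemma expect_abs_le:
  assumes "b > 0" "\<And>y. (\<And>i. y i < b) \<Longrightarrow> \<bar>F y\<bar> \<le> G y"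
  shows "\<bar>expect b L F\<bar> \<le> expect b L G"
proof -
  have "expect b L F \<le> expect b L G"
    using assms(2) by (intro expect_mono[OF assms(1)]) (meson abs_le_D1)
  moreover have "expect b L (\<lambda>y. - 1 * F y) \<le> expect b L G"
    using assms(2) by (intro expect_mono[OF assms(1)]) (metis abs_le_D2 mult_minus1)
  ultimately show ?thesis unfolding expect_cmult by linarith
qed

text \<open>The digits are independent, so drawing one of them afresh leaves the distribution
  unchanged. In the induction, updates at different positions commute.\<close>

lemma expect_resample:
  assumes "t < L" shows "expect b L F = (\<Sum>a<b. expect b L (\<lambda>y. F (y(t := a)))) / real b"
  using assms
proof (induction L arbitrary: F)
  case (Suc L)
  show ?case
  proof (cases "t = L")
    case True
    have "expect b (Suc L) (\<lambda>y. F (y(L := a))) = expect b L (\<lambda>y. F (y(L := a)))" if "a < b" for a :: nat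
      using that by (simp add: expect_Suc)
    then show ?thesis unfolding True by (subst expect_Suc) simp
  next
    case False
    then have t: "t < L" using Suc.prems by simp
    have "expect b (Suc L) F = (\<Sum>a<b. (\<Sum>a'<b. expect b L (\<lambda>y. F (y(t := a', L := a)))) / real b) / real b"
      unfolding expect_Suc by (subst Suc.IH[OF t]) simp
    also have "\<dots> = (\<Sum>a'<b. (\<Sum>a<b. expect b L (\<lambda>y. F (y(L := a, t := a')))) / real b) / real b"
      unfolding sum_divide_distrib using False by (subst sum.swap) (simp add: fun_upd_twist)
    finally show ?thesis unfolding expect_Suc .
  qed
qed simp

section \<open>Redrawing a whole window\<close>

definition overwrite :: "nat \<Rightarrow> (nat \<Rightarrow> nat) \<Rightarrow> nat \<Rightarrow> nat \<Rightarrow> nat \<Rightarrow> nat \<Rightarrow> nat" where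
  "overwrite b y k i w p = (if i \<le> p \<and> p < i + k then digs b w (p - i) else y p)"

text \<open>The digits of the window are redrawn one at a time, the induction splitting off the top
  digit of \<open>w\<close>. In effect, a window is uniform and independent of the digits outside
  it.\<close>

lemma expect_overwrite:
  assumes "i + k \<le> L" "b > 0"
  shows "expect b L F = (\<Sum>w<b ^ k. expect b L (\<lambda>y. F (overwrite b y k i w))) / real b ^ k"
  using assms(1)
proof (induction k arbitrary: F)
  case 0
  have "overwrite b y 0 i w = y" for y w by (auto simp: overwrite_def)
  then show ?case by simp
next
  case (Suc k)
  have ow: "overwrite b (y(i + k := a)) k i w = overwrite b y (Suc k) i (w + a * b ^ k)"
    if "w < b ^ k" "a < b" for y w a
    using digs_add[OF that] by (auto simp: overwrite_def fun_eq_iff less_Suc_eq)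
  have "expect b L F = (\<Sum>w<b ^ k. expect b L (\<lambda>y. F (overwrite b y k i w))) / real b ^ k"
    by (rule Suc.IH) (use Suc.prems in simp)
  also have "\<dots> = (\<Sum>w<b ^ k. (\<Sum>a<b. expect b L (\<lambda>y. F (overwrite b (y(i + k := a)) k i w))) / real b) / real b ^ k"
    by (intro arg_cong2[where f = "(/)"] sum.cong refl expect_resample) (use Suc.prems in simp)
  also have "\<dots> = (\<Sum>w<b ^ k. (\<Sum>a<b. expect b L (\<lambda>y. F (overwrite b y (Suc k) i (w + a * b ^ k)))) / real b) / real b ^ k"
    by (simp add: ow)
  also have "\<dots> = (\<Sum>a<b. \<Sum>w<b ^ k. expect b L (\<lambda>y. F (overwrite b y (Suc k) i (w + a * b ^ k)))) / real b ^ Suc k"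
    by (subst sum.swap) (simp add: sum_divide_distrib[symmetric])
  also have "\<dots> = (\<Sum>w<b ^ Suc k. expect b L (\<lambda>y. F (overwrite b y (Suc k) i w))) / real b ^ Suc k"
    by (simp add: sum_lessThan_mult)
  finally show ?case .
qed

section \<open>A variance bound\<close>

lemma expect_square_deviation:
  assumes "b > 0"
  shows "expect b L (\<lambda>y. (F y - c)\<^sup>2) = expect b L (\<lambda>y. (F y - expect b L F)\<^sup>2) + (expect b L F - c)\<^sup>2"
proof -
  define m where "m = expect b L F"
  have "expect b L (\<lambda>y. (F y - c)\<^sup>2) = expect b L (\<lambda>y. (F y - m)\<^sup>2 + (2 * (m - c) * (F y - m) + (m - c)\<^sup>2))"
    by (rule arg_cong[where f = "expect b L"]) (simp add: fun_eq_iff power2_eq_square algebra_simps)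
  also have "\<dots> = expect b L (\<lambda>y. (F y - m)\<^sup>2) + (2 * (m - c) * (m - m) + (m - c)\<^sup>2)"
    unfolding expect_add expect_cmult expect_diff expect_const[OF assms] m_def ..
  finally show ?thesis by (simp add: m_def)
qed

text \<open>Law of total variance with respect to the last digit: the conditional variances are
  bounded by induction, and each conditional mean differs from the overall mean by at most
  \<open>c\<close>.\<close>

lemma variance_bounded_differences:
  fixes F :: "(nat \<Rightarrow> nat) \<Rightarrow> real"
  assumes "b > 0"
    "\<And>y t a a'. (\<And>i. y i < b) \<Longrightarrow> t < L \<Longrightarrow> a < b \<Longrightarrow> a' < b \<Longrightarrow> \<bar>F (y(t := a)) - F (y(t := a'))\<bar> \<le> c"
  shows "expect b L (\<lambda>y. (F y - expect b L F)\<^sup>2) \<le> real L * c\<^sup>2"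
  using assms(2)
proof (induction L arbitrary: F)
  case 0
  show ?case by (simp add: expect_0)
next
  case (Suc L)
  define G where "G a y = F (y(L := a))" for a y
  define m where "m = expect b (Suc L) F"
  have m: "m = (\<Sum>a<b. expect b L (G a)) / real b"
    unfolding m_def expect_Suc G_def ..
  have var: "expect b L (\<lambda>y. (G a y - expect b L (G a))\<^sup>2) \<le> real L * c\<^sup>2" if "a < b" for a
  proof (rule Suc.IH)
    fix y :: "nat \<Rightarrow> nat" and t a1 a2 assume *: "\<And>i. y i < b" "t < L" "a1 < b" "a2 < b"
    have "\<bar>F (y(L := a, t := a1)) - F (y(L := a, t := a2))\<bar> \<le> c"
      using * that by (intro Suc.prems) auto
    then show "\<bar>G a (y(t := a1)) - G a (y(t := a2))\<bar> \<le> c"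
      using *(2) by (simp add: G_def fun_upd_twist)
  qed
  have dev: "\<bar>expect b L (G a) - m\<bar> \<le> c" if a: "a < b" for a
  proof -
    have "expect b L (G a) - m = (\<Sum>a'<b. expect b L (\<lambda>y. G a y - G a' y)) / real b"
      unfolding m expect_diff using assms(1) by (simp add: sum_subtractf field_simps)
    also have "\<bar>\<dots>\<bar> \<le> (\<Sum>a'<b. c) / real b"
    proof (simp only: abs_divide abs_of_nat, intro divide_right_mono order_trans[OF sum_abs] sum_mono)
      fix a' assume "a' \<in> {..<b}"
      then have "\<bar>expect b L (\<lambda>y. G a y - G a' y)\<bar> \<le> expect b L (\<lambda>y. c)"
        unfolding G_def using a by (intro expect_abs_le assms(1) Suc.prems) auto
      then show "\<bar>expect b L (\<lambda>y. G a y - G a' y)\<bar> \<le> c" using expect_const[OF assms(1)] by simp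
    qed simp
    finally show ?thesis using assms(1) by simp
  qed
  have "expect b (Suc L) (\<lambda>y. (F y - m)\<^sup>2) = (\<Sum>a<b. expect b L (\<lambda>y. (G a y - m)\<^sup>2)) / real b"
    unfolding expect_Suc G_def ..
  also have "\<dots> \<le> (\<Sum>a<b. real L * c\<^sup>2 + c\<^sup>2) / real b"
  proof (intro divide_right_mono sum_mono)
    fix a assume "a \<in> {..<b}"
    then have a: "a < b" by simp
    have "(expect b L (G a) - m)\<^sup>2 \<le> c\<^sup>2"
      using power_mono[OF dev[OF a] abs_ge_zero, of 2] by simp
    then show "expect b L (\<lambda>y. (G a y - m)\<^sup>2) \<le> real L * c\<^sup>2 + c\<^sup>2"
      unfolding expect_square_deviation[OF assms(1), of L "G a" m] using var[OF a] by linarith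
  qed simp
  also have "\<dots> = real (Suc L) * c\<^sup>2" using assms(1) by (simp add: field_simps)
  finally show ?case unfolding m_def .
qed

lemma expect_extend:
  fixes F :: "(nat \<Rightarrow> nat) \<Rightarrow> real"
  assumes "M \<le> L" "b > 0" "\<And>y y'. (\<And>i. i < M \<Longrightarrow> y i = y' i) \<Longrightarrow> F y = F y'"
  shows "expect b L F = expect b M F"
  using assms(1)
proof (induction L rule: dec_induct)
  case (step L)
  have "F (y(L := a)) = F y" for y a using step by (intro assms(3)) simp
  then show ?case using step assms(2) by (simp add: expect_Suc)
qed simp

lemma window_digs: "window b (digs b w) k 0 = w mod b ^ k"
proof (induction k)
  case (Suc k)
  have "w mod b ^ Suc k = b ^ k * (w div b ^ k mod b) + w mod b ^ k"
    by (metis mod_mult2_eq power_Suc2)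
  with Suc show ?case by (simp add: window_Suc digs_def)
qed (simp add: window_def)

lemma window_overwrite:
  assumes "w < b ^ k" shows "window b (overwrite b y k i w) k i = w"
proof -
  have "window b (overwrite b y k i w) k i = window b (digs b w) k 0"
    by (rule window_cong) (simp add: overwrite_def)
  with assms show ?thesis by (simp add: window_digs)
qed

lemma overwrite_less: "b > 0 \<Longrightarrow> y p < b \<Longrightarrow> overwrite b y k i w p < b"
  by (simp add: overwrite_def digs_less)

text \<open>Given all digits to the left of the second window, its digits are forced one after the other,
  even if the windows overlap.\<close>

lemma card_coincide_le:
  assumes "b > 0" "i < i'" "\<And>p. y p < b"
  shows "card {w. w < b ^ k \<and> window b (overwrite b y k i' w) k i = w} \<le> 1"
proof -
  have digits: "\<forall>t<k. overwrite b y k i' w (i + t) = digs b w t"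
    if "w < b ^ k" "window b (overwrite b y k i' w) k i = w" for w
  proof -
    have "window b (overwrite b y k i' w) k i = window b (digs b w) k 0"
      using that by (simp add: window_digs)
    then show ?thesis
      by (subst (asm) window_eq_iff) (simp_all add: overwrite_less digs_less assms)
  qed
  have "w = w'"
    if w: "w < b ^ k" "window b (overwrite b y k i' w) k i = w"
      and w': "w' < b ^ k" "window b (overwrite b y k i' w') k i = w'" for w w'
  proof -
    have "t < k \<Longrightarrow> digs b w t = digs b w' t" for t
    proof (induction t rule: less_induct)
      case (less t)
      have "overwrite b y k i' w (i + t) = overwrite b y k i' w' (i + t)"
        using less assms(2) by (simp add: overwrite_def)
      then show ?case using digits[OF w] digits[OF w'] less.prems by simp
    qed
    then have "window b (digs b w) k 0 = window b (digs b w') k 0"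
      by (intro window_cong) simp
    then show ?thesis using w(1) w'(1) by (simp add: window_digs)
  qed
  then have "card {w. w < b ^ k \<and> window b (overwrite b y k i' w) k i = w} \<le> Suc 0"
    by (subst card_le_Suc0_iff_eq) auto
  then show ?thesis by simp
qed

lemma real_sum_of_bool: "(\<Sum>i<(n::nat). of_bool (P i) :: real) = real (card {i. i < n \<and> P i})"
  by (simp add: of_bool_def sum.If_cases Int_def)

text \<open>The later of the two windows is redrawn; by \<open>card_coincide_le\<close> at most one
  of its \<open>b ^ k\<close> words can agree with the earlier window, whatever the other digits
  are.\<close>

lemma expect_coincide_le:
  assumes b: "b > 0" and "i \<noteq> i'" "i + k \<le> L" "i' + k \<le> L"
  shows "expect b L (\<lambda>y. of_bool (window b y k i = window b y k i')) \<le> 1 / real b ^ k"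
proof -
  have main: "expect b L (\<lambda>y. of_bool (window b y k i = window b y k i')) \<le> 1 / real b ^ k"
    if "i < i'" "i' + k \<le> L" for i i'
  proof -
    have "expect b L (\<lambda>y. of_bool (window b y k i = window b y k i')) =
        (\<Sum>w<b ^ k. expect b L (\<lambda>y. of_bool (window b (overwrite b y k i' w) k i = w))) / real b ^ k"
      by (subst expect_overwrite[OF that(2) b]) (simp add: window_overwrite)
    also have "\<dots> = expect b L (\<lambda>y. real (card {w. w < b ^ k \<and> window b (overwrite b y k i' w) k i = w})) / real b ^ k"
      unfolding real_sum_of_bool[symmetric] expect_sum ..
    also have "\<dots> \<le> expect b L (\<lambda>y. 1) / real b ^ k"
      using card_coincide_le[OF b that(1)] by (intro divide_right_mono expect_mono b) force+
    finally show ?thesis using expect_const[OF b] by simp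
  qed
  consider "i < i'" | "i' < i" using assms(2) by linarith
  then show ?thesis
  proof cases
    case 1
    then show ?thesis using main assms by blast
  next
    case 2
    then show ?thesis using main[of i' i] assms by (simp add: eq_commute)
  qed
qed

section \<open>Size biasing\<close>

definition near :: "nat \<Rightarrow> nat \<Rightarrow> nat \<Rightarrow> nat set" where
  "near k N i = {i'. i' < N \<and> i < i' + k \<and> i' < i + k}"

text \<open>Near positions are those whose windows overlap the window at \<open>i\<close>; the
  windows counted here share no digit with it and are therefore independent of it.\<close>

definition far_occ :: "nat \<Rightarrow> (nat \<Rightarrow> nat) \<Rightarrow> nat \<Rightarrow> nat \<Rightarrow> nat \<Rightarrow> nat \<Rightarrow> nat" where
  "far_occ b y k N i w = card {i'. i' < N \<and> i' \<notin> near k N i \<and> window b y k i' = w}"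

lemma finite_near: "finite (near k N i)" and card_near_le: "card (near k N i) \<le> 2 * k"
proof -
  have sub: "near k N i \<subseteq> {i - k..<i + k}" by (auto simp: near_def)
  then show "finite (near k N i)" by (rule finite_subset) simp
  have "card (near k N i) \<le> card {i - k..<i + k}" using sub by (intro card_mono) auto
  then show "card (near k N i) \<le> 2 * k" by simp
qed

text \<open>Size biasing: conditioned on an occurrence at position \<open>i\<close>, the remaining occurrences of the
  word are distributed almost like the unconditioned ones, because far occurrences are independent
  of the window at \<open>i\<close> and near ones are rare.\<close>

lemma expect_occ_window:
  assumes b: "b > 0" and k: "k > 0" and i: "i < N" and L: "N + k \<le> L"
  shows "\<bar>expect b L (\<lambda>y. of_bool (occ b y k N (window b y k i) = Suc j)) -
    expect b L (\<lambda>y. real (freq b y k N j)) / real b ^ k\<bar> \<le> 4 * real k / real b ^ k"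
proof -
  have bk: "real b ^ k > 0" using b by simp
  \<comment> \<open>The two indicators can differ only if another near window equals the one at
    \<open>i\<close>: at most \<open>2 * k\<close> positions, each with probability at most
    \<open>1 / b ^ k\<close>.\<close>
  have "\<bar>expect b L (\<lambda>y. of_bool (occ b y k N (window b y k i) = Suc j) -
        of_bool (far_occ b y k N i (window b y k i) = j))\<bar>
      \<le> expect b L (\<lambda>y. \<Sum>i'\<in>near k N i - {i}. of_bool (window b y k i = window b y k i'))"
  proof (rule expect_abs_le[OF b])
    fix y :: "nat \<Rightarrow> nat"
    let ?W = "window b y k"
    show "\<bar>of_bool (occ b y k N (?W i) = Suc j) - of_bool (far_occ b y k N i (?W i) = j)\<bar>
        \<le> (\<Sum>i'\<in>near k N i - {i}. of_bool (?W i = ?W i') :: real)"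
    proof (cases "\<exists>i'\<in>near k N i - {i}. ?W i = ?W i'")
      case True
      then obtain i' where i': "i' \<in> near k N i - {i}" "?W i = ?W i'" by blast
      then have "(of_bool (?W i = ?W i') :: real) \<le> (\<Sum>i'\<in>near k N i - {i}. of_bool (?W i = ?W i'))"
        by (intro member_le_sum) (auto simp: finite_near)
      moreover have "\<bar>of_bool p - of_bool q\<bar> \<le> (1::real)" for p q by simp
      ultimately show ?thesis using i'(2) by (smt (verit, best) of_bool_eq(2))
    next
      case False
      then have "i' = i" if "i' \<in> near k N i" "?W i' = ?W i" for i'
        using that False by (metis Diff_iff singletonD)
      then have "{i'. i' < N \<and> ?W i' = ?W i} = insert i {i'. i' < N \<and> i' \<notin> near k N i \<and> ?W i' = ?W i}"
        using i by auto
      moreover have "i \<in> near k N i" using i k by (simp add: near_def)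
      ultimately have "occ b y k N (?W i) = Suc (far_occ b y k N i (?W i))"
        unfolding occ_card far_occ_def by simp
      then show ?thesis by (simp add: sum_nonneg)
    qed
  qed
  also have "\<dots> \<le> (\<Sum>i'\<in>near k N i - {i}. 1 / real b ^ k)"
    unfolding expect_sum using i L
    by (intro sum_mono expect_coincide_le b) (auto simp: near_def)
  also have "\<dots> \<le> (\<Sum>i'\<in>near k N i. 1 / real b ^ k)"
    by (intro sum_mono2 finite_near) auto
  also have "\<dots> = real (card (near k N i)) / real b ^ k" by simp
  also have "\<dots> \<le> real (2 * k) / real b ^ k"
    using card_near_le[of k N i] bk by (intro divide_right_mono) linarith+
  finally have 1: "\<bar>expect b L (\<lambda>y. of_bool (occ b y k N (window b y k i) = Suc j)) -
      expect b L (\<lambda>y. of_bool (far_occ b y k N i (window b y k i) = j))\<bar> \<le> 2 * real k / real b ^ k"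
    unfolding expect_diff by simp
  have far: "far_occ b (overwrite b y k i w) k N i w' = far_occ b y k N i w'" for y w w'
  proof -
    have "window b (overwrite b y k i w) k i' = window b y k i'" if "i' < N" "i' \<notin> near k N i" for i'
      using that by (intro window_cong) (auto simp: overwrite_def near_def)
    then show ?thesis unfolding far_occ_def by (intro arg_cong[where f = card]) auto
  qed
  \<comment> \<open>The window at \<open>i\<close> is redrawn as a uniform word, which leaves the
    far count untouched; averaging over the words produces a frequency.\<close>
  have "expect b L (\<lambda>y. of_bool (far_occ b y k N i (window b y k i) = j)) =
      (\<Sum>w<b ^ k. expect b L (\<lambda>y. of_bool (far_occ b y k N i w = j))) / real b ^ k"
    using i L by (subst expect_overwrite[of i k L b, OF _ b]) (simp_all add: window_overwrite far)
  also have "\<dots> = expect b L (\<lambda>y. real (card {w. w < b ^ k \<and> far_occ b y k N i w = j})) / real b ^ k"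
    unfolding real_sum_of_bool[symmetric] expect_sum ..
  finally have 2: "expect b L (\<lambda>y. of_bool (far_occ b y k N i (window b y k i) = j)) =
      expect b L (\<lambda>y. real (card {w. w < b ^ k \<and> far_occ b y k N i w = j})) / real b ^ k" .
  \<comment> \<open>Omitting the near positions alters the counts of at most \<open>2 * k\<close>
    words. Together with the first error this gives the constant 4.\<close>
  have "\<bar>expect b L (\<lambda>y. real (card {w. w < b ^ k \<and> far_occ b y k N i w = j}) - real (freq b y k N j))\<bar>
      \<le> expect b L (\<lambda>y. 2 * real k)"
  proof (rule expect_abs_le[OF b])
    fix y :: "nat \<Rightarrow> nat"
    define D where "D = window b y k ` near k N i"
    have "{i'. i' < N \<and> i' \<notin> near k N i \<and> window b y k i' = w} = {i'. i' < N \<and> window b y k i' = w}"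
      if "w \<notin> D" for w
      using that by (auto simp: D_def)
    then have "\<bar>real (card {w. w < b ^ k \<and> far_occ b y k N i w = j}) - real (freq b y k N j)\<bar> \<le> real (card D)"
      unfolding freq_card occ_card far_occ_def by (intro card_diff_le) (auto simp: D_def finite_near)
    also have "card D \<le> 2 * k"
      unfolding D_def using card_image_le[OF finite_near] card_near_le by (rule order_trans)
    finally show "\<bar>real (card {w. w < b ^ k \<and> far_occ b y k N i w = j}) - real (freq b y k N j)\<bar> \<le> 2 * real k"
      by simp
  qed
  then have "\<bar>expect b L (\<lambda>y. real (card {w. w < b ^ k \<and> far_occ b y k N i w = j})) -
      expect b L (\<lambda>y. real (freq b y k N j))\<bar> / real b ^ k \<le> 2 * real k / real b ^ k"
    unfolding expect_diff expect_const[OF b] using bk by (intro divide_right_mono) simp_all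
  then have 3: "\<bar>expect b L (\<lambda>y. of_bool (far_occ b y k N i (window b y k i) = j)) -
      expect b L (\<lambda>y. real (freq b y k N j)) / real b ^ k\<bar> \<le> 2 * real k / real b ^ k"
    unfolding 2 diff_divide_distrib[symmetric] abs_divide using bk by simp
  have "4 * real k / real b ^ k = 2 * real k / real b ^ k + 2 * real k / real b ^ k"
    by (simp add: add_divide_distrib[symmetric])
  with 1 3 show ?thesis by linarith
qed

lemma expect_mult_freq_Suc:
  assumes b: "b > 0" and k: "k > 0" and L: "N + k \<le> L"
  shows "\<bar>real (Suc j) * expect b L (\<lambda>y. real (freq b y k N (Suc j))) -
    real N / real b ^ k * expect b L (\<lambda>y. real (freq b y k N j))\<bar> \<le> 4 * real k * real N / real b ^ k"
proof -
  have "real (Suc j) * expect b L (\<lambda>y. real (freq b y k N (Suc j))) =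
      expect b L (\<lambda>y. \<Sum>i<N. of_bool (occ b y k N (window b y k i) = Suc j))"
    unfolding expect_cmult[symmetric]
  proof (rule expect_cong[OF b])
    fix y :: "nat \<Rightarrow> nat" assume "\<And>i. y i < b"
    from mult_freq_Suc[of y b j k N, OF this]
    show "real (Suc j) * real (freq b y k N (Suc j)) = (\<Sum>i<N. of_bool (occ b y k N (window b y k i) = Suc j))"
      by (metis (mono_tags, lifting) of_nat_mult of_nat_of_bool of_nat_sum sum.cong)
  qed
  also have "\<dots> = (\<Sum>i<N. expect b L (\<lambda>y. of_bool (occ b y k N (window b y k i) = Suc j)))"
    by (rule expect_sum)
  finally have "real (Suc j) * expect b L (\<lambda>y. real (freq b y k N (Suc j))) -
      real N / real b ^ k * expect b L (\<lambda>y. real (freq b y k N j)) =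
     (\<Sum>i<N. expect b L (\<lambda>y. of_bool (occ b y k N (window b y k i) = Suc j)) -
        expect b L (\<lambda>y. real (freq b y k N j)) / real b ^ k)"
    by (simp add: sum_subtractf)
  moreover have "\<bar>\<Sum>i<N. expect b L (\<lambda>y. of_bool (occ b y k N (window b y k i) = Suc j)) -
        expect b L (\<lambda>y. real (freq b y k N j)) / real b ^ k\<bar> \<le> (\<Sum>i<N. 4 * real k / real b ^ k)"
    by (rule order_trans[OF sum_abs], rule sum_mono, rule expect_occ_window[OF b k _ L]) simp
  moreover have "(\<Sum>i<N. 4 * real k / real b ^ k) = 4 * real k * real N / real b ^ k" by simp
  ultimately show ?thesis by (simp only:)
qed

section \<open>Imbalance and irregular word lengths\<close>

definition imbalance :: "nat \<Rightarrow> (nat \<Rightarrow> nat) \<Rightarrow> nat \<Rightarrow> nat \<Rightarrow> nat \<Rightarrow> nat \<Rightarrow> real" where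
  "imbalance b d k p q j =
     real (q * Suc j * freq b d k (Suc (p * b ^ k div q)) (Suc j)) -
     real (p * freq b d k (Suc (p * b ^ k div q)) j)"

text \<open>One event per word length, depending on finitely many digits: the parameter ranges grow
  with \<open>k\<close> and the tolerance is \<open>b ^ k / k\<close>, so avoiding it for all large
  \<open>k\<close> controls every fixed choice of parameters.\<close>

definition irregular :: "nat \<Rightarrow> nat \<Rightarrow> (nat \<Rightarrow> nat) \<Rightarrow> bool" where
  "irregular b k d \<longleftrightarrow>
     (\<exists>p<k. \<exists>q<k. \<exists>j<k. real b ^ k < real k * \<bar>imbalance b d k (Suc p) (Suc q) j\<bar>)"

text \<open>An upper bound for the digits that \<open>irregular\<close> inspects: for ratios up to
  \<open>k\<close> there are at most \<open>k * b ^ k + 1\<close> starting positions, the summand 1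
  accounting for position 0, and the last windows need \<open>k\<close> more digits.\<close>

definition span :: "nat \<Rightarrow> nat \<Rightarrow> nat" where
  "span b k = k * b ^ k + k + 1"

text \<open>One digit lies in at most \<open>k\<close> windows, so each frequency changes by at most
  \<open>2 * k\<close>; the coefficients are at most \<open>k * k\<close> and
  \<open>k\<close>.\<close>

lemma imbalance_update_le:
  assumes "p \<le> k" "q \<le> k" "j < k"
  shows "\<bar>imbalance b (y(t := a)) k p q j - imbalance b (y(t := a')) k p q j\<bar> \<le> 4 * real k ^ 3"
proof -
  define N where "N = Suc (p * b ^ k div q)"
  define f where "f a j = real (freq b (y(t := a)) k N j)" for a j
  define S where "S = {i. i \<le> t \<and> t < i + k}"
  have S: "finite S" "card S \<le> k"
  proof -
    have sub: "S \<subseteq> {Suc t - k..<Suc t}" by (auto simp: S_def)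
    then show "finite S" by (rule finite_subset) simp
    have "card S \<le> card {Suc t - k..<Suc t}" using sub by (intro card_mono) auto
    then show "card S \<le> k" by simp
  qed
  have f: "\<bar>f a j - f a' j\<bar> \<le> 2 * real k" for j
  proof -
    have "\<bar>f a j - f a' j\<bar> \<le> 2 * real (card S)"
      unfolding f_def
    proof (rule freq_diff_le[OF S(1)])
      fix i assume "i \<notin> S"
      then show "window b (y(t := a)) k i = window b (y(t := a')) k i"
        by (intro window_cong) (auto simp: S_def)
    qed
    with S(2) show ?thesis by linarith
  qed
  have "imbalance b (y(t := a)) k p q j - imbalance b (y(t := a')) k p q j =
      real (q * Suc j) * (f a (Suc j) - f a' (Suc j)) - real p * (f a j - f a' j)"
    by (simp add: imbalance_def f_def N_def algebra_simps)
  also have "\<bar>\<dots>\<bar> \<le> real (q * Suc j) * \<bar>f a (Suc j) - f a' (Suc j)\<bar> + real p * \<bar>f a j - f a' j\<bar>"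
    by (rule order_trans[OF abs_triangle_ineq4]) (simp add: abs_mult)
  also have "\<dots> \<le> real (k * k) * (2 * real k) + real k * (2 * real k)"
  proof -
    have "q * Suc j \<le> k * k" using assms by (intro mult_le_mono) auto
    then show ?thesis
      using f[of j] f[of "Suc j"] assms(1)
      by (intro add_mono mult_mono) (simp_all del: of_nat_mult of_nat_Suc mult_Suc_right)
  qed
  also have "\<dots> \<le> 4 * real k ^ 3"
    using assms(3) power_increasing[of 2 3 "real k"] by (simp add: power2_eq_square power3_eq_cube)
  finally show ?thesis .
qed

text \<open>Size biasing contributes at most \<open>8 * k ^ 3\<close>, because \<open>N\<close> is
  at most \<open>2 * k * b ^ k\<close>. Replacing \<open>q * N\<close> by \<open>p * b ^ k\<close>
  is a rounding error of at most \<open>q\<close>, which contributes at most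
  \<open>k\<close>.\<close>

lemma expect_imbalance_le:
  assumes b: "b > 0" and "p \<le> k" "q \<le> k" "0 < q" "j < k" "span b k \<le> L"
  shows "\<bar>expect b L (\<lambda>y. imbalance b y k p q j)\<bar> \<le> 9 * real k ^ 3"
proof -
  define N where "N = Suc (p * b ^ k div q)"
  define A where "A j = expect b L (\<lambda>y. real (freq b y k N j))" for j
  have k: "k > 0" and bk: "real b ^ k > 0" using assms by auto
  have "p * b ^ k div q \<le> p * b ^ k" by simp
  also have "\<dots> \<le> k * b ^ k" using assms by simp
  finally have N_le: "N \<le> k * b ^ k + 1" by (simp add: N_def)
  then have L: "N + k \<le> L" using assms(6) by (simp add: span_def)
  have bk1: "1 \<le> real b ^ k" using b by simp
  have N_bk: "real N / real b ^ k \<le> 2 * real k"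
  proof -
    have "real N \<le> real (k * b ^ k + 1)" using N_le by (simp only: of_nat_le_iff)
    also have "\<dots> \<le> real k * real b ^ k + real k * real b ^ k"
      using k bk1 mult_mono[of 1 "real k" 1 "real b ^ k"] by simp
    finally show ?thesis using bk by (simp add: divide_le_eq)
  qed
  have qN: "\<bar>real q * (real N / real b ^ k) - real p\<bar> \<le> real q / real b ^ k"
  proof -
    have "p * b ^ k < q * N" unfolding N_def using dividend_less_times_div[of q "p * b ^ k"] assms(4) by simp
    then have "real p * real b ^ k \<le> real q * real N" by (metis less_imp_le of_nat_le_iff of_nat_mult of_nat_power)
    moreover have "q * N \<le> p * b ^ k + q" unfolding N_def by simp
    then have "real q * real N \<le> real p * real b ^ k + real q"
      by (metis of_nat_add of_nat_le_iff of_nat_mult of_nat_power)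
    ultimately have "\<bar>real q * real N - real p * real b ^ k\<bar> \<le> real q" by linarith
    then have "\<bar>real q * real N - real p * real b ^ k\<bar> / real b ^ k \<le> real q / real b ^ k"
      using bk by (intro divide_right_mono) auto
    moreover have "real q * (real N / real b ^ k) - real p = (real q * real N - real p * real b ^ k) / real b ^ k"
      using bk by (simp add: field_simps)
    ultimately show ?thesis using bk by simp
  qed
  have A_le: "0 \<le> A j" "A j \<le> real b ^ k" for j
  proof -
    have "A j \<le> expect b L (\<lambda>y. real b ^ k)" unfolding A_def
      by (intro expect_mono b) (metis freq_le of_nat_le_iff of_nat_power)
    then show "A j \<le> real b ^ k" using expect_const[OF b] by simp
    have "expect b L (\<lambda>y. 0) \<le> A j" unfolding A_def by (intro expect_mono b) simp
    then show "0 \<le> A j" using expect_const[OF b] by simp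
  qed
  have "expect b L (\<lambda>y. imbalance b y k p q j) = real q * (real (Suc j) * A (Suc j)) - real p * A j"
    unfolding A_def N_def expect_cmult[symmetric] expect_diff[symmetric]
    by (simp add: imbalance_def algebra_simps)
  also have "\<dots> = real q * (real (Suc j) * A (Suc j) - real N / real b ^ k * A j) +
      (real q * (real N / real b ^ k) - real p) * A j"
    by (simp add: algebra_simps)
  also have "\<bar>\<dots>\<bar> \<le> real q * \<bar>real (Suc j) * A (Suc j) - real N / real b ^ k * A j\<bar> +
      \<bar>real q * (real N / real b ^ k) - real p\<bar> * A j"
    using A_le(1)[of j] by (rule_tac order_trans[OF abs_triangle_ineq]) (simp add: abs_mult)
  also have "\<dots> \<le> real q * (4 * real k * (real N / real b ^ k)) + real q / real b ^ k * real b ^ k"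
    using expect_mult_freq_Suc[OF b k L, of j] qN A_le
    by (intro add_mono mult_left_mono mult_mono) (simp_all add: A_def)
  also have "\<dots> \<le> real k * (4 * real k * (2 * real k)) + real k"
    using assms(3) N_bk bk by (intro add_mono mult_mono) simp_all
  also have "\<dots> \<le> 9 * real k ^ 3"
    using k power_increasing[of 1 3 "real k"] by (simp add: power3_eq_cube)
  finally show ?thesis .
qed

lemma span_le:
  assumes "b > 0" "k > 0" shows "real (span b k) \<le> 3 * real k * real b ^ k"
proof -
  from assms have "1 \<le> b ^ k" by simp
  have "k * 1 \<le> k * b ^ k" "1 * 1 \<le> k * b ^ k"
    using \<open>1 \<le> b ^ k\<close> assms by (intro mult_le_mono; simp)+
  then have "span b k \<le> 3 * (k * b ^ k)" unfolding span_def by linarith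
  then have "real (span b k) \<le> real (3 * (k * b ^ k))" by (simp only: of_nat_le_iff)
  then show ?thesis by simp
qed

text \<open>The second moment is variance plus squared mean. At most \<open>3 * k * b ^ k\<close>
  digits with influence \<open>4 * k ^ 3\<close> give the coefficient 48, the mean bound
  \<open>9 * k ^ 3\<close> gives 81.\<close>

lemma expect_imbalance_square_le:
  assumes b: "b > 0" and "p \<le> k" "q \<le> k" "0 < q" "j < k"
  shows "expect b (span b k) (\<lambda>y. (imbalance b y k p q j)\<^sup>2) \<le> 129 * real k ^ 7 * real b ^ k"
proof -
  define F where "F y = imbalance b y k p q j" for y
  define L where "L = span b k"
  have k: "k > 0" using assms by auto
  have bk: "1 \<le> real b ^ k" using b by simp
  have "expect b L (\<lambda>y. (F y - expect b L F)\<^sup>2) \<le> real L * (4 * real k ^ 3)\<^sup>2"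
    unfolding F_def by (intro variance_bounded_differences b imbalance_update_le assms)
  also have "\<dots> \<le> 3 * real k * real b ^ k * (4 * real k ^ 3)\<^sup>2"
    unfolding L_def by (intro mult_right_mono span_le b k) simp
  also have "\<dots> = 48 * real k ^ 7 * real b ^ k"
    by (simp add: power_numeral_reduce)
  finally have var: "expect b L (\<lambda>y. (F y - expect b L F)\<^sup>2) \<le> 48 * real k ^ 7 * real b ^ k" .
  have "\<bar>expect b L F\<bar> \<le> 9 * real k ^ 3"
    unfolding F_def by (intro expect_imbalance_le b assms) (simp add: L_def)
  then have "(expect b L F)\<^sup>2 \<le> (9 * real k ^ 3)\<^sup>2"
    by (metis abs_ge_zero power2_abs power_mono)
  also have "\<dots> = 81 * (real k ^ 6 * 1)" by (simp add: power_mult_distrib power_mult[symmetric])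
  also have "\<dots> \<le> 81 * (real k ^ 7 * real b ^ k)"
    using k bk by (intro mult_left_mono mult_mono power_increasing) simp_all
  finally have "(expect b L F)\<^sup>2 \<le> 81 * real k ^ 7 * real b ^ k" by simp
  with var expect_square_deviation[OF b, of L F 0] have "expect b L (\<lambda>y. (F y)\<^sup>2) \<le> 129 * real k ^ 7 * real b ^ k"
    by simp
  then show ?thesis unfolding F_def L_def .
qed

text \<open>Chebyshev's inequality at height \<open>b ^ k / k\<close> and a union bound over
  \<open>k ^ 3\<close> parameter triples; the exponent 12 is 2 + 7 + 3.\<close>

lemma expect_irregular_le:
  assumes b: "b > 0"
  shows "expect b (span b k) (\<lambda>y. of_bool (irregular b k y)) \<le> 129 * real k ^ 12 / real b ^ k"
proof (cases "k = 0")
  case True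
  then show ?thesis using expect_const[OF b] by (simp add: irregular_def)
next
  case False
  define L where "L = span b k"
  define I where "I p q j y = imbalance b y k (Suc p) (Suc q) j" for p q j y
  define c where "c = (real k / real b ^ k)\<^sup>2"
  have bk: "real b ^ k > 0" using b by simp
  have "expect b L (\<lambda>y. of_bool (irregular b k y)) \<le> expect b L (\<lambda>y. \<Sum>p<k. \<Sum>q<k. \<Sum>j<k. c * (I p q j y)\<^sup>2)"
  proof (rule expect_mono[OF b])
    fix y
    have nonneg: "0 \<le> c * (I p q j y)\<^sup>2" for p q j by (simp add: c_def)
    show "of_bool (irregular b k y) \<le> (\<Sum>p<k. \<Sum>q<k. \<Sum>j<k. c * (I p q j y)\<^sup>2)"
    proof (cases "irregular b k y")
      case True
      then obtain p q j where *: "p < k" "q < k" "j < k" "real b ^ k < real k * \<bar>I p q j y\<bar>"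
        unfolding irregular_def I_def by blast
      then have "1 \<le> real k / real b ^ k * \<bar>I p q j y\<bar>" using bk by (simp add: field_simps)
      then have "1 \<le> (real k / real b ^ k * \<bar>I p q j y\<bar>)\<^sup>2" by (rule one_le_power)
      then have "1 \<le> c * (I p q j y)\<^sup>2" by (simp add: c_def power_mult_distrib power_divide)
      also have "\<dots> \<le> (\<Sum>j<k. c * (I p q j y)\<^sup>2)"
        by (rule member_le_sum) (simp_all only: lessThan_iff * nonneg finite_lessThan)
      also have "\<dots> \<le> (\<Sum>q<k. \<Sum>j<k. c * (I p q j y)\<^sup>2)"
        by (rule member_le_sum) (simp_all only: lessThan_iff * nonneg finite_lessThan sum_nonneg)
      also have "\<dots> \<le> (\<Sum>p<k. \<Sum>q<k. \<Sum>j<k. c * (I p q j y)\<^sup>2)"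
        by (rule member_le_sum) (simp_all only: lessThan_iff * nonneg finite_lessThan sum_nonneg)
      finally show ?thesis using True by simp
    next
      case False
      then show ?thesis using nonneg by (simp add: sum_nonneg)
    qed
  qed
  also have "\<dots> = (\<Sum>p<k. \<Sum>q<k. \<Sum>j<k. c * expect b L (\<lambda>y. (I p q j y)\<^sup>2))"
    unfolding expect_sum expect_cmult ..
  also have "\<dots> \<le> (\<Sum>p<k. \<Sum>q<k. \<Sum>j<k. c * (129 * real k ^ 7 * real b ^ k))"
    unfolding I_def L_def
    by (intro sum_mono mult_left_mono expect_imbalance_square_le b) (auto simp: c_def)
  also have "\<dots> = 129 * (real k * real k * real k * (real k)\<^sup>2 * real k ^ 7) / real b ^ k"
    using b by (simp add: c_def power_divide power2_eq_square)
  also have "real k * real k * real k * (real k)\<^sup>2 * real k ^ 7 = real k ^ 12"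
    by (simp add: power_numeral_reduce)
  finally show ?thesis unfolding L_def .
qed

lemma irregular_cong:
  assumes "\<And>i. i < span b k \<Longrightarrow> d i = d' i"
  shows "irregular b k d \<longleftrightarrow> irregular b k d'"
proof -
  have "freq b d k (Suc (Suc p * b ^ k div Suc q)) j = freq b d' k (Suc (Suc p * b ^ k div Suc q)) j"
    if "p < k" for p q j
  proof -
    have "Suc p * b ^ k div Suc q \<le> Suc p * b ^ k" by simp
    also have "\<dots> \<le> k * b ^ k" using that by (intro mult_le_mono1) simp
    finally have "window b d k i = window b d' k i" if "i < Suc (Suc p * b ^ k div Suc q)" for i
      using that by (intro window_cong assms) (simp add: span_def)
    then show ?thesis unfolding freq_def occ_def by simp
  qed
  then show ?thesis unfolding irregular_def imbalance_def by simp metis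
qed

section \<open>Poisson genericity without the exponential function\<close>

text \<open>The floor commutes with adding the integer \<open>k\<close>, so the number of starting
  positions is one more than the floor of \<open>lam * b ^ k\<close>. Words as lists correspond
  bijectively to their codes.\<close>

lemma Z_eq_freq:
  assumes d: "\<And>i. d i < b" and lam: "lam > 0"
  shows "Z b lam j k d = real (freq b d k (Suc (nat \<lfloor>lam * real b ^ k\<rfloor>)) j) / real b ^ k"
proof -
  have b: "b > 0" using d[of 0] by simp
  define N where "N = Suc (nat \<lfloor>lam * real b ^ k\<rfloor>)"
  have "0 \<le> \<lfloor>lam * real b ^ k\<rfloor>" using lam b by simp
  then have "nat \<lfloor>lam * real b ^ k + real k\<rfloor> = nat \<lfloor>lam * real b ^ k\<rfloor> + k"
    by (simp add: nat_add_distrib)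
  then have u: "restrict_seq d (lam * real b ^ k + real k) = map d [0..<nat \<lfloor>lam * real b ^ k\<rfloor> + k]"
    unfolding restrict_seq_def by simp
  have occ_list: "occurrences w (restrict_seq d (lam * real b ^ k + real k)) = card {i. i < N \<and> map d [i..<i + k] = w}"
    if "length w = k" for w
  proof -
    have "take k (drop i (map d [0..<nat \<lfloor>lam * real b ^ k\<rfloor> + k])) = map d [i..<i + k]" if "i < N" for i
      using that by (simp add: drop_map take_map N_def)
    then have "{i. i + k \<le> nat \<lfloor>lam * real b ^ k\<rfloor> + k \<and> take k (drop i (map d [0..<nat \<lfloor>lam * real b ^ k\<rfloor> + k])) = w}
        = {i. i < N \<and> map d [i..<i + k] = w}"
      by (auto simp: N_def less_Suc_eq_le)
    with that show ?thesis unfolding u occurrences_def by simp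
  qed
  define f where "f c = map (digs b c) [0..<k]" for c
  have f: "map d [i..<i + k] = f c \<longleftrightarrow> window b d k i = c" if "c < b ^ k" for i c
  proof -
    have "map d [i..<i + k] = f c \<longleftrightarrow> (\<forall>t<k. d (i + t) = digs b c (0 + t))"
      unfolding f_def list_eq_iff_nth_eq by simp
    also have "\<dots> \<longleftrightarrow> window b d k i = window b (digs b c) k 0"
      by (rule window_eq_iff[symmetric]) (simp_all add: d digs_less b)
    finally show ?thesis using that by (simp add: window_digs)
  qed
  have "bij_betw f {c. c < b ^ k \<and> occ b d k N c = j}
    {w. length w = k \<and> set w \<subseteq> {0..<b} \<and> card {i. i < N \<and> map d [i..<i + k] = w} = j}"
  proof (rule bij_betwI')
    fix c c' assume c: "c \<in> {c. c < b ^ k \<and> occ b d k N c = j}" "c' \<in> {c. c < b ^ k \<and> occ b d k N c = j}"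
    have "f c = f c' \<Longrightarrow> window b (digs b c) k 0 = window b (digs b c') k 0"
      by (rule window_cong) (simp add: f_def list_eq_iff_nth_eq)
    then show "f c = f c' \<longleftrightarrow> c = c'" using c by (auto simp: window_digs)
  next
    fix c assume c: "c \<in> {c. c < b ^ k \<and> occ b d k N c = j}"
    then have "card {i. i < N \<and> map d [i..<i + k] = f c} = j" by (simp add: f occ_card)
    moreover have "set (f c) \<subseteq> {0..<b}" using digs_less[OF b] by (auto simp: f_def)
    ultimately show "f c \<in> {w. length w = k \<and> set w \<subseteq> {0..<b} \<and> card {i. i < N \<and> map d [i..<i + k] = w} = j}"
      by (simp add: f_def)
  next
    fix w assume w: "w \<in> {w. length w = k \<and> set w \<subseteq> {0..<b} \<and> card {i. i < N \<and> map d [i..<i + k] = w} = j}"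
    define c where "c = window b (\<lambda>t. w ! t) k 0"
    have wb: "w ! t < b" if "t < k" for t
    proof -
      have "w ! t \<in> set w" using w that by (intro nth_mem) simp
      then show ?thesis using w by auto
    qed
    have c: "c < b ^ k" unfolding c_def by (rule window_less) (simp add: wb)
    have "w = f c"
      using w window_digit[of k "\<lambda>t. w ! t" 0 b] wb
      by (auto simp: list_eq_iff_nth_eq f_def c_def digs_def)
    moreover from this have "occ b d k N c = j" using w f[OF c] by (simp add: occ_card)
    ultimately show "\<exists>c\<in>{c. c < b ^ k \<and> occ b d k N c = j}. w = f c" using c by blast
  qed
  from bij_betw_same_card[OF this]
  have "freq b d k N j = card {w. length w = k \<and> set w \<subseteq> {0..<b} \<and> card {i. i < N \<and> map d [i..<i + k] = w} = j}"
    by (simp add: freq_card)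
  also have "{w. length w = k \<and> set w \<subseteq> {0..<b} \<and> card {i. i < N \<and> map d [i..<i + k] = w} = j} =
     {w. length w = k \<and> set w \<subseteq> {0..<b} \<and> occurrences w (restrict_seq d (lam * real b ^ k + real k)) = j}"
    using occ_list by auto
  finally show ?thesis unfolding Z_def N_def by simp
qed

section \<open>Total mass and tightness of the occurrence counts\<close>

lemma sum_occ:
  assumes "\<And>i. d i < b" shows "(\<Sum>w<b ^ k. occ b d k N w) = N"
proof -
  have "(\<Sum>w<b ^ k. of_bool (window b d k i = w) :: nat) = 1" for i
  proof -
    have "window b d k i < b ^ k" using assms by (rule window_less)
    then have "(\<Sum>w<b ^ k. of_bool (window b d k i = w) :: nat) = (\<Sum>w\<in>{window b d k i}. of_bool (window b d k i = w))"
      by (intro sum.mono_neutral_right) auto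
    then show ?thesis by simp
  qed
  then show ?thesis unfolding occ_def by (subst sum.swap) simp
qed

lemma sum_freq_le: "(\<Sum>j\<le>J. freq b d k N j) \<le> b ^ k"
proof -
  have "(\<Sum>j\<le>J. freq b d k N j) = (\<Sum>w<b ^ k. \<Sum>j\<le>J. of_bool (occ b d k N w = j))"
    unfolding freq_def by (rule sum.swap)
  also have "\<dots> \<le> (\<Sum>w<b ^ k. 1)"
  proof (rule sum_mono)
    fix w
    have "(\<Sum>j\<le>J. of_bool (occ b d k N w = j) :: nat) = of_bool (occ b d k N w \<le> J)"
      by (simp add: of_bool_def)
    then show "(\<Sum>j\<le>J. of_bool (occ b d k N w = j) :: nat) \<le> 1" by simp
  qed
  finally show ?thesis by simp
qed

text \<open>Markov's inequality: the occurrences add up to \<open>N\<close>, so at most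
  \<open>N / (J + 1)\<close> words occur more than \<open>J\<close> times.\<close>

lemma sum_freq_ge:
  assumes "\<And>i. d i < b"
  shows "Suc J * b ^ k \<le> Suc J * (\<Sum>j\<le>J. freq b d k N j) + N"
proof -
  have "(\<Sum>w<b ^ k. Suc J) \<le> (\<Sum>w<b ^ k. Suc J * (\<Sum>j\<le>J. of_bool (occ b d k N w = j)) + occ b d k N w)"
  proof (rule sum_mono)
    fix w
    show "Suc J \<le> Suc J * (\<Sum>j\<le>J. of_bool (occ b d k N w = j)) + occ b d k N w"
    proof (cases "occ b d k N w \<le> J")
      case True
      then have "(of_bool (occ b d k N w = occ b d k N w) :: nat) \<le> (\<Sum>j\<le>J. of_bool (occ b d k N w = j))"
        by (intro member_le_sum) auto
      then have "Suc J * 1 \<le> Suc J * (\<Sum>j\<le>J. of_bool (occ b d k N w = j))" by (intro mult_le_mono2) simp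
      then show ?thesis by simp
    qed simp
  qed
  also have "\<dots> = Suc J * (\<Sum>w<b ^ k. \<Sum>j\<le>J. of_bool (occ b d k N w = j)) + N"
    using sum_occ[OF assms] by (simp add: sum.distrib sum_distrib_left)
  also have "(\<Sum>w<b ^ k. \<Sum>j\<le>J. of_bool (occ b d k N w = j)) = (\<Sum>j\<le>J. freq b d k N j)"
    unfolding freq_def by (rule sum.swap)
  finally show ?thesis by (simp add: mult.commute)
qed

text \<open>The Poisson distribution is the only probability distribution satisfying the recurrence
  \<open>(j + 1) p\<^bsub>j+1\<^esub> = \<lambda> p\<^bsub>j\<^esub>\<close>; no mass escapes because the mean stays bounded. This
  characterization avoids the transcendental constant \<open>exp (- \<lambda>)\<close>.\<close>

lemma poisson_limit_of_recurrence:
  fixes x :: "nat \<Rightarrow> nat \<Rightarrow> real"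
  assumes rec: "\<And>j. (\<lambda>k. real (Suc j) * x (Suc j) k - lam * x j k) \<longlonglongrightarrow> 0"
    and x0: "\<And>k. 0 \<le> x 0 k" "\<And>k. x 0 k \<le> 1" and lam: "lam \<ge> 0"
    and le: "\<And>J k. (\<Sum>j\<le>J. x j k) \<le> 1" and ge: "\<And>J k. 1 - C / real (Suc J) \<le> (\<Sum>j\<le>J. x j k)"
  shows "(\<lambda>k. x j k) \<longlonglongrightarrow> exp (- lam) * lam ^ j / fact j"
proof -
  \<comment> \<open>The recurrence alone determines every \<open>x j\<close> asymptotically as a
    multiple of \<open>x 0\<close>.\<close>
  have dev: "(\<lambda>k. x j k - x 0 k * (lam ^ j / fact j)) \<longlonglongrightarrow> 0" for j
  proof (induction j)
    case (Suc j)
    have lim: "(\<lambda>k. ((real (Suc j) * x (Suc j) k - lam * x j k) + lam * (x j k - x 0 k * (lam ^ j / fact j))) / real (Suc j))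
        \<longlonglongrightarrow> (0 + lam * 0) / real (Suc j)"
      by (intro tendsto_intros rec Suc) simp
    have eq: "((real (Suc j) * x (Suc j) k - lam * x j k) + lam * (x j k - x 0 k * (lam ^ j / fact j))) / real (Suc j) =
        x (Suc j) k - x 0 k * (lam ^ Suc j / fact (Suc j))" for k
    proof -
      have "(s * X - lam * Y + lam * (Y - W * (lam ^ j / f))) / s = X - W * (lam ^ Suc j / (s * f))"
        if "f \<noteq> 0" "s \<noteq> 0" for X Y W f s
        using that by (simp add: field_simps)
      from this[of "fact j" "real (Suc j)"] show ?thesis by (simp only: fact_Suc) simp
    qed
    show ?case using lim unfolding eq by simp
  qed simp
  define E where "E J = (\<Sum>j\<le>J. lam ^ j / fact j)" for J
  have E_lim: "E \<longlonglongrightarrow> exp lam"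
    unfolding E_def using exp_converges[of lam] by (simp add: sums_def_le divide_inverse mult.commute)
  have C_lim: "(\<lambda>J. C / real (Suc J)) \<longlonglongrightarrow> 0"
    using LIMSEQ_Suc[OF lim_const_over_n[of C]] by simp
  \<comment> \<open>Normalization fixes \<open>x 0\<close>. First \<open>J\<close> is chosen,
    uniformly in \<open>k\<close>, such that the mass beyond \<open>J\<close> and the tail of the
    exponential series are small; then \<open>k\<close> is sent to infinity.\<close>
  have "(\<lambda>k. x 0 k * exp lam) \<longlonglongrightarrow> 1"
  proof (rule LIMSEQ_I)
    fix r :: real assume r: "r > 0"
    have "\<forall>\<^sub>F J in sequentially. \<bar>E J - exp lam\<bar> < r / 3 \<and> C / real (Suc J) < r / 3"
      using tendstoD[OF E_lim, of "r / 3"] order_tendstoD(2)[OF C_lim, of "r / 3"] r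
      by (auto simp: dist_real_def intro: eventually_conj)
    then obtain J where J: "\<bar>E J - exp lam\<bar> < r / 3" "C / real (Suc J) < r / 3"
      unfolding eventually_sequentially by blast
    have "(\<lambda>k. \<Sum>j\<le>J. x j k - x 0 k * (lam ^ j / fact j)) \<longlonglongrightarrow> (\<Sum>j\<le>J. 0)"
      by (intro tendsto_sum dev)
    then have "(\<lambda>k. (\<Sum>j\<le>J. x j k) - x 0 k * E J) \<longlonglongrightarrow> 0"
      by (simp add: sum_subtractf E_def sum_distrib_left)
    from LIMSEQ_D[OF this, of "r / 3"] r obtain K where
      K: "\<And>k. k \<ge> K \<Longrightarrow> \<bar>(\<Sum>j\<le>J. x j k) - x 0 k * E J\<bar> < r / 3" by auto
    have "norm (x 0 k * exp lam - 1) < r" if "k \<ge> K" for k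
    proof -
      have "\<bar>x 0 k * E J - x 0 k * exp lam\<bar> = x 0 k * \<bar>E J - exp lam\<bar>"
        using x0(1) by (simp add: right_diff_distrib[symmetric] abs_mult)
      also have "\<dots> \<le> 1 * \<bar>E J - exp lam\<bar>" using x0(2) by (intro mult_right_mono) auto
      finally have "\<bar>x 0 k * E J - x 0 k * exp lam\<bar> \<le> \<bar>E J - exp lam\<bar>" by simp
      moreover have "\<bar>a - 1\<bar> < r"
        if "\<bar>c - a\<bar> \<le> e" "\<bar>S - c\<bar> < r / 3" "e < r / 3" "t < r / 3" "S \<le> 1" "1 - t \<le> S" for a c e S t
        using that by arith
      ultimately show ?thesis
        using K[OF that] J le[where J = J and k = k] ge[where J = J and k = k]
        unfolding real_norm_def by blast
    qed
    then show "\<exists>K. \<forall>k\<ge>K. norm (x 0 k * exp lam - 1) < r" by blast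
  qed
  then have "(\<lambda>k. x 0 k * exp lam * exp (- lam)) \<longlonglongrightarrow> 1 * exp (- lam)"
    by (intro tendsto_intros)
  then have "(\<lambda>k. x 0 k) \<longlonglongrightarrow> exp (- lam)"
    by (simp add: mult.assoc exp_add[symmetric])
  then have "(\<lambda>k. (x j k - x 0 k * (lam ^ j / fact j)) + x 0 k * (lam ^ j / fact j)) \<longlonglongrightarrow>
      0 + exp (- lam) * (lam ^ j / fact j)"
    by (intro tendsto_intros dev)
  then show ?thesis by simp
qed

lemma floor_ratio: "nat \<lfloor>real p / real q * real b ^ k\<rfloor> = p * b ^ k div q"
proof -
  have "real p / real q * real b ^ k = real (p * b ^ k) / real q" by simp
  then show ?thesis using floor_divide_of_nat_eq[of "p * b ^ k" q] by (metis nat_int)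
qed

lemma Z_rational:
  assumes "\<And>i. d i < b"
  shows "Z b (real (Suc p) / real (Suc q)) j k d = real (freq b d k (Suc (Suc p * b ^ k div Suc q)) j) / real b ^ k"
  using Z_eq_freq[of d b "real (Suc p) / real (Suc q)" j k, OF assms] by (simp only: floor_ratio) simp

lemma imbalance_Z:
  assumes "\<And>i. d i < b"
  defines "lam \<equiv> \<lambda>p q. real (Suc p) / real (Suc q)"
  shows "imbalance b d k (Suc p) (Suc q) j / real b ^ k =
    real (Suc q) * (real (Suc j) * Z b (lam p q) (Suc j) k d - lam p q * Z b (lam p q) j k d)"
proof -
  have b: "b > 0" using assms(1)[of 0] by simp
  define X where "X j = real (freq b d k (Suc (Suc p * b ^ k div Suc q)) j)" for j
  have "imbalance b d k (Suc p) (Suc q) j = real (Suc q) * real (Suc j) * X (Suc j) - real (Suc p) * X j"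
    unfolding imbalance_def X_def by (simp only: of_nat_mult)
  moreover have "Z b (lam p q) i k d = X i / real b ^ k" for i
    unfolding lam_def X_def by (rule Z_rational) (rule assms(1))
  moreover have "(Q * J * X1 - P * X0) / B = Q * (J * (X1 / B) - P / Q * (X0 / B))"
    if "Q \<noteq> 0" "B \<noteq> 0" for Q J X1 P X0 B :: real
    using that by (simp add: field_simps)
  ultimately show ?thesis unfolding lam_def using b by simp
qed

text \<open>Passing to \<open>lam'\<close> adds at most \<open>(lam' - lam) * b ^ k + 1\<close>
  starting positions, each affecting the count of one word. The first summand is uniform in
  \<open>k\<close>, which extends limits from rational to real parameters.\<close>

lemma Z_diff_le:
  assumes "\<And>i. d i < b" "0 < lam" "lam \<le> lam'"
  shows "\<bar>Z b lam j k d - Z b lam' j k d\<bar> \<le> lam' - lam + 1 / real b ^ k"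
proof -
  have b: "real b ^ k > 0" using assms(1)[of 0] by simp
  define N where "N l = Suc (nat \<lfloor>l * real b ^ k\<rfloor>)" for l
  have mono: "lam * real b ^ k \<le> lam' * real b ^ k" using assms b by (intro mult_right_mono) auto
  then have "N lam \<le> N lam'" unfolding N_def by (simp add: nat_mono floor_mono)
  from freq_diff_N_le[OF this]
  have "\<bar>real (freq b d k (N lam) j) - real (freq b d k (N lam') j)\<bar> \<le> real (N lam') - real (N lam)" .
  also have "\<dots> \<le> lam' * real b ^ k - lam * real b ^ k + 1"
  proof -
    have "0 \<le> lam * real b ^ k" using assms(2) b by simp
    then show ?thesis using mono unfolding N_def by simp linarith
  qed
  finally have "\<bar>real (freq b d k (N lam) j) - real (freq b d k (N lam') j)\<bar> / real b ^ k
      \<le> (lam' * real b ^ k - lam * real b ^ k + 1) / real b ^ k"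
    using b by (intro divide_right_mono) auto
  also have "\<dots> = lam' - lam + 1 / real b ^ k" using b by (simp add: field_simps)
  finally show ?thesis
    using Z_eq_freq[of d b lam j k, OF assms(1,2)] Z_eq_freq[of d b lam' j k, OF assms(1)] assms(2,3) b
    by (simp add: N_def diff_divide_distrib[symmetric])
qed

text \<open>The Poisson probabilities satisfy the recurrence exactly, which gives one direction.
  Conversely, \<open>poisson_limit_of_recurrence\<close> settles positive rational parameters, and
  real ones are approximated by them.\<close>

theorem poisson_generic_seq_iff:
  assumes d: "\<And>i. d i < b" and b: "b \<ge> 2"
  shows "poisson_generic_seq b d \<longleftrightarrow>
    (\<forall>p q j m. \<exists>K. \<forall>k\<ge>K. real m * \<bar>imbalance b d k (Suc p) (Suc q) j\<bar> \<le> real b ^ k)"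
    (is "_ \<longleftrightarrow> ?R")
proof
  have bk: "real b ^ k > 0" for k using b by simp
  assume PG: "poisson_generic_seq b d"
  show ?R
  proof (intro allI)
    fix p q j m
    define lam where "lam = real (Suc p) / real (Suc q)"
    have lam: "lam > 0" by (simp add: lam_def)
    define P where "P j = exp (- lam) * lam ^ j / fact j" for j
    have "(\<lambda>k. Z b lam j k d) \<longlonglongrightarrow> P j" for j
      using PG lam unfolding poisson_generic_seq_def P_def by blast
    then have "(\<lambda>k. real m * \<bar>real (Suc q) * (real (Suc j) * Z b lam (Suc j) k d - lam * Z b lam j k d)\<bar>)
        \<longlonglongrightarrow> real m * \<bar>real (Suc q) * (real (Suc j) * P (Suc j) - lam * P j)\<bar>"
      by (intro tendsto_intros)
    moreover have "real (Suc j) * P (Suc j) - lam * P j = 0"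
    proof -
      have "s * (e * (lam * l) / (s * f)) - lam * (e * l / f) = 0" if "f \<noteq> 0" "s \<noteq> 0" for e l f s :: real
        using that by (simp add: field_simps)
      from this[of "fact j" "real (Suc j)"] show ?thesis
        unfolding P_def fact_Suc power_Suc by simp
    qed
    ultimately have "(\<lambda>k. real m * \<bar>real (Suc q) * (real (Suc j) * Z b lam (Suc j) k d - lam * Z b lam j k d)\<bar>) \<longlonglongrightarrow> 0"
      by simp
    then have "\<forall>\<^sub>F k in sequentially. real m * \<bar>real (Suc q) * (real (Suc j) * Z b lam (Suc j) k d - lam * Z b lam j k d)\<bar> < 1"
      by (rule order_tendstoD) simp
    then have "\<forall>\<^sub>F k in sequentially. real m * \<bar>imbalance b d k (Suc p) (Suc q) j / real b ^ k\<bar> < 1"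
      using imbalance_Z[of d b _ p q j, OF d] unfolding lam_def by simp
    then have "\<forall>\<^sub>F k in sequentially. real m * \<bar>imbalance b d k (Suc p) (Suc q) j\<bar> \<le> real b ^ k"
      by eventually_elim (use bk in \<open>simp add: field_simps\<close>)
    then show "\<exists>K. \<forall>k\<ge>K. real m * \<bar>imbalance b d k (Suc p) (Suc q) j\<bar> \<le> real b ^ k"
      unfolding eventually_sequentially .
  qed
next
  have bk: "real b ^ k > 0" for k using b by simp
  assume R: ?R
  have rational: "(\<lambda>k. Z b (real (Suc p) / real (Suc q)) j k d) \<longlonglongrightarrow>
      exp (- (real (Suc p) / real (Suc q))) * (real (Suc p) / real (Suc q)) ^ j / fact j" for p q j
  proof -
    define lam where "lam = real (Suc p) / real (Suc q)"
    have lam: "lam > 0" by (simp add: lam_def)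
    define N where "N k = Suc (Suc p * b ^ k div Suc q)" for k
    have Z: "Z b lam j k d = real (freq b d k (N k) j) / real b ^ k" for j k
      unfolding lam_def N_def by (rule Z_rational) (rule d)
    have N: "real (N k) \<le> (lam + 1) * real b ^ k" for k
    proof -
      have "real (Suc p * b ^ k div Suc q) \<le> real (Suc p * b ^ k) / real (Suc q)"
        by (rule of_nat_div_le_of_nat)
      also have "\<dots> = lam * real b ^ k" unfolding lam_def of_nat_mult of_nat_power by simp
      moreover have "1 \<le> real b ^ k" using b by simp
      ultimately have "real (Suc p * b ^ k div Suc q) + 1 \<le> lam * real b ^ k + real b ^ k" by linarith
      then show ?thesis unfolding N_def of_nat_Suc distrib_right by simp
    qed
    show ?thesis
      unfolding lam_def[symmetric]
    proof (rule poisson_limit_of_recurrence[where x = "\<lambda>j k. Z b lam j k d" and C = "lam + 1"])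
      fix j
      show "(\<lambda>k. real (Suc j) * Z b lam (Suc j) k d - lam * Z b lam j k d) \<longlonglongrightarrow> 0"
      proof (rule LIMSEQ_I)
        fix r :: real assume "r > 0"
        then obtain m where m: "inverse (real (Suc m)) < r" using reals_Archimedean by blast
        from R obtain K where K: "\<And>k. k \<ge> K \<Longrightarrow> real (Suc m) * \<bar>imbalance b d k (Suc p) (Suc q) j\<bar> \<le> real b ^ k" by blast
        have "norm (real (Suc j) * Z b lam (Suc j) k d - lam * Z b lam j k d - 0) < r" if "k \<ge> K" for k
        proof -
          define D where "D = real (Suc j) * Z b lam (Suc j) k d - lam * Z b lam j k d"
          have "\<bar>D\<bar> \<le> real (Suc q) * \<bar>D\<bar>" using mult_right_mono[of 1 "real (Suc q)" "\<bar>D\<bar>"] by simp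
          also have "\<dots> = \<bar>imbalance b d k (Suc p) (Suc q) j / real b ^ k\<bar>"
            unfolding imbalance_Z[of d b _ p q j, OF d] lam_def[symmetric] D_def[symmetric] by (simp add: abs_mult)
          also have "\<dots> = \<bar>imbalance b d k (Suc p) (Suc q) j\<bar> / real b ^ k" using bk[of k] by simp
          also have "\<dots> \<le> inverse (real (Suc m))" using K[OF that] bk[of k] by (simp add: field_simps)
          finally show ?thesis using m by (simp add: D_def)
        qed
        then show "\<exists>K. \<forall>k\<ge>K. norm (real (Suc j) * Z b lam (Suc j) k d - lam * Z b lam j k d - 0) < r" by blast
      qed
    next
      fix k
      show "0 \<le> Z b lam 0 k d" unfolding Z by simp
      show "Z b lam 0 k d \<le> 1" unfolding Z using bk[of k] freq_le[of b d k "N k" 0]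
        by (simp add: divide_le_eq)
    next
      show "lam \<ge> 0" using lam by simp
    next
      fix J k
      have "(\<Sum>j\<le>J. Z b lam j k d) = real (\<Sum>j\<le>J. freq b d k (N k) j) / real b ^ k"
        unfolding Z by (simp add: sum_divide_distrib)
      moreover have "real (\<Sum>j\<le>J. freq b d k (N k) j) \<le> real b ^ k"
        by (metis sum_freq_le of_nat_le_iff of_nat_power)
      moreover have "real (Suc J) * real b ^ k \<le> real (Suc J) * real (\<Sum>j\<le>J. freq b d k (N k) j) + (lam + 1) * real b ^ k"
      proof -
        have "real (Suc J * b ^ k) \<le> real (Suc J * (\<Sum>j\<le>J. freq b d k (N k) j) + N k)"
          unfolding of_nat_le_iff by (rule sum_freq_ge) (rule d)
        then show ?thesis using N[of k] by (simp only: of_nat_mult of_nat_add of_nat_power)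
      qed
      moreover have "S / B \<le> 1 \<and> 1 - c / s \<le> S / B"
        if "S \<le> B" "s * B \<le> s * S + c * B" "B > 0" "s > 0" for S B c s :: real
        using that by (simp add: field_simps)
      ultimately show "(\<Sum>j\<le>J. Z b lam j k d) \<le> 1" "1 - (lam + 1) / real (Suc J) \<le> (\<Sum>j\<le>J. Z b lam j k d)"
        using bk[of k] by (metis of_nat_0_less_iff zero_less_Suc)+
    qed
  qed
  show "poisson_generic_seq b d"
    unfolding poisson_generic_seq_def
  proof (intro allI impI)
    fix lam :: real and j assume lam: "lam > 0"
    define P where "P l = exp (- l) * l ^ j / fact j" for l :: real
    \<comment> \<open>Rounding strictly up to denominator \<open>n + 1\<close> keeps the numerator
      positive, so that \<open>rational\<close> applies, and \<open>l n\<close> above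
      \<open>lam\<close>, as \<open>Z_diff_le\<close> requires.\<close>
    define l where "l n = real (Suc (nat \<lfloor>lam * real (Suc n)\<rfloor>)) / real (Suc n)" for n
    have l: "lam \<le> l n" "l n \<le> lam + 1 / real (Suc n)" for n
    proof -
      define s where "s = real (Suc n)"
      have s: "s > 0" by (simp add: s_def)
      have "0 \<le> lam * s" using lam s by simp
      then have "lam * s \<le> real (Suc (nat \<lfloor>lam * s\<rfloor>))" "real (Suc (nat \<lfloor>lam * s\<rfloor>)) \<le> lam * s + 1"
        by simp_all linarith
      then show "lam \<le> l n" "l n \<le> lam + 1 / real (Suc n)"
        unfolding l_def s_def[symmetric] using s by (simp_all add: field_simps)
    qed
    have inv: "(\<lambda>n. 1 / real (Suc n)) \<longlonglongrightarrow> 0"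
      using LIMSEQ_Suc[OF lim_const_over_n[of 1]] by simp
    have l_lim: "l \<longlonglongrightarrow> lam"
      by (rule real_tendsto_sandwich[of "\<lambda>n. lam" _ _ "\<lambda>n. lam + 1 / real (Suc n)"])
         (use l tendsto_add[OF tendsto_const inv, of lam] in auto)
    then have P_lim: "(\<lambda>n. P (l n)) \<longlonglongrightarrow> P lam"
      unfolding P_def by (intro tendsto_intros) simp_all
    have "(\<lambda>k. Z b lam j k d) \<longlonglongrightarrow> P lam"
    proof (rule LIMSEQ_I)
      fix r :: real assume r: "r > 0"
      have "\<forall>\<^sub>F n in sequentially. \<bar>P (l n) - P lam\<bar> < r / 4 \<and> 1 / real (Suc n) < r / 4"
        using tendstoD[OF P_lim, of "r / 4"] order_tendstoD(2)[OF inv, of "r / 4"] r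
        by (auto simp: dist_real_def intro: eventually_conj)
      then obtain n where n: "\<bar>P (l n) - P lam\<bar> < r / 4" "1 / real (Suc n) < r / 4"
        unfolding eventually_sequentially by blast
      have "(\<lambda>k. Z b (l n) j k d) \<longlonglongrightarrow> P (l n)"
        unfolding l_def P_def by (rule rational)
      from LIMSEQ_D[OF this, of "r / 4"] r obtain K where K: "\<And>k. k \<ge> K \<Longrightarrow> \<bar>Z b (l n) j k d - P (l n)\<bar> < r / 4" by auto
      have "(\<lambda>k. (1 / real b) ^ k) \<longlonglongrightarrow> 0" using b by (intro LIMSEQ_power_zero) simp
      from LIMSEQ_D[OF this, of "r / 4"] r obtain K' where K': "\<And>k. k \<ge> K' \<Longrightarrow> 1 / real b ^ k < r / 4"
        by (auto simp: power_divide)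
      have "norm (Z b lam j k d - P lam) < r" if k: "k \<ge> max K K'" for k
      proof -
        have "\<bar>Z b lam j k d - Z b (l n) j k d\<bar> \<le> l n - lam + 1 / real b ^ k"
          by (rule Z_diff_le[OF d lam l(1)])
        moreover have "\<bar>Z b (l n) j k d - P (l n)\<bar> < r / 4" "1 / real b ^ k < r / 4"
          using K K' k by simp_all
        ultimately show ?thesis using n l(2)[of n] unfolding real_norm_def by arith
      qed
      then show "\<exists>K. \<forall>k\<ge>K. norm (Z b lam j k d - P lam) < r" by blast
    qed
    then show "(\<lambda>k. Z b lam j k d) \<longlonglongrightarrow> exp (- lam) * lam ^ j / fact j" unfolding P_def .
  qed
qed

section \<open>A computable Poisson generic sequence\<close>

text \<open>Method of conditional expectations: the next digit never increases the sum of the conditional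
  probabilities that the sequence is irregular at word length \<open>k\<close>. The length \<open>k\<close> enters this sum when
  about \<open>k / 2\<close> digits are fixed, so its conditional probability is at that time at most \<open>b\<^bsup>k/2\<^esup>\<close> times
  the unconditional one, which is summable.\<close>

definition lookahead :: "nat \<Rightarrow> nat \<Rightarrow> nat" where
  "lookahead b n = span b (2 * n) + n"

text \<open>An unnormalized conditional expectation, kept as an integer so that the greedy choice is
  decidable. \<open>lookahead\<close> covers the digits relevant to lengths up to
  \<open>2 * n\<close>; lengths below \<open>k0\<close> are ignored in order to bring the total
  weight below 1.\<close>

definition bad_count :: "nat \<Rightarrow> nat \<Rightarrow> nat \<Rightarrow> nat \<Rightarrow> nat \<Rightarrow> nat" where
  "bad_count b k0 n m u = (\<Sum>v<b ^ lookahead b n. of_bool (window b (digs b v) m 0 = u) *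
     (\<Sum>k<Suc (2 * n). of_bool (k0 \<le> k \<and> irregular b k (digs b v))))"

text \<open>The least digit whose count is at most the average over all \<open>b\<close> extensions;
  the factor \<open>b\<close> avoids a division.\<close>

definition next_digit :: "nat \<Rightarrow> nat \<Rightarrow> nat \<Rightarrow> nat \<Rightarrow> nat" where
  "next_digit b k0 n u = first_failure b
     (\<lambda>a. \<not> b * bad_count b k0 n (Suc n) (u + a * b ^ n) \<le> bad_count b k0 n n u)"

definition greedy_prefix :: "nat \<Rightarrow> nat \<Rightarrow> nat \<Rightarrow> nat" where
  "greedy_prefix b k0 n = rec_nat 0 (\<lambda>n u. u + next_digit b k0 n u * b ^ n) n"

definition greedy_seq :: "nat \<Rightarrow> nat \<Rightarrow> nat \<Rightarrow> nat" where
  "greedy_seq b k0 n = next_digit b k0 n (greedy_prefix b k0 n)"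

text \<open>One of the two truncated differences vanishes and the other is the absolute value, so
  real inequalities about \<open>imbalance\<close> become decidable ones between naturals.\<close>

lemma less_mult_abs_diff_iff:
  "real c < real k * \<bar>real x - real y\<bar> \<longleftrightarrow> c < k * (x - y) \<or> c < k * (y - x)"
proof (cases "x \<le> y")
  case True
  then have "\<bar>real x - real y\<bar> = real (y - x)" by simp
  then have "real c < real k * \<bar>real x - real y\<bar> \<longleftrightarrow> c < k * (y - x)"
    by (metis of_nat_less_iff of_nat_mult)
  with True show ?thesis by simp
next
  case False
  then have "\<bar>real x - real y\<bar> = real (x - y)" by simp
  then have "real c < real k * \<bar>real x - real y\<bar> \<longleftrightarrow> c < k * (x - y)"
    by (metis of_nat_less_iff of_nat_mult)
  with False show ?thesis by simp
qed

lemma less_mult_imbalance_iff: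
  "real (b ^ k) < real m * \<bar>imbalance b d k (Suc p) (Suc q) j\<bar> \<longleftrightarrow>
     b ^ k < m * (Suc q * Suc j * freq b d k (Suc (Suc p * b ^ k div Suc q)) (Suc j) -
       Suc p * freq b d k (Suc (Suc p * b ^ k div Suc q)) j) \<or>
     b ^ k < m * (Suc p * freq b d k (Suc (Suc p * b ^ k div Suc q)) j -
       Suc q * Suc j * freq b d k (Suc (Suc p * b ^ k div Suc q)) (Suc j))"
  unfolding imbalance_def less_mult_abs_diff_iff ..

text \<open>\<open>k0\<close> is a fixed number here, so its mere existence suffices for
  computability.\<close>

lemma recursive_greedy_seq:
  assumes "recursive N" shows "recursive (\<lambda>x e. greedy_seq b k0 (N x e))"
proof (rule recursive_subst1[where f = "\<lambda>_ n. greedy_seq b k0 n", OF _ assms])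
  have bad: "recursive (\<lambda>x e. bad_count b k0 (A x e) (B x e) (C x e))"
    if "recursive A" "recursive B" "recursive C" for A B C
    unfolding bad_count_def lookahead_def span_def irregular_def
      of_nat_power[symmetric] less_mult_imbalance_iff freq_def occ_def window_def digs_def
    by (intro recursive_intros that that[THEN recursive_shift] that[THEN recursive_shift, THEN recursive_shift])
  have "next": "recursive (\<lambda>x e. next_digit b k0 (A x e) (B x e))"
    if "recursive A" "recursive B" for A B
    unfolding next_digit_def first_failure_def
    by (intro recursive_intros bad that that[THEN recursive_shift] that[THEN recursive_shift, THEN recursive_shift])
  show "recursive (\<lambda>x e. greedy_seq b k0 (e 0))"
    unfolding greedy_seq_def greedy_prefix_def
    by (intro recursive_intros recursive_rec_nat "next")
qed

lemma first_failure_witness: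
  assumes "\<exists>a<n. P a"
  shows "first_failure n (\<lambda>a. \<not> P a) < n" "P (first_failure n (\<lambda>a. \<not> P a))"
proof -
  define r where "r = first_failure n (\<lambda>a. \<not> P a)"
  have 1: "r \<le> n \<and> (\<forall>i<r. \<not> P i)"
    using le_first_failure_iff[of r n "\<lambda>a. \<not> P a"] by (simp add: r_def)
  have 2: "\<not> (Suc r \<le> n \<and> (\<forall>i<Suc r. \<not> P i))"
    using le_first_failure_iff[of "Suc r" n "\<lambda>a. \<not> P a"] by (simp add: r_def)
  from assms 1 have "r < n" by (metis le_neq_implies_less)
  with 1 2 show "r < n" "P r" by (auto simp: less_Suc_eq)
qed

lemma bad_count_split:
  assumes "b > 0" "u < b ^ n"
  shows "bad_count b k0 n n u = (\<Sum>a<b. bad_count b k0 n (Suc n) (u + a * b ^ n))"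
proof -
  have split: "of_bool (window b d n 0 = u) = (\<Sum>a<b. of_bool (window b d (Suc n) 0 = u + a * b ^ n) :: nat)"
    if d: "\<And>i. d i < b" for d
  proof -
    have w: "window b d n 0 < b ^ n" by (rule window_less) (rule d)
    have "window b d (Suc n) 0 = u + a * b ^ n \<longleftrightarrow> window b d n 0 = u \<and> d n = a" (is "?L \<longleftrightarrow> ?R") for a
    proof
      assume ?L
      then have *: "window b d n 0 + d n * b ^ n = u + a * b ^ n" by (simp add: window_Suc)
      from arg_cong[OF this, of "\<lambda>x. x mod b ^ n"] arg_cong[OF this, of "\<lambda>x. x div b ^ n"]
      show ?R using w assms by simp
    qed (simp add: window_Suc)
    then have "(\<Sum>a<b. of_bool (window b d (Suc n) 0 = u + a * b ^ n) :: nat) =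
        (\<Sum>a<b. of_bool (d n = a) * of_bool (window b d n 0 = u))"
      by (simp add: conj_commute of_bool_conj)
    also have "\<dots> = (\<Sum>a\<in>{d n}. of_bool (d n = a) * of_bool (window b d n 0 = u))"
      using d by (intro sum.mono_neutral_right) auto
    finally show ?thesis by simp
  qed
  show ?thesis
    unfolding bad_count_def split[OF digs_less[OF assms(1)]] sum_distrib_right by (rule sum.swap)
qed

text \<open>If every extension exceeded the average, their sum would exceed the count of the prefix,
  which they partition.\<close>

lemma next_digit:
  assumes "b > 0" "u < b ^ n"
  shows "next_digit b k0 n u < b"
    "b * bad_count b k0 n (Suc n) (u + next_digit b k0 n u * b ^ n) \<le> bad_count b k0 n n u"
proof -
  have "\<exists>a<b. b * bad_count b k0 n (Suc n) (u + a * b ^ n) \<le> bad_count b k0 n n u"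
  proof (rule ccontr)
    assume "\<not> ?thesis"
    then have "(\<Sum>a<b. bad_count b k0 n n u) < (\<Sum>a<b. b * bad_count b k0 n (Suc n) (u + a * b ^ n))"
      using assms(1) by (intro sum_strict_mono) (auto simp: not_le)
    also have "\<dots> = b * bad_count b k0 n n u"
      unfolding bad_count_split[OF assms] sum_distrib_left ..
    finally show False by simp
  qed
  from first_failure_witness[OF this] show "next_digit b k0 n u < b"
    "b * bad_count b k0 n (Suc n) (u + next_digit b k0 n u * b ^ n) \<le> bad_count b k0 n n u"
    unfolding next_digit_def by blast+
qed

lemma greedy_prefix_Suc:
  "greedy_prefix b k0 (Suc n) = greedy_prefix b k0 n + greedy_seq b k0 n * b ^ n"
  by (simp add: greedy_prefix_def greedy_seq_def)

lemma greedy_prefix_less: "b > 0 \<Longrightarrow> greedy_prefix b k0 n < b ^ n"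
proof (induction n)
  case (Suc n)
  then have "greedy_prefix b k0 n < b ^ n" "Suc (greedy_seq b k0 n) \<le> b"
    using next_digit(1) by (simp_all add: greedy_seq_def Suc_le_eq)
  then have "greedy_prefix b k0 (Suc n) < Suc (greedy_seq b k0 n) * b ^ n"
    by (simp add: greedy_prefix_Suc)
  also have "\<dots> \<le> b * b ^ n" using \<open>Suc (greedy_seq b k0 n) \<le> b\<close> by (rule mult_le_mono1)
  finally show ?case by simp
qed (simp add: greedy_prefix_def)

lemma greedy_seq_less: "b > 0 \<Longrightarrow> greedy_seq b k0 n < b"
  unfolding greedy_seq_def by (intro next_digit greedy_prefix_less)

lemma window_greedy_seq: "window b (greedy_seq b k0) n 0 = greedy_prefix b k0 n"
  by (induction n) (simp_all add: window_Suc greedy_prefix_Suc, simp_all add: window_def greedy_prefix_def)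

section \<open>The invariant of the greedy choice\<close>

definition bad_weight :: "nat \<Rightarrow> nat \<Rightarrow> nat \<Rightarrow> nat \<Rightarrow> nat \<Rightarrow> real" where
  "bad_weight b k0 n m u = (\<Sum>k<Suc (2 * n). expect b (lookahead b n)
     (\<lambda>y. of_bool (window b y m 0 = u \<and> k0 \<le> k \<and> irregular b k y)))"

lemma real_bad_count:
  assumes "b > 0"
  shows "real (bad_count b k0 n m u) = real b ^ lookahead b n * bad_weight b k0 n m u"
proof -
  have "bad_weight b k0 n m u = expect b (lookahead b n) (\<lambda>y. of_bool (window b y m 0 = u) *
      (\<Sum>k<Suc (2 * n). of_bool (k0 \<le> k \<and> irregular b k y)))"
    unfolding bad_weight_def expect_sum[symmetric] sum_distrib_left of_bool_conj ..
  then show ?thesis using assms by (simp add: expect_def bad_count_def)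
qed

text \<open>Length \<open>k\<close> enters when \<open>Suc k div 2\<close> digits are fixed. The
  first factor bounds the loss from conditioning on them, the second is the unconditional
  probability bound.\<close>

definition irregular_weight :: "nat \<Rightarrow> nat \<Rightarrow> real" where
  "irregular_weight b k = real b ^ (Suc k div 2) * (129 * real k ^ 12 / real b ^ k)"

lemma span_mono: "b > 0 \<Longrightarrow> k \<le> k' \<Longrightarrow> span b k \<le> span b k'"
  unfolding span_def by (intro add_mono mult_le_mono power_increasing) auto

text \<open>Further random digits do not change the probabilities for the old lengths. For the two
  new lengths the condition on the prefix is dropped.\<close>

lemma bad_weight_Suc_le:
  assumes "b > 0"
  shows "bad_weight b k0 (Suc n) (Suc n) u \<le> bad_weight b k0 n (Suc n) u +
    (\<Sum>k\<in>{Suc (2 * n), 2 * n + 2}. of_bool (k0 \<le> k) * (129 * real k ^ 12 / real b ^ k))"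
proof -
  define W where "W L k = expect b L (\<lambda>y. of_bool (window b y (Suc n) 0 = u \<and> k0 \<le> k \<and> irregular b k y))" for L k
  have mono: "lookahead b n \<le> lookahead b (Suc n)"
    unfolding lookahead_def using span_mono[OF assms, of "2 * n" "2 * Suc n"] by simp
  have old: "W (lookahead b (Suc n)) k = W (lookahead b n) k" if "k < Suc (2 * n)" for k
    unfolding W_def
  proof (rule expect_extend[OF mono assms])
    fix y y' :: "nat \<Rightarrow> nat" assume *: "\<And>i. i < lookahead b n \<Longrightarrow> y i = y' i"
    have "window b y (Suc n) 0 = window b y' (Suc n) 0"
      by (rule window_cong) (auto intro!: * simp: lookahead_def span_def)
    moreover have "span b k \<le> lookahead b n"
      unfolding lookahead_def using span_mono[OF assms, of k "2 * n"] that by simp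
    then have "irregular b k y \<longleftrightarrow> irregular b k y'"
      by (intro irregular_cong *) simp
    ultimately show "of_bool (window b y (Suc n) 0 = u \<and> k0 \<le> k \<and> irregular b k y) =
      (of_bool (window b y' (Suc n) 0 = u \<and> k0 \<le> k \<and> irregular b k y') :: real)" by simp
  qed
  have new: "W (lookahead b (Suc n)) k \<le> of_bool (k0 \<le> k) * (129 * real k ^ 12 / real b ^ k)"
    if "k \<le> 2 * n + 2" for k
  proof -
    have "W (lookahead b (Suc n)) k \<le> expect b (lookahead b (Suc n)) (\<lambda>y. of_bool (k0 \<le> k) * of_bool (irregular b k y))"
      unfolding W_def by (intro expect_mono assms) simp
    also have "\<dots> = of_bool (k0 \<le> k) * expect b (lookahead b (Suc n)) (\<lambda>y. of_bool (irregular b k y))"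
      by (rule expect_cmult)
    also have "expect b (lookahead b (Suc n)) (\<lambda>y. of_bool (irregular b k y)) = expect b (span b k) (\<lambda>y. of_bool (irregular b k y))"
    proof (rule expect_extend[OF _ assms])
      show "span b k \<le> lookahead b (Suc n)"
        unfolding lookahead_def using span_mono[OF assms, of k "2 * Suc n"] that by simp
      show "of_bool (irregular b k y) = (of_bool (irregular b k y') :: real)"
        if "\<And>i. i < span b k \<Longrightarrow> y i = y' i" for y y'
        using irregular_cong[of b k y y', OF that] by simp
    qed
    also have "of_bool (k0 \<le> k) * \<dots> \<le> of_bool (k0 \<le> k) * (129 * real k ^ 12 / real b ^ k)"
      by (intro mult_left_mono expect_irregular_le assms) simp
    finally show ?thesis .
  qed
  have "bad_weight b k0 (Suc n) (Suc n) u =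
      (\<Sum>k<Suc (2 * n). W (lookahead b (Suc n)) k) + W (lookahead b (Suc n)) (Suc (2 * n)) + W (lookahead b (Suc n)) (2 * n + 2)"
    by (simp add: bad_weight_def W_def)
  also have "(\<Sum>k<Suc (2 * n). W (lookahead b (Suc n)) k) = bad_weight b k0 n (Suc n) u"
    unfolding bad_weight_def W_def[symmetric] by (intro sum.cong refl old) simp
  finally show ?thesis using new[of "Suc (2 * n)"] new[of "2 * n + 2"] by simp
qed

text \<open>The factor \<open>b ^ n\<close> turns joint probabilities with a prefix of length
  \<open>n\<close> into conditional ones. The greedy digit does not increase their sum, and the two
  entering lengths add their weights.\<close>

lemma greedy_invariant:
  assumes "b > 0"
  shows "real b ^ n * bad_weight b k0 n n (greedy_prefix b k0 n) \<le>
    (\<Sum>k<Suc (2 * n). of_bool (k0 \<le> k) * irregular_weight b k)"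
proof (induction n)
  case 0
  have "irregular b 0 y = False" for y by (simp add: irregular_def)
  then show ?case using expect_const[OF assms, of _ 0] by (simp add: bad_weight_def irregular_weight_def)
next
  case (Suc n)
  define u where "u = greedy_prefix b k0 n"
  define u' where "u' = greedy_prefix b k0 (Suc n)"
  have "b * bad_count b k0 n (Suc n) u' \<le> bad_count b k0 n n u"
    unfolding u'_def greedy_prefix_Suc greedy_seq_def u_def
    by (intro next_digit assms greedy_prefix_less)
  then have "real b * real (bad_count b k0 n (Suc n) u') \<le> real (bad_count b k0 n n u)"
    by (metis of_nat_le_iff of_nat_mult)
  then have "real b ^ lookahead b n * (real b * bad_weight b k0 n (Suc n) u') \<le> real b ^ lookahead b n * bad_weight b k0 n n u"
    unfolding real_bad_count[OF assms] by (simp add: mult_ac)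
  then have le: "real b * bad_weight b k0 n (Suc n) u' \<le> bad_weight b k0 n n u"
    using assms by simp
  have "real b ^ Suc n * bad_weight b k0 (Suc n) (Suc n) u' \<le>
      real b ^ Suc n * (bad_weight b k0 n (Suc n) u' +
      (\<Sum>k\<in>{Suc (2 * n), 2 * n + 2}. of_bool (k0 \<le> k) * (129 * real k ^ 12 / real b ^ k)))"
    by (intro mult_left_mono bad_weight_Suc_le assms) simp
  also have "\<dots> = real b ^ n * (real b * bad_weight b k0 n (Suc n) u') +
      (\<Sum>k\<in>{Suc (2 * n), 2 * n + 2}. of_bool (k0 \<le> k) * irregular_weight b k)"
    by (simp add: irregular_weight_def algebra_simps)
  also have "\<dots> \<le> real b ^ n * bad_weight b k0 n n u +
      (\<Sum>k\<in>{Suc (2 * n), 2 * n + 2}. of_bool (k0 \<le> k) * irregular_weight b k)"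
    using le by (intro add_right_mono mult_left_mono) simp_all
  also have "\<dots> \<le> (\<Sum>k<Suc (2 * Suc n). of_bool (k0 \<le> k) * irregular_weight b k)"
  proof -
    have "(\<Sum>k<Suc (2 * Suc n). f k) = (\<Sum>k<Suc (2 * n). f k) + (\<Sum>k\<in>{Suc (2 * n), 2 * n + 2}. f k)"
      for f :: "nat \<Rightarrow> real" by simp
    then show ?thesis using Suc.IH unfolding u_def by (simp only: add_right_mono)
  qed
  finally show ?case unfolding u'_def .
qed

lemma summable_irregular_weight:
  assumes "b \<ge> 2" shows "summable (irregular_weight b)"
proof -
  define x where "x = 1 / sqrt (real b)"
  \<comment> \<open>The thirteenth root splits \<open>x ^ k\<close> into thirteen factors
    \<open>y ^ k\<close>: twelve absorb \<open>k ^ 12\<close>, the last is the term of a convergent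
    geometric series.\<close>
  define y where "y = root 13 x"
  have x: "0 < x" "x < 1" using assms by (simp_all add: x_def)
  then have y: "0 < y" "y < 1" "y ^ 13 = x" by (simp_all add: y_def)
  have "(\<lambda>k. real k * y ^ k) \<longlonglongrightarrow> 0"
    using powser_times_n_limit_0[of y] y by simp
  then have "\<forall>\<^sub>F k in sequentially. real k * y ^ k < 1"
    by (rule order_tendstoD) simp
  then have "\<forall>\<^sub>F k in sequentially. norm (irregular_weight b k) \<le> 129 * sqrt (real b) * y ^ k"
  proof eventually_elim
    case (elim k)
    have b: "real b > 0" using assms by simp
    have "real b ^ (Suc k div 2) = sqrt (real b) ^ (2 * (Suc k div 2))"
      using b by (simp add: power_mult)
    also have "\<dots> \<le> sqrt (real b) ^ Suc k"
      using assms by (intro power_increasing) auto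
    finally have 1: "real b ^ (Suc k div 2) \<le> sqrt (real b) ^ Suc k" .
    have "real b ^ k = sqrt (real b) ^ k * sqrt (real b) ^ k"
      using b by (simp add: power_mult_distrib[symmetric])
    then have "sqrt (real b) ^ Suc k / real b ^ k = sqrt (real b) * x ^ k"
      using b by (simp add: x_def power_divide field_simps)
    moreover have "x ^ k = (y ^ k) ^ 12 * y ^ k"
      by (simp add: y(3)[symmetric] power_mult[symmetric] power_add[symmetric])
    ultimately have 2: "sqrt (real b) ^ Suc k / real b ^ k * real k ^ 12 = sqrt (real b) * ((real k * y ^ k) ^ 12 * y ^ k)"
      by (simp add: power_mult_distrib mult_ac)
    have "irregular_weight b k \<le> sqrt (real b) ^ Suc k * (129 * real k ^ 12 / real b ^ k)"
      unfolding irregular_weight_def using 1 b by (intro mult_right_mono) auto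
    also have "\<dots> = 129 * (sqrt (real b) * ((real k * y ^ k) ^ 12 * y ^ k))"
      unfolding 2[symmetric] by simp
    also have "\<dots> \<le> 129 * (sqrt (real b) * (1 * y ^ k))"
      using elim y by (intro mult_left_mono mult_right_mono power_le_one) auto
    finally show ?case by (simp add: irregular_weight_def)
  qed
  moreover have "summable (\<lambda>k. 129 * sqrt (real b) * y ^ k)"
    using y by (intro summable_mult summable_geometric) simp
  ultimately show ?thesis by (rule summable_comparison_test_ev)
qed

text \<open>Once all digits that decide length \<open>k\<close> are fixed, its conditional
  probability of irregularity is 0 or 1; a bad length would contribute 1 to a sum that stays below
  1.\<close>

theorem greedy_seq_regular:
  assumes "b \<ge> 2"
  obtains k0 where "\<And>k. k \<ge> k0 \<Longrightarrow> \<not> irregular b k (greedy_seq b k0)"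
proof -
  have b: "b > 0" using assms by simp
  obtain k0 where k0: "\<And>m n. m \<ge> k0 \<Longrightarrow> norm (\<Sum>k=m..<n. irregular_weight b k) < 1"
    using summable_irregular_weight[OF assms] unfolding summable_Cauchy
    by (metis zero_less_one)
  have small: "(\<Sum>k<n. of_bool (k0 \<le> k) * irregular_weight b k) < 1" for n
  proof -
    have "(\<Sum>k<n. of_bool (k0 \<le> k) * irregular_weight b k) = (\<Sum>k=k0..<n. of_bool (k0 \<le> k) * irregular_weight b k)"
      by (rule sum.mono_neutral_right) auto
    also have "\<dots> = (\<Sum>k=k0..<n. irregular_weight b k)" by simp
    also have "\<dots> < 1" using k0[of k0 n] by simp
    finally show ?thesis .
  qed
  have "\<not> irregular b k (greedy_seq b k0)" if "k \<ge> k0" for k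
  proof
    assume bad: "irregular b k (greedy_seq b k0)"
    define n where "n = span b k"
    define u where "u = greedy_prefix b k0 n"
    define L where "L = lookahead b n"
    have u: "u < b ^ n" unfolding u_def by (rule greedy_prefix_less[OF b])
    have "k \<le> n" by (simp add: n_def span_def)
    have "1 / real b ^ n = expect b L (\<lambda>y. of_bool (window b y n 0 = u))"
    proof -
      have "expect b L (\<lambda>y. of_bool (window b y n 0 = u)) = (\<Sum>w<b ^ n. expect b L (\<lambda>y. of_bool (w = u))) / real b ^ n"
        by (subst expect_overwrite[of 0 n L b, OF _ b]) (simp_all add: L_def lookahead_def window_overwrite)
      also have "\<dots> = (\<Sum>w<b ^ n. of_bool (w = u)) / real b ^ n"
        using expect_const[OF b] by simp
      also have "(\<Sum>w<b ^ n. of_bool (w = u)) = (\<Sum>w\<in>{u}. of_bool (w = u) :: real)"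
        using u by (intro sum.mono_neutral_right) auto
      finally show ?thesis by simp
    qed
    also have "\<dots> \<le> expect b L (\<lambda>y. of_bool (window b y n 0 = u \<and> k0 \<le> k \<and> irregular b k y))"
    proof (rule expect_mono[OF b])
      fix y :: "nat \<Rightarrow> nat" assume y: "\<And>i. y i < b"
      have "irregular b k y" if "window b y n 0 = u"
      proof -
        have "window b y n 0 = window b (greedy_seq b k0) n 0"
          using that by (simp add: window_greedy_seq u_def)
        then have "\<forall>i<n. y i = greedy_seq b k0 i"
          by (subst (asm) window_eq_iff) (simp_all add: y greedy_seq_less[OF b])
        then show ?thesis using irregular_cong[of b k y "greedy_seq b k0"] bad by (simp add: n_def)
      qed
      then show "of_bool (window b y n 0 = u) \<le> (of_bool (window b y n 0 = u \<and> k0 \<le> k \<and> irregular b k y) :: real)"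
        using \<open>k \<ge> k0\<close> by simp
    qed
    also have "\<dots> \<le> bad_weight b k0 n n u"
      unfolding bad_weight_def L_def
    proof (rule member_le_sum)
      show "0 \<le> expect b (lookahead b n) (\<lambda>y. of_bool (window b y n 0 = u \<and> k0 \<le> k \<and> irregular b k y))" for k
        using expect_mono[OF b, of "\<lambda>y. 0" "\<lambda>y. of_bool (window b y n 0 = u \<and> k0 \<le> k \<and> irregular b k y)"]
          expect_const[OF b, of _ 0] by simp
    qed (use \<open>k \<le> n\<close> in auto)
    finally have "1 \<le> real b ^ n * bad_weight b k0 n n u" using b by (simp add: field_simps)
    also have "\<dots> < 1"
      unfolding u_def using greedy_invariant[OF b] small by (rule le_less_trans)
    finally show False by simp
  qed
  then show ?thesis by (rule that)
qed

section \<open>Altering a Poisson generic sequence\<close>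

text \<open>A block takes up at most half of the first \<open>b ^ s\<close> positions, whence
  \<open>s < b ^ s \<le> 2 * i\<close> for a mark at \<open>i\<close>. The explicit bound on
  \<open>s\<close> therefore loses nothing and makes marking decidable.\<close>

definition marked :: "nat \<Rightarrow> (nat \<Rightarrow> nat) \<Rightarrow> nat \<Rightarrow> bool" where
  "marked b g i \<longleftrightarrow> (\<exists>s<2 * i. i < b ^ s \<and> b ^ s \<le> i + b ^ s div (g s + 2))"

text \<open>The digit at position 0 is fixed so that the number with these digits is less than 1, and the
  marks are filled with ones so that infinitely many digits are nonzero.\<close>

definition altered :: "nat \<Rightarrow> (nat \<Rightarrow> nat) \<Rightarrow> (nat \<Rightarrow> nat) \<Rightarrow> nat \<Rightarrow> nat" where
  "altered b g z i = (if i = 0 then 0 else if marked b g i then 1 else z i)"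

lemma marked_bound:
  fixes b :: nat
  assumes "b \<ge> 2" "b ^ s \<le> i + b ^ s div (a + 2)" shows "b ^ s \<le> 2 * i"
proof -
  have "b ^ s div (a + 2) \<le> b ^ s div 2" by (rule div_le_mono2) simp_all
  then show ?thesis using assms by linarith
qed

lemma less_power_of_ge_2:
  fixes b n :: nat
  assumes "b \<ge> 2" shows "n < b ^ n"
  using less_exp[of n] power_mono[OF assms, of n] by linarith

lemma markedI:
  assumes "b \<ge> 2" "i < b ^ s" "b ^ s \<le> i + b ^ s div (g s + 2)" shows "marked b g i"
proof -
  have "s < b ^ s" by (rule less_power_of_ge_2[OF assms(1)])
  also have "\<dots> \<le> 2 * i" by (rule marked_bound[OF assms(1,3)])
  finally show ?thesis unfolding marked_def using assms by blast
qed

lemma altered_less: "b \<ge> 2 \<Longrightarrow> (\<And>i. z i < b) \<Longrightarrow> altered b g z i < b"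
  by (simp add: altered_def)

text \<open>For \<open>s\<close> at least 2, the chain
  \<open>g s + 2 \<le> s + 2 \<le> 2 * s \<le> b ^ s\<close> makes the block nonempty, so it
  contains \<open>b ^ s - 1\<close>.\<close>

lemma infinite_altered_nonzero:
  assumes b: "b \<ge> 2" and g: "\<And>s. g s \<le> s" shows "infinite {i. altered b g z i \<noteq> 0}"
  unfolding infinite_nat_iff_unbounded_le
proof
  fix m :: nat
  define s where "s = m + 2"
  have "2 * (m + 2) \<le> b * b ^ (m + 1)" using b less_power_of_ge_2[OF b, of "m + 1"] by (intro mult_le_mono) auto
  then have bs: "2 * s \<le> b ^ s" by (simp add: s_def)
  have "1 * (g s + 2) \<le> b ^ s" using g[of s] bs by (simp add: s_def)
  then have "1 \<le> b ^ s div (g s + 2)" by (subst less_eq_div_iff_mult_less_eq) simp_all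
  then have "marked b g (b ^ s - 1)" using b by (intro markedI[of _ _ s]) auto
  then have "altered b g z (b ^ s - 1) \<noteq> 0" using bs by (simp add: altered_def s_def)
  moreover have "m \<le> b ^ s - 1" using bs by (simp add: s_def)
  ultimately show "\<exists>n\<ge>m. n \<in> {i. altered b g z i \<noteq> 0}" by blast
qed

section \<open>Alterations of vanishing density\<close>

lemma over_power_tendsto_0:
  assumes "b \<ge> (2::nat)"
  shows "(\<lambda>k. 1 / real b ^ k) \<longlonglongrightarrow> 0" "(\<lambda>k. real k / real b ^ k) \<longlonglongrightarrow> 0"
    "(\<lambda>k. (real k)\<^sup>2 / real b ^ k) \<longlonglongrightarrow> 0"
proof -
  have "(\<lambda>k. (1 / real b) ^ k) \<longlonglongrightarrow> 0" using assms by (intro LIMSEQ_power_zero) simp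
  then show "(\<lambda>k. 1 / real b ^ k) \<longlonglongrightarrow> 0" by (simp add: power_divide)
  have "(\<lambda>k. real k * (1 / real b) ^ k) \<longlonglongrightarrow> 0"
    using powser_times_n_limit_0[of "1 / real b"] assms by simp
  then show "(\<lambda>k. real k / real b ^ k) \<longlonglongrightarrow> 0" by (simp add: power_divide)
  have "(\<lambda>k. real k * (1 / sqrt (real b)) ^ k) \<longlonglongrightarrow> 0"
    using powser_times_n_limit_0[of "1 / sqrt (real b)"] assms by simp
  then have "(\<lambda>k. (real k * (1 / sqrt (real b)) ^ k)\<^sup>2) \<longlonglongrightarrow> 0\<^sup>2" by (rule tendsto_power)
  moreover have "(real k * (1 / sqrt (real b)) ^ k)\<^sup>2 = (real k)\<^sup>2 / real b ^ k" for k
  proof -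
    have "((1 / sqrt (real b)) ^ k)\<^sup>2 = ((1 / sqrt (real b))\<^sup>2) ^ k"
      by (simp add: power_mult[symmetric] mult.commute)
    then show ?thesis by (simp add: power_mult_distrib power_divide)
  qed
  ultimately show "(\<lambda>k. (real k)\<^sup>2 / real b ^ k) \<longlonglongrightarrow> 0" by simp
qed

text \<open>A window changes only if it contains position 0 or a marked digit. The digits involved
  lie below \<open>2 * b ^ (k + c)\<close>, and a mark of scale \<open>s\<close> at \<open>i\<close>
  has \<open>b ^ s \<le> 2 * i\<close>, so only scales below \<open>k + c + 2\<close>
  matter.\<close>

lemma window_differs_subset:
  assumes b: "b \<ge> 2" and N: "N \<le> b ^ (k + c)"
  shows "{i. i < N \<and> window b (altered b g z) k i \<noteq> window b z k i} \<subseteq>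
    insert 0 (\<Union>s<k + c + 2. {b ^ s - b ^ s div (g s + 2) - k..<b ^ s})"
proof
  fix i assume "i \<in> {i. i < N \<and> window b (altered b g z) k i \<noteq> window b z k i}"
  then have i: "i < N" and "window b (altered b g z) k i \<noteq> window b z k i" by auto
  then obtain t where t: "t < k" "altered b g z (i + t) \<noteq> z (i + t)"
    using window_cong[of k "altered b g z" i z i b] by blast
  show "i \<in> insert 0 (\<Union>s<k + c + 2. {b ^ s - b ^ s div (g s + 2) - k..<b ^ s})"
  proof (cases "i + t = 0")
    case False
    with t(2) have "marked b g (i + t)" by (simp add: altered_def split: if_splits)
    then obtain s where s: "i + t < b ^ s" "b ^ s \<le> i + t + b ^ s div (g s + 2)"
      unfolding marked_def by blast
    have "k < b ^ k" by (rule less_power_of_ge_2[OF b])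
    also have "b ^ k \<le> b ^ (k + c)" using b by (intro power_increasing) auto
    finally have "i + t < 2 * b ^ (k + c)" using i t(1) N by linarith
    then have "2 * (i + t) < 2 * (2 * b ^ (k + c))" by simp
    also have "\<dots> \<le> b * (b * b ^ (k + c))" using b by (intro mult_le_mono) auto
    finally have "b ^ s < b ^ (k + c + 2)"
      using marked_bound[OF b s(2)] by (simp add: power_add power2_eq_square mult_ac)
    then have "s < k + c + 2" by (rule power_less_imp_less_exp[rotated]) (use b in simp)
    moreover have "i \<in> {b ^ s - b ^ s div (g s + 2) - k..<b ^ s}" using s t(1) by auto
    ultimately show ?thesis by blast
  qed simp
qed

text \<open>The block of each scale spoils the windows starting in it and at most \<open>k\<close>
  windows starting to its left.\<close>

lemma card_window_differs_le:
  assumes b: "b \<ge> 2" and N: "N \<le> b ^ (k + c)"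
  shows "real (card {i. i < N \<and> window b (altered b g z) k i \<noteq> window b z k i}) \<le>
    1 + real (k + c + 2) * real k + (\<Sum>s<k + c + 2. real b ^ s * (1 / real (g s + 2)))"
proof -
  have "card {i. i < N \<and> window b (altered b g z) k i \<noteq> window b z k i} \<le>
      card (insert 0 (\<Union>s<k + c + 2. {b ^ s - b ^ s div (g s + 2) - k..<b ^ s}))"
    by (rule card_mono[OF _ window_differs_subset[OF b N]]) simp
  also have "\<dots> \<le> Suc (card (\<Union>s<k + c + 2. {b ^ s - b ^ s div (g s + 2) - k..<b ^ s}))"
    by (rule card_insert_le_m1) simp_all
  also have "card (\<Union>s<k + c + 2. {b ^ s - b ^ s div (g s + 2) - k..<b ^ s}) \<le>
      (\<Sum>s<k + c + 2. card {b ^ s - b ^ s div (g s + 2) - k..<b ^ s})"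
    by (rule card_UN_le) simp
  also have "\<dots> \<le> (\<Sum>s<k + c + 2. k + b ^ s div (g s + 2))"
    by (rule sum_mono) simp
  finally have "real (card {i. i < N \<and> window b (altered b g z) k i \<noteq> window b z k i}) \<le>
      real (Suc (\<Sum>s<k + c + 2. k + b ^ s div (g s + 2)))" by (simp only: of_nat_le_iff)
  also have "\<dots> = 1 + real (k + c + 2) * real k + (\<Sum>s<k + c + 2. real (b ^ s div (g s + 2)))"
  proof -
    have "real (Suc (\<Sum>s<n. k + f s)) = 1 + real n * real k + (\<Sum>s<n. real (f s))" for n and f :: "nat \<Rightarrow> nat"
      by (simp add: sum.distrib)
    then show ?thesis .
  qed
  also have "(\<Sum>s<k + c + 2. real (b ^ s div (g s + 2))) \<le> (\<Sum>s<k + c + 2. real b ^ s * (1 / real (g s + 2)))"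
    by (rule sum_mono) (metis mult.right_neutral of_nat_div_le_of_nat of_nat_power times_divide_eq_right)
  finally show ?thesis by simp
qed

text \<open>The weights \<open>b ^ s / b ^ n\<close> sum to at most 1, and the weight of every fixed
  initial part vanishes as \<open>n\<close> grows, so the averages inherit the limit 0.\<close>

lemma geometric_average_tendsto_0:
  fixes \<epsilon> :: "nat \<Rightarrow> real"
  assumes b: "b \<ge> 2" and lim: "\<epsilon> \<longlonglongrightarrow> 0" and \<epsilon>: "\<And>s. 0 \<le> \<epsilon> s" "\<And>s. \<epsilon> s \<le> 1"
  shows "(\<lambda>n. (\<Sum>s<n. real b ^ s * \<epsilon> s) / real b ^ n) \<longlonglongrightarrow> 0"
proof (rule LIMSEQ_I)
  fix r :: real assume r: "r > 0"
  from LIMSEQ_D[OF lim, of "r / 2"] r obtain S where S: "\<And>s. s \<ge> S \<Longrightarrow> \<epsilon> s < r / 2"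
    using \<epsilon>(1) by auto
  have geom: "(\<Sum>s<n. real b ^ s) \<le> real b ^ n" for n
  proof (induction n)
    case (Suc n)
    then have "(\<Sum>s<Suc n. real b ^ s) \<le> 2 * real b ^ n" by simp
    also have "\<dots> \<le> real b * real b ^ n" using b by (intro mult_right_mono) auto
    finally show ?case by simp
  qed simp
  have bound: "(\<Sum>s<n. real b ^ s * \<epsilon> s) \<le> real b ^ S + r / 2 * real b ^ n" for n
  proof -
    have "(\<Sum>s<n. real b ^ s * \<epsilon> s) \<le> (\<Sum>s<n. of_bool (s < S) * real b ^ s + r / 2 * real b ^ s)"
    proof (rule sum_mono)
      fix s
      show "real b ^ s * \<epsilon> s \<le> of_bool (s < S) * real b ^ s + r / 2 * real b ^ s"
      proof (cases "s < S")
        case True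
        have "real b ^ s * \<epsilon> s \<le> real b ^ s * 1" by (intro mult_left_mono \<epsilon>) simp
        then show ?thesis using True r by (simp add: add_increasing2)
      next
        case False
        then have "real b ^ s * \<epsilon> s \<le> real b ^ s * (r / 2)" using S[of s] by (intro mult_left_mono) auto
        then show ?thesis using False by (simp add: mult.commute)
      qed
    qed
    also have "\<dots> = (\<Sum>s<n. of_bool (s < S) * real b ^ s) + r / 2 * (\<Sum>s<n. real b ^ s)"
      by (simp add: sum.distrib sum_distrib_left)
    also have "(\<Sum>s<n. of_bool (s < S) * real b ^ s) = (\<Sum>s\<in>{..<n} \<inter> {..<S}. of_bool (s < S) * real b ^ s)"
      by (rule sum.mono_neutral_right) auto
    also have "\<dots> = (\<Sum>s\<in>{..<n} \<inter> {..<S}. real b ^ s)"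
      by (rule sum.cong) auto
    also have "\<dots> \<le> (\<Sum>s<S. real b ^ s)"
      by (rule sum_mono2) auto
    also have "\<dots> \<le> real b ^ S" by (rule geom)
    also have "r / 2 * (\<Sum>s<n. real b ^ s) \<le> r / 2 * real b ^ n"
      using r by (intro mult_left_mono geom) simp
    finally show ?thesis by simp
  qed
  have "(\<lambda>n. real b ^ S * (1 / real b) ^ n) \<longlonglongrightarrow> 0"
    using b by (intro tendsto_mult_right_zero LIMSEQ_power_zero) simp
  from LIMSEQ_D[OF this, of "r / 2"] r obtain K where
    K: "\<And>n. n \<ge> K \<Longrightarrow> real b ^ S / real b ^ n < r / 2"
    by (auto simp: power_divide)
  have "norm ((\<Sum>s<n. real b ^ s * \<epsilon> s) / real b ^ n - 0) < r" if "n \<ge> K" for n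
  proof -
    have bn: "real b ^ n > 0" using b by simp
    have "0 \<le> (\<Sum>s<n. real b ^ s * \<epsilon> s) / real b ^ n" using \<epsilon>(1) by (simp add: sum_nonneg)
    moreover have "(\<Sum>s<n. real b ^ s * \<epsilon> s) / real b ^ n \<le> real b ^ S / real b ^ n + r / 2"
      using divide_right_mono[OF bound[of n], of "real b ^ n"] b by (simp add: add_divide_distrib split: if_splits)
    ultimately show ?thesis using K[OF that] unfolding real_norm_def by linarith
  qed
  then show "\<exists>K. \<forall>n\<ge>K. norm ((\<Sum>s<n. real b ^ s * \<epsilon> s) / real b ^ n - 0) < r" by blast
qed

lemma poisson_generic_altered:
  assumes b: "b \<ge> 2" and z: "\<And>i. z i < b" and PG: "poisson_generic_seq b z"
    and g: "\<And>m. \<exists>S. \<forall>s\<ge>S. m \<le> g s"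
  shows "poisson_generic_seq b (altered b g z)"
  unfolding poisson_generic_seq_def
proof (intro allI impI)
  fix lam :: real and j assume lam: "lam > 0"
  define d where "d = altered b g z"
  have d: "d i < b" for i unfolding d_def by (rule altered_less[OF b z])
  have bk: "real b ^ k > 0" for k using b by simp
  define N where "N k = Suc (nat \<lfloor>lam * real b ^ k\<rfloor>)" for k
  obtain c where c: "lam + 1 < real b ^ c"
    using real_arch_pow[of "real b" "lam + 1"] b by auto
  have N: "N k \<le> b ^ (k + c)" for k
  proof -
    have "0 \<le> lam * real b ^ k" using lam by simp
    then have "real (N k) \<le> lam * real b ^ k + 1" unfolding N_def by simp
    also have "\<dots> \<le> (lam + 1) * real b ^ k" using b by (simp add: distrib_right)
    also have "\<dots> \<le> real b ^ c * real b ^ k" using c bk[of k] by (intro mult_right_mono) auto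
    finally have "real (N k) \<le> real (b ^ (k + c))" by (simp add: power_add mult.commute)
    then show ?thesis by (simp only: of_nat_le_iff)
  qed
  define S where "S k = {i. i < N k \<and> window b d k i \<noteq> window b z k i}" for k
  have le: "norm (Z b lam j k d - Z b lam j k z) \<le> 2 * (real (card (S k)) / real b ^ k)" for k
  proof -
    have "finite (S k)" unfolding S_def by simp
    then have "\<bar>real (freq b d k (N k) j) - real (freq b z k (N k) j)\<bar> \<le> 2 * real (card (S k))"
      by (rule freq_diff_le) (simp add: S_def)
    then have "\<bar>real (freq b d k (N k) j) - real (freq b z k (N k) j)\<bar> / real b ^ k \<le> 2 * real (card (S k)) / real b ^ k"
      using bk[of k] by (intro divide_right_mono) auto
    then show ?thesis
      using Z_eq_freq[of d b lam j k, OF d lam] Z_eq_freq[of z b lam j k, OF z lam] bk[of k]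
      by (simp add: N_def diff_divide_distrib[symmetric])
  qed
  define \<epsilon> where "\<epsilon> s = 1 / real (g s + 2)" for s
  have "\<epsilon> \<longlonglongrightarrow> 0"
  proof (rule LIMSEQ_I)
    fix r :: real assume "r > 0"
    then obtain m where m: "inverse (real (Suc m)) < r" using reals_Archimedean by blast
    obtain S where S: "\<And>s. s \<ge> S \<Longrightarrow> m \<le> g s" using g by blast
    have "norm (\<epsilon> s - 0) < r" if "s \<ge> S" for s
    proof -
      have "\<epsilon> s \<le> inverse (real (Suc m))" unfolding \<epsilon>_def using S[OF that] by (simp add: field_simps)
      then show ?thesis using m by (simp add: \<epsilon>_def)
    qed
    then show "\<exists>S. \<forall>s\<ge>S. norm (\<epsilon> s - 0) < r" by blast
  qed
  then have avg: "(\<lambda>n. (\<Sum>s<n. real b ^ s * \<epsilon> s) / real b ^ n) \<longlonglongrightarrow> 0"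
    by (rule geometric_average_tendsto_0[OF b]) (simp_all add: \<epsilon>_def)
  \<comment> \<open>The scales reach up to \<open>k + c + 2\<close> while the normalization is by
    \<open>b ^ k\<close>; the shift costs only the constant factor
    \<open>b ^ (c + 2)\<close>.\<close>
  have "(\<lambda>k. (\<Sum>s<k + (c + 2). real b ^ s * \<epsilon> s) / real b ^ (k + (c + 2)) * real b ^ (c + 2)) \<longlonglongrightarrow> 0 * real b ^ (c + 2)"
    by (intro tendsto_intros LIMSEQ_ignore_initial_segment avg)
  moreover have "(\<lambda>k. (1 + real (k + c + 2) * real k) / real b ^ k) \<longlonglongrightarrow> 0"
  proof -
    have "(\<lambda>k. 1 / real b ^ k + (real k)\<^sup>2 / real b ^ k + real (c + 2) * (real k / real b ^ k)) \<longlonglongrightarrow>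
        0 + 0 + real (c + 2) * 0"
      by (intro tendsto_intros over_power_tendsto_0 b)
    moreover have "1 / real b ^ k + (real k)\<^sup>2 / real b ^ k + real (c + 2) * (real k / real b ^ k) =
        (1 + real (k + c + 2) * real k) / real b ^ k" for k
      using b by (simp add: field_simps power2_eq_square)
    ultimately show ?thesis by simp
  qed
  ultimately have "(\<lambda>k. (1 + real (k + c + 2) * real k) / real b ^ k +
      (\<Sum>s<k + (c + 2). real b ^ s * \<epsilon> s) / real b ^ (k + (c + 2)) * real b ^ (c + 2)) \<longlonglongrightarrow> 0 + 0 * real b ^ (c + 2)"
    by (intro tendsto_add)
  then have bound_lim: "(\<lambda>k. (1 + real (k + c + 2) * real k) / real b ^ k +
      (\<Sum>s<k + (c + 2). real b ^ s * \<epsilon> s) / real b ^ (k + (c + 2)) * real b ^ (c + 2)) \<longlonglongrightarrow> 0" by simp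
  have S_le: "real (card (S k)) / real b ^ k \<le> (1 + real (k + c + 2) * real k) / real b ^ k +
      (\<Sum>s<k + (c + 2). real b ^ s * \<epsilon> s) / real b ^ (k + (c + 2)) * real b ^ (c + 2)" for k
  proof -
    have "real (card (S k)) / real b ^ k \<le> (1 + real (k + c + 2) * real k + (\<Sum>s<k + c + 2. real b ^ s * \<epsilon> s)) / real b ^ k"
      unfolding S_def d_def \<epsilon>_def using bk[of k] by (intro divide_right_mono card_window_differs_le b N) auto
    also have "\<dots> = (1 + real (k + c + 2) * real k) / real b ^ k +
      (\<Sum>s<k + (c + 2). real b ^ s * \<epsilon> s) / real b ^ (k + (c + 2)) * real b ^ (c + 2)"
    proof -
      have "(A + X) / B = A / B + X / (B * C) * C" if "B \<noteq> 0" "C \<noteq> 0" for A X B C :: real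
        using that by (simp add: field_simps)
      from this[of "real b ^ k" "real b ^ (c + 2)" "1 + real (k + c + 2) * real k" "\<Sum>s<k + c + 2. real b ^ s * \<epsilon> s"]
      show ?thesis
        using b by (simp only: add.assoc power_add[of "real b" k "c + 2"]) simp
    qed
    finally show ?thesis .
  qed
  have "(\<lambda>k. real (card (S k)) / real b ^ k) \<longlonglongrightarrow> 0"
    by (rule real_tendsto_sandwich[OF _ _ tendsto_const bound_lim]) (use S_le in auto)
  then have "(\<lambda>k. 2 * (real (card (S k)) / real b ^ k)) \<longlonglongrightarrow> 0" by (rule tendsto_mult_right_zero)
  then have "(\<lambda>k. Z b lam j k d - Z b lam j k z) \<longlonglongrightarrow> 0"
    by (rule tendsto_0_le[where K = 1]) (intro always_eventually allI order_trans[OF le], simp)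
  moreover have "(\<lambda>k. Z b lam j k z) \<longlonglongrightarrow> exp (- lam) * lam ^ j / fact j"
    using PG lam unfolding poisson_generic_seq_def by blast
  ultimately have "(\<lambda>k. (Z b lam j k d - Z b lam j k z) + Z b lam j k z) \<longlonglongrightarrow> 0 + exp (- lam) * lam ^ j / fact j"
    by (rule tendsto_add)
  then show "(\<lambda>k. Z b lam j k (altered b g z)) \<longlonglongrightarrow> exp (- lam) * lam ^ j / fact j" by (simp add: d_def)
qed

text \<open>If \<open>g s = a\<close>, then the last part, of proportion \<open>1 / (a + 2)\<close>, of the first \<open>b\<^sup>s\<close> digits
  is constant, so it produces almost no new words of length \<open>s\<close>.\<close>

lemma altered_not_poisson_generic:
  assumes b: "b \<ge> 2" and z: "\<And>i. z i < b" and inf: "infinite {s. g s = a}"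
  shows "\<not> poisson_generic_seq b (altered b g z)"
proof
  define d where "d = altered b g z"
  have d: "d i < b" for i unfolding d_def by (rule altered_less[OF b z])
  have bk: "real b ^ k > 0" for k using b by simp
  \<comment> \<open>Up to rounding, the positions from \<open>l * b ^ s\<close> to
    \<open>b ^ s\<close> form the marked block of scale \<open>s\<close> whenever
    \<open>g s = a\<close>.\<close>
  define l where "l = 1 - 1 / real (a + 2)"
  have l: "0 < l" "l < 1" by (simp_all add: l_def)
  assume PG: "poisson_generic_seq b (altered b g z)"
  have lim: "(\<lambda>k. Z b lam 0 k d) \<longlonglongrightarrow> exp (- lam)" if "lam > 0" for lam
  proof -
    have "(\<lambda>k. Z b lam 0 k d) \<longlonglongrightarrow> exp (- lam) * lam ^ 0 / fact 0"
      using PG that unfolding poisson_generic_seq_def d_def by blast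
    then show ?thesis by simp
  qed
  \<comment> \<open>Poisson genericity would make the proportion of missing words drop by a positive
    constant between the parameters \<open>l\<close> and 1.\<close>
  have "(\<lambda>k. Z b l 0 k d - Z b 1 0 k d) \<longlonglongrightarrow> exp (- l) - exp (- 1)"
    by (intro tendsto_diff lim l) simp
  moreover have "(\<lambda>k. (real k + 2) / real b ^ k) \<longlonglongrightarrow> 0"
    using tendsto_add[OF over_power_tendsto_0(2)[OF b] tendsto_mult_right_zero[OF over_power_tendsto_0(1)[OF b], of 2]]
    by (simp add: add_divide_distrib)
  ultimately have "(\<lambda>k. (Z b l 0 k d - Z b 1 0 k d) - (real k + 2) / real b ^ k) \<longlonglongrightarrow> (exp (- l) - exp (- 1)) - 0"
    by (rule tendsto_diff)
  moreover have "0 < (exp (- l) - exp (- 1)) - 0" using l by simp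
  ultimately have "\<forall>\<^sub>F k in sequentially. 0 < (Z b l 0 k d - Z b 1 0 k d) - (real k + 2) / real b ^ k"
    by (rule order_tendstoD(1))
  then obtain K where K: "\<And>k. k \<ge> K \<Longrightarrow> (real k + 2) / real b ^ k < Z b l 0 k d - Z b 1 0 k d"
    unfolding eventually_sequentially by auto
  obtain s where s: "s \<ge> K" "g s = a"
    using inf unfolding infinite_nat_iff_unbounded_le by blast
  define N where "N lam = Suc (nat \<lfloor>lam * real b ^ s\<rfloor>)" for lam
  have N1: "N 1 = Suc (b ^ s)" 
    unfolding N_def using floor_of_nat[of "b ^ s"] by (metis mult_1 nat_int of_nat_power)
  have "l * real b ^ s \<le> 1 * real b ^ s" using l bk[of s] by (intro mult_right_mono) auto
  then have NN: "N l \<le> N 1" unfolding N_def by (simp add: nat_mono floor_mono)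
  have ones: "window b d s i = window b (\<lambda>_. 1) s 0" if "N l \<le> i" "i + s \<le> b ^ s" for i
  proof (rule window_cong)
    fix t assume t: "t < s"
    have "l * real b ^ s < real (i + t)"
    proof -
      have "0 \<le> l * real b ^ s" using l by simp
      then have "l * real b ^ s < real (N l)" unfolding N_def by (simp, linarith)
      then show ?thesis using that(1) by simp
    qed
    then have "real (b ^ s) - real (i + t) < real (b ^ s) / real (a + 2)"
      by (simp add: l_def left_diff_distrib)
    moreover have "i + t < b ^ s" using that t by simp
    ultimately have "real (b ^ s - (i + t)) \<le> real (b ^ s) / real (a + 2)" by (simp add: of_nat_diff)
    then have "real ((b ^ s - (i + t)) * (a + 2)) \<le> real (b ^ s)" by (simp add: field_simps)
    then have "(b ^ s - (i + t)) * (a + 2) \<le> b ^ s" by (simp only: of_nat_le_iff)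
    then have "b ^ s - (i + t) \<le> b ^ s div (a + 2)" by (simp add: less_eq_div_iff_mult_less_eq)
    then have "marked b g (i + t)"
      using \<open>i + t < b ^ s\<close> s(2) by (intro markedI[OF b, of _ s]) auto
    moreover have "i + t > 0" using that(1) by (simp add: N_def)
    ultimately show "d (i + t) = 1" by (simp add: d_def altered_def)
  qed
  \<comment> \<open>Apart from the word of ones, new words can come only from the last
    \<open>s\<close> starting positions, whose windows stick out of the block.\<close>
  have "window b d s ` {N l..<N 1} \<subseteq> insert (window b (\<lambda>_. 1) s 0) (window b d s ` {Suc (b ^ s) - s..<Suc (b ^ s)})"
  proof
    fix w assume "w \<in> window b d s ` {N l..<N 1}"
    then obtain i where i: "w = window b d s i" "N l \<le> i" "i < Suc (b ^ s)" unfolding N1 by auto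
    show "w \<in> insert (window b (\<lambda>_. 1) s 0) (window b d s ` {Suc (b ^ s) - s..<Suc (b ^ s)})"
    proof (cases "i + s \<le> b ^ s")
      case True
      then show ?thesis using ones i by simp
    next
      case False
      then have "i \<in> {Suc (b ^ s) - s..<Suc (b ^ s)}" using i by auto
      then show ?thesis using i(1) by blast
    qed
  qed
  then have "card (window b d s ` {N l..<N 1}) \<le> card (insert (window b (\<lambda>_. 1) s 0) (window b d s ` {Suc (b ^ s) - s..<Suc (b ^ s)}))"
    by (rule card_mono[rotated]) simp
  also have "\<dots> \<le> Suc (card (window b d s ` {Suc (b ^ s) - s..<Suc (b ^ s)}))"
    by (rule card_insert_le_m1) simp_all
  also have "card (window b d s ` {Suc (b ^ s) - s..<Suc (b ^ s)}) \<le> card {Suc (b ^ s) - s..<Suc (b ^ s)}"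
    by (rule card_image_le) simp
  also have "card {Suc (b ^ s) - s..<Suc (b ^ s)} \<le> s" by simp
  finally have "real (card (window b d s ` {N l..<N 1})) \<le> real s + 2" by simp
  with freq_diff_image_le[OF NN, of b d s 0]
  have "real (freq b d s (N l) 0) - real (freq b d s (N 1) 0) \<le> real s + 2" by linarith
  then have "(real (freq b d s (N l) 0) - real (freq b d s (N 1) 0)) / real b ^ s \<le> (real s + 2) / real b ^ s"
    using bk[of s] by (intro divide_right_mono) auto
  then have "Z b l 0 s d - Z b 1 0 s d \<le> (real s + 2) / real b ^ s"
    using Z_eq_freq[of d b l 0 s, OF d l(1)] Z_eq_freq[of d b 1 0 s, OF d]
    by (simp add: N_def diff_divide_distrib)
  with K[OF s(1)] show False by simp
qed

lemma recursive_altered: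
  assumes "recursive (\<lambda>x e. g x (e 0))" "recursive (\<lambda>x e. z (e 0))" "recursive A"
  shows "recursive (\<lambda>x e. altered b (g x) z (A x e))"
proof (rule recursive_subst1[where f = "\<lambda>x. altered b (g x) z", OF _ assms(3)])
  have g: "recursive (\<lambda>x e. g x (B x e))" if "recursive B" for B
    by (rule recursive_subst1[where f = g, OF assms(1) that])
  have z: "recursive (\<lambda>x e. z (B x e))" if "recursive B" for B
    by (rule recursive_subst1[where f = "\<lambda>_. z", OF assms(2) that])
  show "recursive (\<lambda>x e. altered b (g x) z (e 0))"
    unfolding altered_def marked_def by (intro recursive_intros g z)
qed

section \<open>Digits of real numbers\<close>

text \<open>Here the first digit is the most significant one, as suits the values of reals, in
  contrast to \<open>window\<close>.\<close>

definition digit_prefix :: "nat \<Rightarrow> (nat \<Rightarrow> nat) \<Rightarrow> nat \<Rightarrow> nat" where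
  "digit_prefix b d n = (\<Sum>j<n. d j * b ^ (n - Suc j))"

lemma digit_prefix_Suc: "digit_prefix b d (Suc n) = b * digit_prefix b d n + d n"
proof -
  have "(\<Sum>j<n. d j * b ^ (Suc n - Suc j)) = (\<Sum>j<n. b * (d j * b ^ (n - Suc j)))"
    by (intro sum.cong) (simp_all add: Suc_diff_Suc flip: power_Suc)
  then show ?thesis by (simp add: digit_prefix_def sum_distrib_left)
qed

lemma digit_prefix_partial_sum:
  assumes "b > 0"
  shows "(\<Sum>j<n. real (d j) / real b ^ (j + 1)) = real (digit_prefix b d n) / real b ^ n"
proof (induction n)
  case (Suc n)
  have "(\<Sum>j<Suc n. real (d j) / real b ^ (j + 1)) = real (digit_prefix b d n) / real b ^ n + real (d n) / real b ^ (n + 1)"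
    using Suc by simp
  also have "\<dots> = real (digit_prefix b d (Suc n)) / real b ^ Suc n"
    using assms by (simp add: digit_prefix_Suc field_simps)
  finally show ?case .
qed (simp add: digit_prefix_def)

text \<open>Infinitely many nonzero digits make the lower bound strict; the upper bound is attained
  when all later digits are \<open>b - 1\<close>.\<close>

lemma expansion_prefix_bounds:
  assumes b: "b \<ge> 2" and x: "base_expansion b d x"
  shows "real (digit_prefix b d n) / real b ^ n < x" "x \<le> (real (digit_prefix b d n) + 1) / real b ^ n"
proof -
  have d: "\<And>j. d j < b" and inf: "infinite {j. d j \<noteq> 0}"
    and sums: "(\<lambda>j. real (d j) / real b ^ (j + 1)) sums x"
    using x unfolding base_expansion_def by blast+
  define s where "s n = real (digit_prefix b d n) / real b ^ n" for n
  have s: "(\<Sum>j<n. real (d j) / real b ^ (j + 1)) = s n" for n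
    unfolding s_def using b by (intro digit_prefix_partial_sum) simp
  have lim: "s \<longlonglongrightarrow> x" using sums unfolding sums_def s .
  have s_Suc: "s (Suc n) = s n + real (d n) / real b ^ (n + 1)" for n
    using s[of "Suc n"] s[of n] by simp
  have mono: "s m \<le> s n" if "m \<le> n" for m n
    using that by (induction n rule: dec_induct) (auto simp: s_Suc intro: add_increasing2)
  have le: "s n \<le> x" for n by (rule LIMSEQ_le_const[OF lim]) (use mono in blast)
  obtain j where j: "j \<ge> n" "d j \<noteq> 0"
    using inf by (metis (mono_tags, lifting) finite_nat_set_iff_bounded mem_Collect_eq not_le)
  have "s n \<le> s j" using j by (intro mono)
  also have "\<dots> < s (Suc j)" using j b by (simp add: s_Suc)
  also have "\<dots> \<le> x" by (rule le)
  finally show "real (digit_prefix b d n) / real b ^ n < x" by (simp add: s_def)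
  have bound: "s m \<le> s n + 1 / real b ^ n - 1 / real b ^ m" if "n \<le> m" for m
    using that
  proof (induction m rule: dec_induct)
    case (step m)
    have "real (d m) \<le> real b - 1" using d[of m] by linarith
    then have "real (d m) / real b ^ (m + 1) \<le> (real b - 1) / real b ^ (m + 1)"
      by (intro divide_right_mono) auto
    also have "\<dots> = 1 / real b ^ m - 1 / real b ^ Suc m" using b by (simp add: field_simps)
    finally show ?case using step.IH by (simp add: s_Suc)
  qed simp
  have "x \<le> s n + 1 / real b ^ n"
  proof (rule LIMSEQ_le_const2[OF lim], intro exI allI impI)
    fix m assume "n \<le> m"
    moreover have "0 \<le> 1 / real b ^ m" by simp
    ultimately show "s m \<le> s n + 1 / real b ^ n" using bound[of m] by linarith
  qed
  then show "x \<le> (real (digit_prefix b d n) + 1) / real b ^ n" by (simp add: s_def add_divide_distrib)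
qed

text \<open>The half-open intervals between successive multiples of \<open>1 / b ^ n\<close> are
  disjoint.\<close>

lemma prefix_unique:
  assumes "b > (0::nat)" "real m / real b ^ n < x" "x \<le> (real m + 1) / real b ^ n"
    "real m' / real b ^ n < x" "x \<le> (real m' + 1) / real b ^ n"
  shows "m = m'"
proof -
  have b: "real b ^ n > 0" using assms(1) by simp
  have "real m / real b ^ n < (real m' + 1) / real b ^ n" "real m' / real b ^ n < (real m + 1) / real b ^ n"
    using assms by linarith+
  then have "real m < real m' + 1" "real m' < real m + 1"
    using b unfolding divide_less_cancel by blast+
  then show ?thesis by linarith
qed

lemma base_expansion_unique:
  assumes b: "b \<ge> 2" and "base_expansion b d x" "base_expansion b d' x"
  shows "d = d'"
proof
  fix n
  have eq: "digit_prefix b d n = digit_prefix b d' n" for n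
    using b by (intro prefix_unique[OF _ expansion_prefix_bounds[OF b assms(2)] expansion_prefix_bounds[OF b assms(3)]]) simp
  from eq[of "Suc n"] eq[of n] show "d n = d' n" by (simp add: digit_prefix_Suc)
qed

text \<open>The oracle is meant to decide the left Dedekind cut of a number; the number of multiples of
  \<open>b\<^sup>-\<^sup>n\<close> in the cut is the value of the first \<open>n\<close> digits.\<close>

definition cut_prefix :: "nat \<Rightarrow> (nat \<Rightarrow> nat) \<Rightarrow> nat \<Rightarrow> nat" where
  "cut_prefix b c n = (\<Sum>m<b ^ n. c (prod_encode (Suc m, b ^ n)))"

definition cut_digits :: "nat \<Rightarrow> (nat \<Rightarrow> nat) \<Rightarrow> nat \<Rightarrow> nat" where
  "cut_digits b c n = cut_prefix b c (Suc n) mod b"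
text \<open>With \<open>c\<close> the ceiling of \<open>x * b ^ n\<close>, exactly the multiples 1
  to \<open>c - 1\<close> lie strictly below \<open>x\<close>. The ceiling, rather than the floor,
  matches expansions that do not end in zeros.\<close>

lemma cut_prefix_bounds:
  assumes b: "b > 0" and x: "0 < x" "x < 1"
  shows "real (cut_prefix b (cut_oracle x) n) / real b ^ n < x"
    "x \<le> (real (cut_prefix b (cut_oracle x) n) + 1) / real b ^ n"
proof -
  have bn: "real b ^ n > 0" using b by simp
  define c where "c = \<lceil>x * real b ^ n\<rceil>"
  have "0 < x * real b ^ n" using x bn by simp
  then have c: "c \<ge> 1" unfolding c_def by linarith
  have "x * real b ^ n < 1 * real b ^ n" using x bn by (intro mult_strict_right_mono)
  then have "c \<le> int (b ^ n)" unfolding c_def by (simp add: ceiling_le_iff)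
  have cut: "cut_oracle x (prod_encode (Suc m, b ^ n)) = of_bool (m < nat (c - 1))" for m
  proof -
    have "real (Suc m) / real (b ^ n) < x \<longleftrightarrow> real (Suc m) < x * real b ^ n"
      using bn by (simp add: divide_less_eq)
    also have "\<dots> \<longleftrightarrow> int (Suc m) < c" unfolding c_def by (simp add: less_ceiling_iff)
    also have "\<dots> \<longleftrightarrow> m < nat (c - 1)" using c by linarith
    finally show ?thesis using x unfolding cut_oracle_def by simp
  qed
  have "{m. m < b ^ n \<and> m < nat (c - 1)} = {..<nat (c - 1)}"
  proof -
    have "m < b ^ n" if "m < nat (c - 1)" for m
      using \<open>c \<le> int (b ^ n)\<close> that by linarith
    then show ?thesis by auto
  qed
  then have "cut_prefix b (cut_oracle x) n = nat (c - 1)"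
    unfolding cut_prefix_def cut by (simp add: of_bool_def sum.If_cases Int_def)
  then have T: "real (cut_prefix b (cut_oracle x) n) = of_int c - 1" using c by simp
  have "of_int c - 1 < x * real b ^ n" "x * real b ^ n \<le> of_int c" unfolding c_def by linarith+
  then show "real (cut_prefix b (cut_oracle x) n) / real b ^ n < x"
    "x \<le> (real (cut_prefix b (cut_oracle x) n) + 1) / real b ^ n"
    unfolding T using bn by (simp_all add: field_simps)
qed

text \<open>Dropping the last digit of a prefix leaves a number that satisfies the interval
  condition one level below, so uniqueness makes the prefixes coherent. Finitely many nonzero digits
  would make \<open>x\<close> equal to one of its strict lower bounds.\<close>

lemma base_expansion_cut_digits:
  assumes b: "b \<ge> 2" and x: "0 < x" "x < 1"
  shows "base_expansion b (cut_digits b (cut_oracle x)) x"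
proof -
  define T where "T = cut_prefix b (cut_oracle x)"
  define d where "d = cut_digits b (cut_oracle x)"
  have b0: "b > 0" using b by simp
  note T_bounds = cut_prefix_bounds[OF b0 x, folded T_def]
  have "T 0 = 0" using T_bounds(1)[of 0] x by simp
  have T_div: "T (Suc n) div b = T n" for n
  proof (rule prefix_unique[OF b0 _ _ T_bounds])
    define q where "q = T (Suc n) div b"
    have q: "b * q \<le> T (Suc n)" "T (Suc n) + 1 \<le> b * (q + 1)"
      unfolding q_def using b0 dividend_less_times_div[of b "T (Suc n)"] by simp_all
    have "real q / real b ^ n = real (b * q) / real b ^ Suc n" using b0 by simp
    also have "\<dots> \<le> real (T (Suc n)) / real b ^ Suc n" using q(1) by (intro divide_right_mono) (simp_all only: of_nat_le_iff, simp)
    also have "\<dots> < x" by (rule T_bounds)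
    finally show "real q / real b ^ n < x" .
    have "x \<le> (real (T (Suc n)) + 1) / real b ^ Suc n" by (rule T_bounds)
    also have "\<dots> = real (T (Suc n) + 1) / real b ^ Suc n" by simp
    also have "\<dots> \<le> real (b * (q + 1)) / real b ^ Suc n" using q(2) by (intro divide_right_mono) (simp_all only: of_nat_le_iff, simp)
    also have "\<dots> = (real q + 1) / real b ^ n" using b0 by (simp add: field_simps)
    finally show "x \<le> (real q + 1) / real b ^ n" .
  qed
  have prefix: "digit_prefix b d n = T n" for n
  proof (induction n)
    case 0
    then show ?case using \<open>T 0 = 0\<close> by (simp add: digit_prefix_def)
  next
    case (Suc n)
    have "T (Suc n) = b * (T (Suc n) div b) + T (Suc n) mod b" by simp
    then show ?case unfolding digit_prefix_Suc Suc T_div by (simp add: d_def cut_digits_def T_def)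
  qed
  have inverse_lim: "(\<lambda>n. 1 / real b ^ n) \<longlonglongrightarrow> 0"
    using LIMSEQ_power_zero[of "1 / real b"] b by (simp add: power_divide)
  have "(\<lambda>n. real (T n) / real b ^ n) \<longlonglongrightarrow> x"
  proof (rule real_tendsto_sandwich)
    show "(\<lambda>n. x - 1 / real b ^ n) \<longlonglongrightarrow> x" using tendsto_diff[OF tendsto_const inverse_lim, of x] by simp
    show "\<forall>\<^sub>F n in sequentially. x - 1 / real b ^ n \<le> real (T n) / real b ^ n"
      using T_bounds(2) by (intro always_eventually allI) (simp add: add_divide_distrib diff_le_eq)
    show "\<forall>\<^sub>F n in sequentially. real (T n) / real b ^ n \<le> x"
      using T_bounds(1) by (intro always_eventually allI less_imp_le)
  qed (rule tendsto_const)
  then have sums: "(\<lambda>j. real (d j) / real b ^ (j + 1)) sums x"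
    unfolding sums_def digit_prefix_partial_sum[OF b0] prefix .
  have "infinite {j. d j \<noteq> 0}"
  proof
    assume "finite {j. d j \<noteq> 0}"
    then have "(\<Sum>j\<in>{j. d j \<noteq> 0}. real (d j) / real b ^ (j + 1)) = x"
      using sums_unique2[OF sums_finite sums, of "{j. d j \<noteq> 0}"] by auto
    moreover obtain n where "\<forall>j\<in>{j. d j \<noteq> 0}. j < n"
      using \<open>finite {j. d j \<noteq> 0}\<close> unfolding finite_nat_set_iff_bounded by blast
    then have "(\<Sum>j\<in>{j. d j \<noteq> 0}. real (d j) / real b ^ (j + 1)) = (\<Sum>j<n. real (d j) / real b ^ (j + 1))"
      by (intro sum.mono_neutral_left) auto
    ultimately have "x = real (T n) / real b ^ n"
      unfolding digit_prefix_partial_sum[OF b0] prefix by simp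
    then show False using T_bounds(1)[of n] by simp
  qed
  then show ?thesis
    unfolding base_expansion_def using sums b0 by (simp add: d_def cut_digits_def)
qed

lemma mem_poisson_generic_reals_iff:
  assumes b: "b \<ge> 2"
  shows "x \<in> poisson_generic_reals b \<longleftrightarrow>
    x \<in> {0<..<1} \<and> poisson_generic_seq b (cut_digits b (cut_oracle x))"
proof -
  have pos: "x > 0" if "base_expansion b d x" for d
    using expansion_prefix_bounds(1)[OF b that, of 0] by (simp add: digit_prefix_def)
  have unique: "d = cut_digits b (cut_oracle x)" if "base_expansion b d x" "x \<in> {0<..<1}" for d
    using base_expansion_unique[OF b that(1) base_expansion_cut_digits[OF b]] that(2) by simp
  show ?thesis
  proof
    assume "x \<in> poisson_generic_reals b"
    then obtain d where d: "x < 1" "base_expansion b d x" "poisson_generic_seq b d"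
      unfolding poisson_generic_reals_def by auto
    then have "x \<in> {0<..<1}" using pos by simp
    with d(2,3) unique show "x \<in> {0<..<1} \<and> poisson_generic_seq b (cut_digits b (cut_oracle x))"
      by blast
  next
    assume "x \<in> {0<..<1} \<and> poisson_generic_seq b (cut_digits b (cut_oracle x))"
    moreover from this have "base_expansion b (cut_digits b (cut_oracle x)) x"
      by (intro base_expansion_cut_digits b) auto
    ultimately show "x \<in> poisson_generic_reals b"
      unfolding poisson_generic_reals_def by auto
  qed
qed

text \<open>Rounding a prefix of \<open>n + 1\<close> digits to denominator \<open>2 ^ n\<close> has
  two errors of at most half a unit: the rounding itself, and the unread digits, since
  \<open>2 ^ n / b ^ (n + 1) \<le> 1 / 2\<close>. Even codes stand for nonnegative integers, hence
  the output \<open>2 * c x n\<close>.\<close>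

lemma computable_map_expansion:
  assumes b: "b \<ge> 2" and rec: "recursive (\<lambda>x e. d x (e 0))" and d: "\<And>x. base_expansion b (d x) (f x)"
  shows "computable_map f"
proof -
  define c where "c x n = (2 ^ Suc n * digit_prefix b (d x) (Suc n) + b ^ Suc n) div (2 * b ^ Suc n)" for x n
  have b0: "b > 0" using b by simp
  have d': "recursive (\<lambda>x e. d x (A x e))" if "recursive A" for A
    by (rule recursive_subst1[where f = d, OF rec that])
  have "recursive (\<lambda>x e. 2 * c x (e 0))"
    unfolding c_def digit_prefix_def by (intro recursive_intros d')
  then obtain p where p: "\<And>x n. eval x p [n] (2 * c x n)"
    using recursive_program[of "\<lambda>x n. 2 * c x n"] by blast
  have "\<bar>f x - of_int (int_decode (2 * c x n)) / 2 ^ n\<bar> \<le> 1 / 2 ^ n" for x n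
  proof -
    define P where "P = digit_prefix b (d x) (Suc n)"
    define B where "B = real b ^ Suc n"
    have B: "B > 0" "2 ^ Suc n \<le> B" unfolding B_def using b0 b by (simp, intro power_mono) auto
    have "int_decode (2 * c x n) = int (c x n)"
      by (simp add: int_decode_def sum_decode_def)
    moreover have "real (c x n) \<le> 2 ^ n * (real P / B) + 1 / 2 \<and> 2 ^ n * (real P / B) + 1 / 2 < real (c x n) + 1"
    proof -
      define D where "D = 2 * b ^ Suc n"
      define X where "X = 2 ^ Suc n * P + b ^ Suc n"
      have D: "D > 0" using b0 by (simp add: D_def)
      have "c x n * D \<le> X" "X < (c x n + 1) * D"
        unfolding c_def P_def[symmetric] X_def[symmetric] D_def[symmetric]
        using D by (simp, metis Suc_eq_plus1 dividend_less_div_times add.commute mult_Suc)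
      then have "real (c x n * D) \<le> real X" "real X < real ((c x n + 1) * D)"
        by (simp_all only: of_nat_le_iff of_nat_less_iff)
      then have "real (c x n) \<le> real X / real D" "real X / real D < real (c x n) + 1"
        using D by (simp_all add: field_simps)
      moreover have "real X / real D = 2 ^ n * (real P / B) + 1 / 2"
        using b0 by (simp add: X_def D_def B_def field_simps)
      ultimately show ?thesis by simp
    qed
    moreover have "2 ^ n * (real P / B) < 2 ^ n * f x" "2 ^ n * f x \<le> 2 ^ n * (real P / B) + 1 / 2"
    proof -
      have bounds: "real P / B < f x" "f x \<le> (real P + 1) / B"
        unfolding P_def B_def by (rule expansion_prefix_bounds[OF b d])+
      show "2 ^ n * (real P / B) < 2 ^ n * f x" using bounds(1) by (rule mult_strict_left_mono) simp
      have "2 ^ n * f x \<le> 2 ^ n * ((real P + 1) / B)" using bounds by (intro mult_left_mono) auto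
      also have "\<dots> = 2 ^ n * (real P / B) + 2 ^ n / B" by (simp add: add_divide_distrib distrib_left)
      also have "2 ^ n / B \<le> 1 / 2" using B by (simp add: divide_le_eq)
      finally show "2 ^ n * f x \<le> 2 ^ n * (real P / B) + 1 / 2" by simp
    qed
    ultimately have "\<bar>2 ^ n * f x - real (c x n)\<bar> \<le> 1" by linarith
    then have "\<bar>2 ^ n * f x - real (c x n)\<bar> / 2 ^ n \<le> 1 / 2 ^ n" by (intro divide_right_mono) auto
    moreover have "f x - real (c x n) / 2 ^ n = (2 ^ n * f x - real (c x n)) / 2 ^ n" by (simp add: diff_divide_distrib)
    ultimately show ?thesis using \<open>int_decode (2 * c x n) = int (c x n)\<close> by simp
  qed
  with p show ?thesis unfolding computable_map_def by blast
qed

section \<open>Completeness\<close>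

lemma Pi_real_poisson_generic:
  assumes b: "b \<ge> 2"
  shows "Pi_real 3 (poisson_generic_reals b)"
proof -
  \<comment> \<open>\<open>a\<close> codes the quadruple \<open>((p, q), (j, m))\<close>; the bound
    is stated as a negated strict inequality to fit \<open>less_mult_imbalance_iff\<close>.\<close>
  define R where "R x a K k \<longleftrightarrow> K \<le> k \<longrightarrow> \<not> real (b ^ k) <
    real (snd (prod_decode (snd (prod_decode a)))) *
      \<bar>imbalance b (cut_digits b x) k (Suc (fst (prod_decode (fst (prod_decode a)))))
        (Suc (snd (prod_decode (fst (prod_decode a))))) (fst (prod_decode (snd (prod_decode a))))\<bar>"
    for x a K k
  have "decidable (\<lambda>x e. R x (e 0) (e 1) (e 2))"
    unfolding R_def less_mult_imbalance_iff freq_def occ_def window_def cut_digits_def cut_prefix_def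
    by (intro recursive_intros)
  moreover have "x \<in> poisson_generic_reals b \<longleftrightarrow> x \<in> {0<..<1} \<and> (\<forall>a. \<exists>K. \<forall>k. R (cut_oracle x) a K k)" for x
  proof -
    have digits: "cut_digits b (cut_oracle x) i < b" for i using b by (simp add: cut_digits_def)
    have "poisson_generic_seq b (cut_digits b (cut_oracle x)) \<longleftrightarrow> (\<forall>a. \<exists>K. \<forall>k. R (cut_oracle x) a K k)"
    proof
      assume "poisson_generic_seq b (cut_digits b (cut_oracle x))"
      then show "\<forall>a. \<exists>K. \<forall>k. R (cut_oracle x) a K k"
        unfolding poisson_generic_seq_iff[of "cut_digits b (cut_oracle x)", OF digits b] R_def
        by (metis not_le of_nat_power)
    next
      assume *: "\<forall>a. \<exists>K. \<forall>k. R (cut_oracle x) a K k"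
      have "\<exists>K. \<forall>k\<ge>K. real m * \<bar>imbalance b (cut_digits b (cut_oracle x)) k (Suc p) (Suc q) j\<bar> \<le> real b ^ k"
        for p q j m
        using *[rule_format, of "prod_encode (prod_encode (p, q), prod_encode (j, m))"] unfolding R_def
        by (simp add: not_less)
      then show "poisson_generic_seq b (cut_digits b (cut_oracle x))"
        unfolding poisson_generic_seq_iff[of "cut_digits b (cut_oracle x)", OF digits b] by blast
    qed
    then show ?thesis unfolding mem_poisson_generic_reals_iff[OF b] by simp
  qed
  ultimately show ?thesis by (rule Pi_real_3I)
qed

text \<open>Every fixed choice of \<open>p\<close>, \<open>q\<close>, \<open>j\<close> and
  \<open>m\<close> falls into the range inspected by \<open>irregular\<close> as soon as
  \<open>k\<close> is large.\<close>

lemma poisson_generic_greedy_seq: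
  assumes b: "b \<ge> 2"
  obtains k0 where "poisson_generic_seq b (greedy_seq b k0)"
proof -
  obtain k0 where k0: "\<And>k. k \<ge> k0 \<Longrightarrow> \<not> irregular b k (greedy_seq b k0)"
    using greedy_seq_regular[OF b] by blast
  have z: "greedy_seq b k0 i < b" for i using b by (intro greedy_seq_less) simp
  have "poisson_generic_seq b (greedy_seq b k0)"
    unfolding poisson_generic_seq_iff[of "greedy_seq b k0", OF z b]
  proof (intro allI)
    fix p q j m
    have "real m * \<bar>imbalance b (greedy_seq b k0) k (Suc p) (Suc q) j\<bar> \<le> real b ^ k"
      if k: "k \<ge> k0 + p + q + j + m + 1" for k
    proof -
      have "real m * \<bar>imbalance b (greedy_seq b k0) k (Suc p) (Suc q) j\<bar> \<le>
          real k * \<bar>imbalance b (greedy_seq b k0) k (Suc p) (Suc q) j\<bar>"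
        using k by (intro mult_right_mono) auto
      also have "\<dots> \<le> real b ^ k"
      proof -
        have "p < k" "q < k" "j < k" "k0 \<le> k" using k by simp_all
        then show ?thesis using k0[of k] unfolding irregular_def by (meson not_le)
      qed
      finally show ?thesis .
    qed
    then show "\<exists>K. \<forall>k\<ge>K. real m * \<bar>imbalance b (greedy_seq b k0) k (Suc p) (Suc q) j\<bar> \<le> real b ^ k" by blast
  qed
  then show ?thesis by (rule that)
qed

lemma poisson_generic_altered_iff:
  assumes b: "b \<ge> 2" and z: "\<And>i. z i < b" and PG: "poisson_generic_seq b z"
  shows "poisson_generic_seq b (altered b g z) \<longleftrightarrow> (\<forall>m. \<exists>S. \<forall>s\<ge>S. m \<le> g s)"
proof
  assume *: "poisson_generic_seq b (altered b g z)"
  show "\<forall>m. \<exists>S. \<forall>s\<ge>S. m \<le> g s"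
  proof (rule ccontr)
    assume "\<not> ?thesis"
    then obtain m where "\<And>S. \<exists>s\<ge>S. g s < m" by (meson not_le)
    then have "infinite {s. g s < m}" unfolding infinite_nat_iff_unbounded_le by blast
    \<comment> \<open>Pigeonhole: infinitely many scales with values below \<open>m\<close> take
      some single value infinitely often.\<close>
    moreover have "{s. g s < m} = (\<Union>a<m. {s. g s = a})" by auto
    ultimately obtain a where "infinite {s. g s = a}" by auto
    from altered_not_poisson_generic[of b z g a, OF b z this] * show False by blast
  qed
qed (use poisson_generic_altered[OF b z PG] in blast)

lemma Pi_baire_3_reducible:
  assumes b: "b \<ge> 2" and B: "Pi_baire 3 B"
  obtains f where "computable_map f" "\<And>x. x \<in> B \<longleftrightarrow> f x \<in> poisson_generic_reals b"
proof -
  obtain g where g: "recursive (\<lambda>x e. g x (e 0))" "\<And>x s. g x s \<le> s"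
    "\<And>x. x \<in> B \<longleftrightarrow> (\<forall>m. \<exists>S. \<forall>s\<ge>S. m \<le> g x s)"
    using B by (rule Pi_baire_3_reduction) blast
  obtain k0 where PG: "poisson_generic_seq b (greedy_seq b k0)"
    using b by (rule poisson_generic_greedy_seq)
  define z where "z = greedy_seq b k0"
  have z: "z i < b" for i using b unfolding z_def by (intro greedy_seq_less) simp
  define d where "d x = altered b (g x) z" for x
  define f where "f x = (\<Sum>j. real (d x j) / real b ^ (j + 1))" for x
  have d: "d x i < b" for x i unfolding d_def by (rule altered_less[OF b z])
  have expansion: "base_expansion b (d x) (f x)" for x
    unfolding base_expansion_def
  proof (intro conjI allI d)
    show "infinite {j. d x j \<noteq> 0}" unfolding d_def by (rule infinite_altered_nonzero[OF b g(2)])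
    have "summable (\<lambda>j. real (d x j) / real b ^ (j + 1))"
    proof (rule summable_comparison_test')
      show "summable (\<lambda>j. (1 / real b) ^ j)" using b by (intro summable_geometric) simp
      fix j
      have "real (d x j) \<le> real b" using d[of x j] by simp
      then show "norm (real (d x j) / real b ^ (j + 1)) \<le> (1 / real b) ^ j"
        using b by (simp add: power_divide field_simps)
    qed
    then show "(\<lambda>j. real (d x j) / real b ^ (j + 1)) sums f x" unfolding f_def by (rule summable_sums)
  qed
  have rec: "recursive (\<lambda>x e. d x (e 0))"
    unfolding d_def z_def by (intro recursive_altered g(1) recursive_greedy_seq recursive_var)
  have "x \<in> B \<longleftrightarrow> f x \<in> poisson_generic_reals b" for x
  proof -
    have "f x > 0" using expansion_prefix_bounds(1)[OF b expansion, of x 0] by (simp add: digit_prefix_def)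
    moreover have "f x \<le> 1 / real b"
      using expansion_prefix_bounds(2)[OF b expansion, of x 1] by (simp add: digit_prefix_def d_def altered_def)
    moreover have "1 / real b < 1" using b by (simp add: divide_less_eq)
    ultimately have f: "f x \<in> {0..<1}" by (simp del: of_nat_less_iff)
    have "f x \<in> poisson_generic_reals b \<longleftrightarrow> poisson_generic_seq b (d x)"
      unfolding poisson_generic_reals_def using f expansion[of x] base_expansion_unique[OF b expansion[of x]] by blast
    also have "\<dots> \<longleftrightarrow> x \<in> B"
      unfolding d_def g(3) using b z PG[folded z_def] by (rule poisson_generic_altered_iff)
    finally show ?thesis by simp
  qed
  with computable_map_expansion[OF b rec expansion] show ?thesis by (rule that)
qed

theorem theorem3:
  fixes b :: nat
  assumes "b \<ge> 2"
  shows "effectively_Pi_complete 3 (poisson_generic_reals b)"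
  unfolding effectively_Pi_complete_def
  using Pi_real_poisson_generic[OF assms] Pi_baire_3_reducible[OF assms] by metis

end
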